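(* Let $1<p<r\le2$ and $D>0$. Let $\mathcal X$ be an $(r,D)$-smooth separable real Banach space and let $X\in L^p(\Omega,\mathcal F,\mathbb P,\mathcal X)$ be a regular random variable. Assume moreover that $$\|X\|_{H_p}:=\sum_{n\in\mathbb Z}\|P_nX\|_{p,\mathcal X}<\infty.$$ Then there exists a universal constant $C_{p,r}>0$ (depending only on $p$ and $r$) such that $$\|\mathcal M_p(X)\|_{p,\infty}\le C_{p,r}\,D^{r/p}\,\|X\|_{H_p}.$$ Moreover, $|S_n(X)|_{\mathcal X}/n^{1/p}\to0$ $\mathbb P$-a.s. as $n\to\infty$.
   Context: Setting: $(\Omega,\mathcal F,\mathbb P)$ is a probability space, $\theta:\Omega\to\Omega$ is an invertible bi-measurable measure-preserving transformation, $\mathcal F_0\subset\mathcal F$ is a $\sigma$-algebra with $\mathcal F_0\subset\theta^{-1}(\mathcal F_0)$, and $\mathcal F_n:=\theta^{-n}(\mathcal F_0)$ for $n\in\mathbb Z$; $\mathcal F_{-\infty}:=\bigcap_{n\in\mathbb Z}\mathcal F_n$, $\mathcal F_\infty:=\bigvee_{n\in\mathbb Z}\mathcal F_n$. Write $\mathbb E_n(\cdot)=\mathbb E(\cdot\mid\mathcal F_n)$ for $n\in\mathbb Z\cup\{\pm\infty\}$ and $P_n:=\mathbb E_n-\mathbb E_{n-1}$ for $n\in\mathbb Z$. A variable $X\in L^1(\Omega,\mathcal X)$ is regular if $\mathbb E_{-\infty}(X)=0$ and $X-\mathbb E_\infty(X)=0$. $\|Z\|_{p,\mathcal X}:=(\mathbb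 E|Z|_{\mathcal X}^p)^{1/p}$ is the Bochner $L^p$-norm; for real-valued $Z$, $\|Z\|_{p,\infty}:=\sup_{t>0}t\,\mathbb P(|Z|>t)^{1/p}$. $S_n(X):=\sum_{i=0}^{n-1}X\circ\theta^i$ and, for $1\le p<2$, $\mathcal M_p(X):=\sup_{n\ge1}|S_n(X)|_{\mathcal X}/n^{1/p}$. $r$-smoothness: for $1<r\le2$, $\mathcal X$ is $r$-smooth if there is $\Lambda\ge1$ with $|x+y|_{\mathcal X}^r+|x-y|_{\mathcal X}^r\le2(|x|_{\mathcal X}^r+\Lambda^r|y|_{\mathcal X}^r)$ for all $x,y\in\mathcal X$. It is $(r,D)$-smooth if it is $r$-smooth and $D$ is a constant such that $\mathbb E(|d_1+\cdots+d_N|_{\mathcal X}^r)\le D^r\sum_{n=1}^N\mathbb E(|d_n|_{\mathcal X}^r)$ for every finite sequence $(d_n)_{1\le n\le N}$ of $\mathcal X$-valued martingale differences. *)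

theory Defs
  imports "HOL-Probability.Probability"
begin

text \<open>Conditional expectations of Banach-valued variables. As in
  \<^theory>\<open>HOL-Probability.Conditional_Expectation\<close>, a sub-\<open>\<sigma>\<close>-algebra is a measure \<open>F\<close> with
  \<open>subalgebra M F\<close>, of which only the space and the measurable sets matter.
  A version of the conditional expectation exists for every integrable \<open>X\<close> and is unique up to
  null sets, so \<open>cond_exp M F X\<close> is one fixed version of it.\<close>

definition has_cond_exp ::
  "'a measure \<Rightarrow> 'a measure \<Rightarrow> ('a \<Rightarrow> 'b::{banach, second_countable_topology}) \<Rightarrow> ('a \<Rightarrow> 'b) \<Rightarrow> bool"
  where "has_cond_exp M F X Y \<longleftrightarrow>
    Y \<in> borel_measurable F \<and> integrable M Y \<and>
    (\<forall>A\<in>sets F. (LINT \<omega>:A|M. Y \<omega>) = (LINT \<omega>:A|M. X \<omega>))"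

definition cond_exp ::
  "'a measure \<Rightarrow> 'a measure \<Rightarrow> ('a \<Rightarrow> 'b::{banach, second_countable_topology}) \<Rightarrow> 'a \<Rightarrow> 'b"
  where "cond_exp M F X = (SOME Y. has_cond_exp M F X Y)"


definition invertible_mpt :: "'a measure \<Rightarrow> ('a \<Rightarrow> 'a) \<Rightarrow> bool"
  where "invertible_mpt M \<theta> \<longleftrightarrow>
    bij_betw \<theta> (space M) (space M) \<and>
    \<theta> \<in> measurable M M \<and> inv_into (space M) \<theta> \<in> measurable M M \<and>
    distr M M \<theta> = M"

definition int_iter :: "'a measure \<Rightarrow> ('a \<Rightarrow> 'a) \<Rightarrow> int \<Rightarrow> 'a \<Rightarrow> 'a"
  where "int_iter M \<theta> n =
    (if 0 \<le> n then \<theta> ^^ nat n else inv_into (space M) \<theta> ^^ nat (- n))"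

definition filt :: "'a measure \<Rightarrow> ('a \<Rightarrow> 'a) \<Rightarrow> 'a measure \<Rightarrow> int \<Rightarrow> 'a measure"
  where "filt M \<theta> F0 n = vimage_algebra (space M) (int_iter M \<theta> n) F0"

definition filt_minf :: "'a measure \<Rightarrow> ('a \<Rightarrow> 'a) \<Rightarrow> 'a measure \<Rightarrow> 'a measure"
  where "filt_minf M \<theta> F0 = sigma (space M) (\<Inter>n. sets (filt M \<theta> F0 n))"

definition filt_inf :: "'a measure \<Rightarrow> ('a \<Rightarrow> 'a) \<Rightarrow> 'a measure \<Rightarrow> 'a measure"
  where "filt_inf M \<theta> F0 = sigma (space M) (\<Union>n. sets (filt M \<theta> F0 n))"

definition proj_P ::
  "'a measure \<Rightarrow> ('a \<Rightarrow> 'a) \<Rightarrow> 'a measure \<Rightarrow> int \<Rightarrow>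
    ('a \<Rightarrow> 'b::{banach, second_countable_topology}) \<Rightarrow> 'a \<Rightarrow> 'b"
  where "proj_P M \<theta> F0 n X \<omega> =
    cond_exp M (filt M \<theta> F0 n) X \<omega> - cond_exp M (filt M \<theta> F0 (n - 1)) X \<omega>"

definition regular ::
  "'a measure \<Rightarrow> ('a \<Rightarrow> 'a) \<Rightarrow> 'a measure \<Rightarrow>
    ('a \<Rightarrow> 'b::{banach, second_countable_topology}) \<Rightarrow> bool"
  where "regular M \<theta> F0 X \<longleftrightarrow>
    integrable M X \<and>
    (AE \<omega> in M. cond_exp M (filt_minf M \<theta> F0) X \<omega> = 0) \<and>
    (AE \<omega> in M. X \<omega> - cond_exp M (filt_inf M \<theta> F0) X \<omega> = 0)"


definition Lp_norm :: "real \<Rightarrow> 'a measure \<Rightarrow> ('a \<Rightarrow> 'b::real_normed_vector) \<Rightarrow> ennreal"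
  where "Lp_norm p M Z =
    (let I = (\<integral>\<^sup>+ \<omega>. ennreal (norm (Z \<omega>) powr p) \<partial>M)
     in if I = \<infinity> then \<infinity> else ennreal (enn2real I powr (1 / p)))"

definition in_Lp :: "real \<Rightarrow> 'a measure \<Rightarrow> ('a \<Rightarrow> 'b::real_normed_vector) \<Rightarrow> bool"
  where "in_Lp p M Z \<longleftrightarrow> Z \<in> borel_measurable M \<and> Lp_norm p M Z < \<infinity>"

definition weak_Lp_norm :: "real \<Rightarrow> 'a measure \<Rightarrow> ('a \<Rightarrow> ennreal) \<Rightarrow> ennreal"
  where "weak_Lp_norm p M Z =
    (SUP t\<in>{0<..}. ennreal (t * measure M {\<omega>\<in>space M. ennreal t < Z \<omega>} powr (1 / p)))"

definition Hp_norm ::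
  "real \<Rightarrow> 'a measure \<Rightarrow> ('a \<Rightarrow> 'a) \<Rightarrow> 'a measure \<Rightarrow>
    ('a \<Rightarrow> 'b::{banach, second_countable_topology}) \<Rightarrow> ennreal"
  where "Hp_norm p M \<theta> F0 X = (\<Sum>\<^sub>\<infinity>n\<in>(UNIV :: int set). Lp_norm p M (proj_P M \<theta> F0 n X))"

definition S_sum :: "('a \<Rightarrow> 'a) \<Rightarrow> nat \<Rightarrow> ('a \<Rightarrow> 'b::real_normed_vector) \<Rightarrow> 'a \<Rightarrow> 'b"
  where "S_sum \<theta> n X \<omega> = (\<Sum>i<n. X ((\<theta> ^^ i) \<omega>))"

definition max_op :: "real \<Rightarrow> ('a \<Rightarrow> 'a) \<Rightarrow> ('a \<Rightarrow> 'b::real_normed_vector) \<Rightarrow> 'a \<Rightarrow> ennreal"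
  where "max_op p \<theta> X \<omega> =
    (SUP n\<in>{1..}. ennreal (norm (S_sum \<theta> n X \<omega>) / real n powr (1 / p)))"


definition r_smooth :: "'b::real_normed_vector itself \<Rightarrow> real \<Rightarrow> bool"
  where "r_smooth _ r \<longleftrightarrow>
    (\<exists>\<Lambda>\<ge>1. \<forall>x y :: 'b.
      norm (x + y) powr r + norm (x - y) powr r
        \<le> 2 * (norm x powr r + \<Lambda> powr r * norm y powr r))"

definition martingale_differences ::
  "'a measure \<Rightarrow> nat \<Rightarrow> (nat \<Rightarrow> 'a \<Rightarrow> 'b::{banach, second_countable_topology}) \<Rightarrow> bool"
  where "martingale_differences M N d \<longleftrightarrow>
    (\<exists>G :: nat \<Rightarrow> 'a measure.
      (\<forall>n\<le>N. subalgebra M (G n)) \<and>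
      (\<forall>n<N. sets (G n) \<subseteq> sets (G (Suc n))) \<and>
      (\<forall>n\<in>{1..N}. d n \<in> borel_measurable (G n) \<and> integrable M (d n) \<and>
         (AE \<omega> in M. cond_exp M (G (n - 1)) (d n) \<omega> = 0)))"

text \<open>HOL cannot quantify over the type carrying the probability space inside a formula.
  Letting \<open>Q\<close> range over all probability measures, on arbitrary \<open>\<sigma>\<close>-algebras, of the type
  \<open>nat \<Rightarrow> 'b\<close> loses nothing: if \<open>d\<^sub>1, \<dots>, d\<^sub>N\<close> are martingale differences
  on any probability space, the coordinates under their joint law are martingale differences
  on this type, with the same moments.\<close>

definition rD_smooth :: "'b::{banach, second_countable_topology} itself \<Rightarrow> real \<Rightarrow> real \<Rightarrow> bool"
  where "rD_smooth T r D \<longleftrightarrow>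
    r_smooth T r \<and>
    (\<forall>(Q :: (nat \<Rightarrow> 'b) measure) (N :: nat) (d :: nat \<Rightarrow> (nat \<Rightarrow> 'b) \<Rightarrow> 'b).
      prob_space Q \<longrightarrow> martingale_differences Q N d \<longrightarrow>
      (\<integral>\<^sup>+ \<omega>. ennreal (norm (\<Sum>n=1..N. d n \<omega>) powr r) \<partial>Q)
        \<le> ennreal (D powr r) * (\<Sum>n=1..N. (\<integral>\<^sup>+ \<omega>. ennreal (norm (d n \<omega>) powr r) \<partial>Q)))"


text \<open>The universal constant. In HOL an existential quantifier over a constant stands inside the
  implicit quantification over types, so \<open>\<exists>C\<close> in a theorem about a type \<open>'b\<close> of values and a type
  \<open>'a\<close> of outcomes would allow \<open>C\<close> to depend on the Banach space and would void the stated
  dependence on \<open>D\<close>. Uniformity is expressed by a closed term in \<open>p\<close> and \<open>r\<close> instead.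

  No optimality is intended. Truncating stationary martingale differences \<open>d \<circ> \<theta>\<^sup>i\<close> at
  \<open>t i\<^bsup>1/p\<^esup>\<close> and applying Doob's inequality on dyadic blocks gives
  \<open>t\<^sup>p P(M\<^sub>p(d) > t) \<le> 2\<^sup>p (1 + p/(p-1) + 32 r/(r-p)) D\<^sup>r E|d|\<^sup>p\<close>.
  Countable subadditivity of the weak norm costs a further factor \<open>p/(p-1)\<close>.
  In total at most \<open>536 / ((p-1)\<^sup>2 (r-p))\<close> is needed.\<close>

definition C_univ :: "real \<Rightarrow> real \<Rightarrow> real"
  where "C_univ p r = 10000 / ((p - 1)\<^sup>2 * (r - p))"

end

theory Submission
  imports Defs "HOL-Real_Asymp.Real_Asymp"
begin

text \<open>Fix \<open>k\<close> and put \<open>d = P\<^sub>k X\<close>. The orbit \<open>d \<circ> \<theta>\<^sup>i\<close> is a sequence of identically distributed martingale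
differences for the filtration \<open>F\<^bsub>k+i\<^esub>\<close>, and a regular \<open>X\<close> is the sum of the \<open>P\<^sub>k X\<close>. So the theorem
reduces to a weak-type inequality and an almost sure convergence statement for one such
orbit, plus a countable triangle inequality for the weak \<open>L\<^sup>p\<close> norm.

For one orbit write \<open>Y\<^sub>i = d \<circ> \<theta>\<^sup>i\<close> and \<open>a\<^sub>i = (i+1)\<^bsup>1/p\<^esup>\<close>. Abel summation bounds \<open>|Y\<^sub>0 + \<dots> + Y\<^sub>n| / a\<^sub>n\<close>
by twice the largest partial sum of \<open>\<Sum>\<^sub>i Y\<^sub>i / a\<^sub>i\<close>, and Kronecker's lemma makes it tend to \<open>0\<close> as soon
as this series converges. The weights \<open>1/a\<^sub>i\<close> thus replace the usual dyadic blocks: it is enough to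
control the series. Truncate \<open>Y\<^sub>i\<close> at the level \<open>t a\<^sub>i\<close> (\<open>truncation_decomposition\<close>):
  \<^item> some \<open>Y\<^sub>i\<close> exceeds its level with probability at most \<open>\<Sum>\<^sub>i P(|d| > t a\<^sub>i) \<le> E (|d|/t)\<^sup>p\<close>;
  \<^item> the compensator of the large part is controlled in \<open>L\<^sup>1\<close>, because
    \<open>\<Sum>\<^sub>i E(|d|; |d| > t a\<^sub>i) / a\<^sub>i \<le> p/(p-1) t E (|d|/t)\<^sup>p\<close>;
  \<^item> the compensated small part consists again of martingale differences, now in \<open>L\<^sup>r\<close>, with
    \<open>\<Sum>\<^sub>i E(|d|\<^sup>r; |d| \<le> t a\<^sub>i) / a\<^sub>i\<^sup>r \<le> r/(r-p) t\<^sup>r E (|d|/t)\<^sup>p\<close>, so that Doob's maximal inequality and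
    the smoothness inequality apply.

The last two bounds rest on \<open>1/p < 1\<close> and \<open>r/p > 1\<close>; this is where \<open>1 < p < r\<close> enters. By
Markov's and Doob's inequalities at level \<open>t\<close>, each of the three parts is large with probability at most
\<open>const E (|d|/t)\<^sup>p\<close>, which is the weak-type inequality for the orbit
(\<open>weighted_sums_weak_type\<close>), and the finiteness of the three bounds for \<open>t = 1\<close> gives convergence of the series
(\<open>weighted_sums_summable\<close>).

The smoothness hypothesis speaks about probability measures on \<open>nat \<Rightarrow> 'b\<close> only;
\<open>rD_smooth_mart_diff_seq\<close> carries it to an arbitrary probability space through the joint law.
On a nonzero space it forces \<open>D\<^sup>r \<ge> 1\<close> (a random sign times a fixed vector), which lets the
two terms without \<open>D\<close> be absorbed into the constant.\<close>

section \<open>Conditional expectations of Banach-valued variables\<close>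

lemma set_integral_norm_le_set_integral:
  fixes f :: "'a \<Rightarrow> 'b::{banach, second_countable_topology}"
  assumes "set_integrable M A f"
  shows "norm (LINT x:A|M. f x) \<le> (LINT x:A|M. norm (f x))"
proof -
  have "norm (LINT x:A|M. f x) \<le> (LINT x|M. norm (indicator A x *\<^sub>R f x))"
    unfolding set_lebesgue_integral_def by (rule integral_norm_bound)
  also have "\<dots> = (LINT x:A|M. norm (f x))"
    unfolding set_lebesgue_integral_def by (intro Bochner_Integration.integral_cong) auto
  finally show ?thesis .
qed

lemma integrable_imp_set_integrable:
  fixes f :: "'a \<Rightarrow> 'b::{banach, second_countable_topology}"
  assumes "integrable M f" "A \<in> sets M"
  shows "set_integrable M A f"
  unfolding set_integrable_def using assms by (intro integrable_mult_indicator)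

lemma subalgebra_sets: "subalgebra M F \<Longrightarrow> A \<in> sets F \<Longrightarrow> A \<in> sets M"
  by (auto simp: subalgebra_def)

lemma has_cond_expD:
  assumes "has_cond_exp M F X Y"
  shows "Y \<in> borel_measurable F" "integrable M Y"
    "A \<in> sets F \<Longrightarrow> (LINT \<omega>:A|M. Y \<omega>) = (LINT \<omega>:A|M. X \<omega>)"
  using assms by (auto simp: has_cond_exp_def)

lemma has_cond_exp_add:
  assumes "subalgebra M F" "has_cond_exp M F X Y" "has_cond_exp M F X' Y'" "integrable M X" "integrable M X'"
  shows "has_cond_exp M F (\<lambda>\<omega>. X \<omega> + X' \<omega>) (\<lambda>\<omega>. Y \<omega> + Y' \<omega>)"
  using assms unfolding has_cond_exp_def
  by (auto simp: set_integral_add integrable_imp_set_integrable subalgebra_sets)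

lemma has_cond_exp_diff:
  assumes "subalgebra M F" "has_cond_exp M F X Y" "has_cond_exp M F X' Y'" "integrable M X" "integrable M X'"
  shows "has_cond_exp M F (\<lambda>\<omega>. X \<omega> - X' \<omega>) (\<lambda>\<omega>. Y \<omega> - Y' \<omega>)"
  using assms unfolding has_cond_exp_def
  by (auto simp: set_integral_diff integrable_imp_set_integrable subalgebra_sets)

lemma has_cond_exp_scaleR:
  assumes "has_cond_exp M F X Y"
  shows "has_cond_exp M F (\<lambda>\<omega>. c *\<^sub>R X \<omega>) (\<lambda>\<omega>. c *\<^sub>R Y \<omega>)"
  using assms unfolding has_cond_exp_def by auto

lemma has_cond_exp_self:
  assumes "X \<in> borel_measurable F" "integrable M X"
  shows "has_cond_exp M F X X"
  using assms unfolding has_cond_exp_def by auto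

text \<open>On a set where \<open>Y\<close> stays within \<open>\<epsilon>\<close> of a fixed vector, the norm of the integral of \<open>Y\<close> and the
integral of its norm differ by at most \<open>2\<epsilon>\<close> times the measure, and the former equals the norm of the
integral of \<open>X\<close>. Separability splits the space into countably many such sets from \<open>F\<close>.
This contraction property yields uniqueness, existence and Jensen's inequality below.\<close>

lemma (in prob_space) has_cond_exp_set_norm_le:
  fixes X Y :: "'a \<Rightarrow> 'b::{banach, second_countable_topology}"
  assumes F: "subalgebra M F" and Y: "has_cond_exp M F X Y" and X: "integrable M X"
    and A: "A \<in> sets F"
  shows "(LINT \<omega>:A|M. norm (Y \<omega>)) \<le> (LINT \<omega>:A|M. norm (X \<omega>))"
proof -
  note FM = subalgebra_sets[OF F]
  have Ym[measurable]: "Y \<in> borel_measurable F" and Yi[measurable]: "integrable M Y"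
    using has_cond_expD[OF Y] by auto
  note X[measurable]
  have spF: "space F = space M" using F by (simp add: subalgebra_def)
  have nn: "(\<integral>\<^sup>+\<omega>\<in>B. norm (Y \<omega>) \<partial>M) = ennreal (LINT \<omega>:B|M. norm (Y \<omega>))"
       "(\<integral>\<^sup>+\<omega>\<in>B. norm (X \<omega>) \<partial>M) = ennreal (LINT \<omega>:B|M. norm (X \<omega>))" if "B \<in> sets M" for B
    using that X Yi by (auto intro!: nn_set_integral_eq_set_integral)
  have "(LINT \<omega>:A|M. norm (Y \<omega>)) \<le> (LINT \<omega>:A|M. norm (X \<omega>)) + e" if e: "e > 0" for e
  proof -
    obtain D :: "'b set" where D: "countable D" "\<And>U. open U \<Longrightarrow> U \<noteq> {} \<Longrightarrow> \<exists>d\<in>D. d \<in> U"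
      using countable_dense_setE by auto
    then have "D \<noteq> {}" by force
    define y where "y = from_nat_into D"
    \<comment> \<open>Radius \<open>e/2\<close>: the two approximation errors in each piece then add up to \<open>e\<close>.\<close>
    define B where "B j = {\<omega> \<in> space F. dist (Y \<omega>) (y j) < e/2}" for j
    have B: "B j \<in> sets F" for j unfolding B_def by measurable
    have UB: "(\<Union>j. B j) = space M"
    proof -
      have "\<exists>j. dist z (y j) < e/2" for z :: 'b
      proof -
        obtain d where "d \<in> D" "d \<in> ball z (e/2)" using D(2)[of "ball z (e/2)"] e by auto
        then obtain j where "y j = d" unfolding y_def using D(1) \<open>D \<noteq> {}\<close> from_nat_into_surj by metis
        then show ?thesis using \<open>d \<in> ball z (e/2)\<close> by (auto simp: dist_commute)
      qed
      then show ?thesis by (auto simp: B_def spF)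
    qed
    define C where "C j = disjointed B j \<inter> A" for j
    have CF: "C j \<in> sets F" for j unfolding C_def
      using B A sets.range_disjointed_sets[of B F] by (auto intro!: sets.Int)
    then have CM[measurable]: "C j \<in> sets M" for j using FM by blast
    have disj: "disjoint_family C" unfolding C_def
      using disjoint_family_disjointed[of B] by (auto simp: disjoint_family_on_def)
    have UC: "(\<Union>j. C j) = A"
      using UB UN_disjointed_eq[of B] A FM sets.sets_into_space unfolding C_def by fastforce
    have *: "(LINT \<omega>:C j|M. norm (Y \<omega>)) \<le> (LINT \<omega>:C j|M. norm (X \<omega>)) + e * measure M (C j)" for j
    proof -
      have si: "set_integrable M (C j) Y" "set_integrable M (C j) X" "set_integrable M (C j) (\<lambda>_. y j)"
        "set_integrable M (C j) (\<lambda>\<omega>. norm (Y \<omega>))" "set_integrable M (C j) (\<lambda>\<omega>. norm (Y \<omega> - y j))"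
        "set_integrable M (C j) (\<lambda>_. norm (y j))" "set_integrable M (C j) (\<lambda>_. e/2)"
        using X Yi by (auto intro!: integrable_imp_set_integrable)
      have c: "(LINT \<omega>:C j|M. c) = measure M (C j) *\<^sub>R c" for c :: "'c::{banach, second_countable_topology}"
        by (rule set_integral_const) auto
      have d: "(LINT \<omega>:C j|M. norm (Y \<omega> - y j)) \<le> e/2 * measure M (C j)"
      proof -
        have "(LINT \<omega>:C j|M. norm (Y \<omega> - y j)) \<le> (LINT \<omega>:C j|M. e/2)"
          using si disjointed_subset[of B j]
          by (intro set_integral_mono) (auto simp: C_def B_def dist_norm intro!: less_imp_le)
        then show ?thesis by (simp add: c mult.commute)
      qed
      have "(LINT \<omega>:C j|M. norm (Y \<omega>)) \<le> (LINT \<omega>:C j|M. norm (Y \<omega> - y j) + norm (y j))"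
        using si by (intro set_integral_mono set_integral_add) (auto simp: norm_triangle_sub add.commute)
      also have "\<dots> = (LINT \<omega>:C j|M. norm (Y \<omega> - y j)) + norm (LINT \<omega>:C j|M. y j)"
        using si by (simp add: set_integral_add c)
      also have "(LINT \<omega>:C j|M. y j) = (LINT \<omega>:C j|M. X \<omega>) - (LINT \<omega>:C j|M. Y \<omega> - y j)"
        using si has_cond_expD(3)[OF Y CF] by (simp add: set_integral_diff)
      also have "norm \<dots> \<le> norm (LINT \<omega>:C j|M. X \<omega>) + norm (LINT \<omega>:C j|M. Y \<omega> - y j)"
        by (rule norm_triangle_ineq4)
      also have "\<dots> \<le> (LINT \<omega>:C j|M. norm (X \<omega>)) + (LINT \<omega>:C j|M. norm (Y \<omega> - y j))"
        using si by (intro add_mono set_integral_norm_le_set_integral set_integral_diff) auto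
      finally show ?thesis using d by simp
    qed
    have "(\<integral>\<^sup>+\<omega>\<in>A. norm (Y \<omega>) \<partial>M) = (\<Sum>j. (\<integral>\<^sup>+\<omega>\<in>C j. norm (Y \<omega>) \<partial>M))"
      unfolding UC[symmetric] by (rule nn_integral_disjoint_family) (use disj in auto)
    also have "\<dots> \<le> (\<Sum>j. (\<integral>\<^sup>+\<omega>\<in>C j. norm (X \<omega>) \<partial>M) + ennreal e * emeasure M (C j))"
    proof (intro suminf_le)
      fix j
      have "0 \<le> (LINT \<omega>:C j|M. norm (X \<omega>))" unfolding set_lebesgue_integral_def by auto
      then show "(\<integral>\<^sup>+\<omega>\<in>C j. norm (Y \<omega>) \<partial>M) \<le> (\<integral>\<^sup>+\<omega>\<in>C j. norm (X \<omega>) \<partial>M) + ennreal e * emeasure M (C j)"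
        using *[of j] e by (simp add: nn emeasure_eq_measure flip: ennreal_plus ennreal_mult)
    qed auto
    also have "\<dots> = (\<Sum>j. (\<integral>\<^sup>+\<omega>\<in>C j. norm (X \<omega>) \<partial>M)) + ennreal e * (\<Sum>j. emeasure M (C j))"
      by (simp add: suminf_add[symmetric])
    also have "(\<Sum>j. (\<integral>\<^sup>+\<omega>\<in>C j. norm (X \<omega>) \<partial>M)) = (\<integral>\<^sup>+\<omega>\<in>A. norm (X \<omega>) \<partial>M)"
      unfolding UC[symmetric] by (rule nn_integral_disjoint_family[symmetric]) (use disj in auto)
    also have "(\<Sum>j. emeasure M (C j)) = emeasure M A"
      unfolding UC[symmetric] using disj by (intro suminf_emeasure) auto
    also have "\<dots> \<le> 1" by (rule emeasure_le_1)
    finally have "(\<integral>\<^sup>+\<omega>\<in>A. norm (Y \<omega>) \<partial>M) \<le> (\<integral>\<^sup>+\<omega>\<in>A. norm (X \<omega>) \<partial>M) + ennreal e"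
      by (simp add: mult_left_mono)
    moreover have "0 \<le> (LINT \<omega>:A|M. norm (X \<omega>))" unfolding set_lebesgue_integral_def by auto
    ultimately show ?thesis
      using e FM[OF A] by (simp add: nn flip: ennreal_plus)
  qed
  then show ?thesis by (rule field_le_epsilon)
qed

lemma (in prob_space) has_cond_exp_integral_norm_le:
  fixes X Y :: "'a \<Rightarrow> 'b::{banach, second_countable_topology}"
  assumes F: "subalgebra M F" and Y: "has_cond_exp M F X Y" and X: "integrable M X"
  shows "(LINT \<omega>|M. norm (Y \<omega>)) \<le> (LINT \<omega>|M. norm (X \<omega>))"
proof -
  have "space M \<in> sets F" using F by (metis sets.top subalgebra_def)
  from has_cond_exp_set_norm_le[OF assms this] show ?thesis
    using X has_cond_expD(2)[OF Y] by (simp add: set_integral_space)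
qed

lemma (in prob_space) has_cond_exp_unique:
  fixes X Y :: "'a \<Rightarrow> 'b::{banach, second_countable_topology}"
  assumes F: "subalgebra M F" and Y: "has_cond_exp M F X Y" "has_cond_exp M F X Y'" and X: "integrable M X"
  shows "AE \<omega> in M. Y \<omega> = Y' \<omega>"
proof -
  have i: "integrable M (\<lambda>\<omega>. Y \<omega> - Y' \<omega>)" using Y by (auto simp: has_cond_exp_def)
  have "has_cond_exp M F (\<lambda>\<omega>. 0) (\<lambda>\<omega>. Y \<omega> - Y' \<omega>)"
    using has_cond_exp_diff[OF F Y X X] by simp
  from has_cond_exp_integral_norm_le[OF F this] have "(LINT \<omega>|M. norm (Y \<omega> - Y' \<omega>)) \<le> 0" by simp
  then have "(LINT \<omega>|M. norm (Y \<omega> - Y' \<omega>)) = 0"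
    by (intro antisym integral_nonneg_AE) auto
  then have "AE \<omega> in M. norm (Y \<omega> - Y' \<omega>) = 0"
    using i by (subst (asm) integral_nonneg_eq_0_iff_AE) auto
  then show ?thesis by auto
qed

text \<open>A sequence whose increments have summable \<open>L\<^sup>1\<close> norms converges almost everywhere and in \<open>L\<^sup>1\<close>, since
the series of the norms of its increments is integrable. The limit is named by \<open>lim\<close>, so that it
inherits measurability with respect to every sub-\<open>\<sigma>\<close>-algebra for which the members are measurable.\<close>

lemma L1_limit_of_summable_increments:
  fixes f :: "nat \<Rightarrow> 'a \<Rightarrow> 'b::{banach, second_countable_topology}"
  assumes int: "\<And>i. integrable M (f i)"
    and inc: "(\<Sum>i. \<integral>\<^sup>+x. norm (f (Suc i) x - f i x) \<partial>M) < \<infinity>"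
  defines "g \<equiv> (\<lambda>x. lim (\<lambda>i. f i x))"
  shows "AE x in M. (\<lambda>i. f i x) \<longlonglongrightarrow> g x" and "integrable M g"
    and "A \<in> sets M \<Longrightarrow> (\<lambda>i. LINT x:A|M. f i x) \<longlonglongrightarrow> (LINT x:A|M. g x)"
proof -
  note int[measurable]
  have gm[measurable]: "g \<in> borel_measurable M" unfolding g_def by measurable
  define h where "h i x = f (Suc i) x - f i x" for i x
  have [measurable]: "h i \<in> borel_measurable M" for i unfolding h_def by measurable
  have "(\<integral>\<^sup>+x. (\<Sum>i. ennreal (norm (h i x))) \<partial>M) < \<infinity>"
    using inc by (subst nn_integral_suminf) (auto simp: h_def)
  then have fin: "AE x in M. (\<Sum>i. ennreal (norm (h i x))) \<noteq> \<infinity>"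
    by (intro nn_integral_PInf_AE) auto
  have tail: "(\<lambda>i. f i x) \<longlonglongrightarrow> g x \<and> (\<forall>n. ennreal (norm (g x - f n x)) \<le> (\<Sum>i. ennreal (norm (h (i + n) x))))"
    if "(\<Sum>i. ennreal (norm (h i x))) \<noteq> \<infinity>" for x
  proof -
    have sm: "summable (\<lambda>i. norm (h i x))" using that by (intro summable_suminf_not_top) auto
    have tele: "(\<Sum>i<m. h (i + n) x) = f (m + n) x - f n x" for m n
      by (induct m) (auto simp: h_def)
    have "summable (\<lambda>i. h i x)" using sm by (rule summable_norm_cancel)
    then have "(\<lambda>m. f m x - f 0 x) \<longlonglongrightarrow> (\<Sum>i. h i x)"
      using tele[where n=0] summable_LIMSEQ[of "\<lambda>i. h i x"] by simp
    then have "(\<lambda>m. f m x - f 0 x + f 0 x) \<longlonglongrightarrow> (\<Sum>i. h i x) + f 0 x" by (intro tendsto_intros)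
    then have lim: "(\<lambda>i. f i x) \<longlonglongrightarrow> g x" unfolding g_def by (simp add: limI)
    moreover have "ennreal (norm (g x - f n x)) \<le> (\<Sum>i. ennreal (norm (h (i + n) x)))" for n
    proof (rule LIMSEQ_le_const2)
      show "(\<lambda>m. ennreal (norm (f (m + n) x - f n x))) \<longlonglongrightarrow> ennreal (norm (g x - f n x))"
        using LIMSEQ_ignore_initial_segment[OF lim] by (intro tendsto_intros)
      have "ennreal (norm (f (m + n) x - f n x)) \<le> (\<Sum>i<m. ennreal (norm (h (i + n) x)))" for m
        unfolding tele[symmetric] by (subst sum_ennreal) (auto intro!: ennreal_leI norm_sum)
      also have "\<dots> m \<le> (\<Sum>i. ennreal (norm (h (i + n) x)))" for m by (rule sum_le_suminf) auto
      finally show "\<exists>N. \<forall>m\<ge>N. ennreal (norm (f (m + n) x - f n x)) \<le> (\<Sum>i. ennreal (norm (h (i + n) x)))" by auto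
    qed
    ultimately show ?thesis by auto
  qed
  show "AE x in M. (\<lambda>i. f i x) \<longlonglongrightarrow> g x" using fin by eventually_elim (use tail in auto)
  have bd: "(\<integral>\<^sup>+x. norm (g x - f n x) \<partial>M) \<le> (\<Sum>i. \<integral>\<^sup>+x. norm (h (i + n) x) \<partial>M)" for n
  proof -
    have "(\<integral>\<^sup>+x. norm (g x - f n x) \<partial>M) \<le> (\<integral>\<^sup>+x. (\<Sum>i. ennreal (norm (h (i + n) x))) \<partial>M)"
      using fin tail by (intro nn_integral_mono_AE) auto
    also have "\<dots> = (\<Sum>i. \<integral>\<^sup>+x. norm (h (i + n) x) \<partial>M)" by (rule nn_integral_suminf) auto
    finally show ?thesis .
  qed
  have "(\<integral>\<^sup>+x. norm (g x - f 0 x) \<partial>M) < \<infinity>" using bd[of 0] inc by (auto simp: h_def)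
  then have "integrable M (\<lambda>x. g x - f 0 x)" by (intro integrableI_bounded) auto
  then have "integrable M (\<lambda>x. (g x - f 0 x) + f 0 x)" using int
    by (intro Bochner_Integration.integrable_add)
  then show gi: "integrable M g" by simp
  have r: "(\<integral>\<^sup>+x. norm (h i x) \<partial>M) = ennreal (LINT x|M. norm (h i x))" for i
    using int by (intro nn_integral_eq_integral) (auto simp: h_def)
  have sm: "summable (\<lambda>i. LINT x|M. norm (h i x))"
    using inc unfolding h_def[symmetric] r by (intro summable_suminf_not_top) auto
  have n0: "(\<lambda>n. LINT x|M. norm (g x - f n x)) \<longlonglongrightarrow> 0"
  proof (rule tendsto_sandwich[OF _ _ tendsto_const suminf_exist_split2[OF sm]])
    show "\<forall>\<^sub>F n in sequentially. (LINT x|M. norm (g x - f n x)) \<le> (\<Sum>i. LINT x|M. norm (h (i + n) x))"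
    proof (rule always_eventually, rule allI)
      fix n
      have "ennreal (LINT x|M. norm (g x - f n x)) \<le> (\<Sum>i. ennreal (LINT x|M. norm (h (i + n) x)))"
        using bd[of n] gi int unfolding r by (subst (asm) nn_integral_eq_integral) auto
      also have "\<dots> = ennreal (\<Sum>i. LINT x|M. norm (h (i + n) x))"
        using sm by (intro suminf_ennreal2) (auto simp: summable_iff_shift[of "\<lambda>i. LINT x|M. norm (h i x)"])
      finally show "(LINT x|M. norm (g x - f n x)) \<le> (\<Sum>i. LINT x|M. norm (h (i + n) x))"
        using sm by (subst (asm) ennreal_le_iff) (auto intro!: suminf_nonneg simp: summable_iff_shift[of "\<lambda>i. LINT x|M. norm (h i x)"])
    qed
  qed auto
  assume A: "A \<in> sets M"
  show "(\<lambda>i. LINT x:A|M. f i x) \<longlonglongrightarrow> (LINT x:A|M. g x)"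
  proof (rule Lim_transform2[OF tendsto_const[of "LINT x:A|M. g x"]], rule Lim_null_comparison[OF _ n0])
    show "\<forall>\<^sub>F n in sequentially. norm ((LINT x:A|M. g x) - (LINT x:A|M. f n x)) \<le> (LINT x|M. norm (g x - f n x))"
    proof (rule always_eventually, rule allI)
      fix n
      have si: "set_integrable M A g" "set_integrable M A (f n)" 
        using A gi int by (auto intro!: integrable_imp_set_integrable)
      have "norm ((LINT x:A|M. g x) - (LINT x:A|M. f n x)) = norm (LINT x:A|M. g x - f n x)"
        using si by (simp add: set_integral_diff)
      also have "\<dots> \<le> (LINT x|M. norm (indicator A x *\<^sub>R (g x - f n x)))"
        unfolding set_lebesgue_integral_def by (rule integral_norm_bound)
      also have "\<dots> \<le> (LINT x|M. norm (g x - f n x))"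
        using gi int A by (intro integral_mono integrable_norm integrable_mult_indicator) (auto simp: indicator_def)
      finally show "norm ((LINT x:A|M. g x) - (LINT x:A|M. f n x)) \<le> (LINT x|M. norm (g x - f n x))" .
    qed
  qed
qed

text \<open>For \<open>1\<^sub>A c\<close> the scalar conditional expectation of \<open>1\<^sub>A\<close> times \<open>c\<close> will do. The passage to limits uses
the \<open>L\<^sup>1\<close> contraction property: approximations that converge fast in \<open>L\<^sup>1\<close> have conditional
expectations whose increments are summable in \<open>L\<^sup>1\<close>.\<close>

lemma (in prob_space) has_cond_exp_exists:
  fixes X :: "'a \<Rightarrow> 'b::{banach, second_countable_topology}"
  assumes F: "subalgebra M F" and X: "integrable M X"
  shows "\<exists>Y. has_cond_exp M F X Y"
  using X
proof (induct rule: integrable_induct)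
  case (base A c)
  interpret finite_measure_subalgebra M F
    by (simp add: finite_measure_axioms finite_measure_subalgebra_def finite_measure_subalgebra_axioms_def F)
  have A: "integrable M (indicat_real A)" using base by simp
  have "has_cond_exp M F (\<lambda>x. indicator A x *\<^sub>R c) (\<lambda>x. real_cond_exp M F (indicat_real A) x *\<^sub>R c)"
    unfolding has_cond_exp_def
  proof (intro conjI ballI)
    fix B assume B: "B \<in> sets F"
    then have "B \<in> sets M" using F by (rule subalgebra_sets[rotated])
    then show "(LINT \<omega>:B|M. real_cond_exp M F (indicat_real A) \<omega> *\<^sub>R c) = (LINT \<omega>:B|M. indicat_real A \<omega> *\<^sub>R c)"
      using real_cond_exp_intA[OF A B] real_cond_exp_int(1)[OF A] A
      by (simp add: set_integral_scaleR_left)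
  qed (use real_cond_exp_int(1)[OF A] in auto)
  then show ?case by blast
next
  case (add f g)
  then show ?case using has_cond_exp_add[OF F] by blast
next
  case (lim f s)
  obtain Y where Y: "\<And>i. has_cond_exp M F (s i) (Y i)" using lim(2) by metis
  have s[measurable]: "integrable M (s i)" for i by fact
  have f[measurable]: "integrable M f" by fact
  have "(\<lambda>i. \<integral>\<^sup>+x. norm (f x - s i x) \<partial>M) \<longlonglongrightarrow> 0"
  proof (rule nn_integral_dominated_convergence_norm)
    show "(\<integral>\<^sup>+x. ennreal (2 * norm (f x)) \<partial>M) < \<infinity>"
      using f by (subst nn_integral_eq_integral) auto
  qed (use lim in auto)
  moreover have nnr: "(\<integral>\<^sup>+x. norm (f x - s i x) \<partial>M) = ennreal (LINT x|M. norm (f x - s i x))" for i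
    using s f by (intro nn_integral_eq_integral) auto
  ultimately have L: "(\<lambda>i. LINT x|M. norm (f x - s i x)) \<longlonglongrightarrow> 0"
    by (simp add: nnr ennreal_tendsto_0_iff)
  have "\<exists>i. (LINT x|M. norm (f x - s i x)) < (1/2) ^ k" for k
    using order_tendstoD(2)[OF L, of "(1/2)^k"] by (auto simp: eventually_sequentially)
  then obtain r where r: "\<And>k. (LINT x|M. norm (f x - s (r k) x)) < (1/2) ^ k" by metis
  define Z where "Z k = Y (r k)" for k
  have Z: "has_cond_exp M F (s (r k)) (Z k)" for k using Y by (simp add: Z_def)
  have Zm[measurable]: "Z k \<in> borel_measurable F" and Zi: "integrable M (Z k)" for k
    using has_cond_expD[OF Z] by auto
  have step: "(\<integral>\<^sup>+x. norm (Z (Suc k) x - Z k x) \<partial>M) \<le> ennreal (2 * (1/2) ^ k)" for k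
  proof -
    have "(\<integral>\<^sup>+x. norm (Z (Suc k) x - Z k x) \<partial>M) = ennreal (LINT x|M. norm (Z (Suc k) x - Z k x))"
      using Zi by (intro nn_integral_eq_integral) auto
    also have "(LINT x|M. norm (Z (Suc k) x - Z k x)) \<le> (LINT x|M. norm (s (r (Suc k)) x - s (r k) x))"
      by (intro has_cond_exp_integral_norm_le[OF F] has_cond_exp_diff F Z s Bochner_Integration.integrable_diff)
    also have "\<dots> \<le> (LINT x|M. norm (f x - s (r (Suc k)) x) + norm (f x - s (r k) x))"
      using s f by (intro integral_mono)
        (auto intro!: integrable_norm Bochner_Integration.integrable_diff order_trans[OF _ norm_triangle_ineq4] 
          simp: norm_minus_commute)
    also have "\<dots> = (LINT x|M. norm (f x - s (r (Suc k)) x)) + (LINT x|M. norm (f x - s (r k) x))"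
      using s f by (intro Bochner_Integration.integral_add) auto
    also have "\<dots> \<le> 2 * (1/2) ^ k" using r[of k] r[of "Suc k"] zero_le_power[of "1 / 2 :: real" k] by (simp del: zero_le_power)
    finally show ?thesis by (simp add: ennreal_leI)
  qed
  have "(\<Sum>k. \<integral>\<^sup>+x. norm (Z (Suc k) x - Z k x) \<partial>M) \<le> (\<Sum>k. ennreal (2 * (1/2) ^ k))"
    by (intro suminf_le step) auto
  also have "\<dots> = ennreal (\<Sum>k. 2 * (1/2) ^ k)"
    by (intro suminf_ennreal2) (auto intro!: summable_mult summable_geometric)
  also have "\<dots> < \<infinity>" by simp
  finally have sum: "(\<Sum>k. \<integral>\<^sup>+x. norm (Z (Suc k) x - Z k x) \<partial>M) < \<infinity>" .
  define g where "g = (\<lambda>x. lim (\<lambda>k. Z k x))"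
  note g = L1_limit_of_summable_increments[OF Zi sum, folded g_def]
  have "has_cond_exp M F f g" unfolding has_cond_exp_def
  proof (intro conjI ballI)
    show "g \<in> borel_measurable F" unfolding g_def by measurable
    fix A assume A: "A \<in> sets F"
    then have AM: "A \<in> sets M" using F by (rule subalgebra_sets[rotated])
    have si: "set_integrable M A f" "set_integrable M A (s (r k))" for k
      using AM f s by (auto intro!: integrable_imp_set_integrable)
    have "(\<lambda>k. (LINT x:A|M. f x) - (LINT x:A|M. Z k x)) \<longlonglongrightarrow> 0"
    proof (rule Lim_null_comparison)
      show "\<forall>\<^sub>F k in sequentially. norm ((LINT x:A|M. f x) - (LINT x:A|M. Z k x)) \<le> (1/2) ^ k"
      proof (rule always_eventually, rule allI)
        fix k
        have "norm ((LINT x:A|M. f x) - (LINT x:A|M. Z k x)) = norm (LINT x:A|M. f x - s (r k) x)"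
          using si has_cond_expD(3)[OF Z A] by (simp add: set_integral_diff)
        also have "\<dots> \<le> (LINT x|M. norm (indicator A x *\<^sub>R (f x - s (r k) x)))"
          unfolding set_lebesgue_integral_def by (rule integral_norm_bound)
        also have "\<dots> \<le> (LINT x|M. norm (f x - s (r k) x))"
          using f s AM by (intro integral_mono integrable_norm integrable_mult_indicator) (auto simp: indicator_def)
        also have "\<dots> \<le> (1/2) ^ k" using r by (rule less_imp_le)
        finally show "norm ((LINT x:A|M. f x) - (LINT x:A|M. Z k x)) \<le> (1/2) ^ k" .
      qed
    qed (rule LIMSEQ_power_zero, simp)
    from tendsto_diff[OF tendsto_const[of "LINT x:A|M. f x"] this]
    have "(\<lambda>k. LINT x:A|M. Z k x) \<longlonglongrightarrow> (LINT x:A|M. f x)" by simp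
    with g(3)[OF AM] show "(LINT x:A|M. g x) = (LINT x:A|M. f x)" by (rule LIMSEQ_unique)
  qed (rule g(2))
  then show ?case by blast
qed

lemma (in prob_space) has_cond_exp_cond_exp:
  fixes X :: "'a \<Rightarrow> 'b::{banach, second_countable_topology}"
  assumes "subalgebra M F" "integrable M X"
  shows "has_cond_exp M F X (cond_exp M F X)"
  unfolding cond_exp_def using has_cond_exp_exists[OF assms] by (rule someI_ex)

lemma convex_on_abs_powr:
  fixes q :: real
  assumes "1 \<le> q"
  shows "convex_on UNIV (\<lambda>x. \<bar>x\<bar> powr q)"
proof (rule convex_onI)
  fix t x y :: real assume t: "0 < t" "t < 1"
  have le: "s powr q \<le> s" if "0 < s" "s < 1" for s :: real
    using that assms powr_le_one_le[of s q] by simp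
  have "\<bar>(1 - t) *\<^sub>R x + t *\<^sub>R y\<bar> powr q \<le> ((1 - t) * \<bar>x\<bar> + t * \<bar>y\<bar>) powr q"
    using t assms by (intro powr_mono2) (auto intro!: order_trans[OF abs_triangle_ineq] simp: abs_mult)
  also have "\<dots> \<le> (1 - t) * \<bar>x\<bar> powr q + t * \<bar>y\<bar> powr q"
  proof (cases "x = 0 \<or> y = 0")
    case True
    then show ?thesis using t le[of t] le[of "1 - t"] assms
      by (auto simp: powr_mult intro!: mult_right_mono)
  next
    case False
    then show ?thesis using t convex_onD[OF powr_convex[OF assms], of t "\<bar>x\<bar>" "\<bar>y\<bar>"] by simp
  qed
  finally show "\<bar>(1 - t) *\<^sub>R x + t *\<^sub>R y\<bar> powr q \<le> (1 - t) * \<bar>x\<bar> powr q + t * \<bar>y\<bar> powr q" .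
qed auto

text \<open>The contraction property on all sets of \<open>F\<close> says that \<open>|Y|\<close> is at most the conditional expectation of
\<open>|X|\<close>; the scalar Jensen inequality does the rest.\<close>

lemma (in prob_space) has_cond_exp_powr_le:
  fixes X Y :: "'a \<Rightarrow> 'b::{banach, second_countable_topology}"
  assumes F: "subalgebra M F" and Y: "has_cond_exp M F X Y" and X: "integrable M X" and q: "1 \<le> q"
  shows "(\<integral>\<^sup>+\<omega>. norm (Y \<omega>) powr q \<partial>M) \<le> (\<integral>\<^sup>+\<omega>. norm (X \<omega>) powr q \<partial>M)"
proof (cases "(\<integral>\<^sup>+\<omega>. norm (X \<omega>) powr q \<partial>M) < \<infinity>")
  case True
  interpret finite_measure_subalgebra M F
    by (simp add: finite_measure_axioms finite_measure_subalgebra_def finite_measure_subalgebra_axioms_def F)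
  note X[measurable]
  have nX: "integrable M (\<lambda>\<omega>. norm (X \<omega>))" using X by simp
  have pX: "integrable M (\<lambda>\<omega>. \<bar>norm (X \<omega>)\<bar> powr q)" using True
    by (intro integrableI_bounded) auto
  have Ym[measurable]: "Y \<in> borel_measurable F" and Yi[measurable]: "integrable M Y"
    using has_cond_expD[OF Y] by auto
  have "AE \<omega> in restr_to_subalg M F. 0 \<le> real_cond_exp M F (\<lambda>\<omega>. norm (X \<omega>)) \<omega> - norm (Y \<omega>)"
  proof (rule sigma_finite_measure.density_nonneg[OF sigma_fin_subalg])
    show "integrable (restr_to_subalg M F) (\<lambda>\<omega>. real_cond_exp M F (\<lambda>\<omega>. norm (X \<omega>)) \<omega> - norm (Y \<omega>))"
      using real_cond_exp_int(1)[OF nX] Yi by (intro integrable_in_subalg[OF F]) auto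
    fix A assume "A \<in> sets (restr_to_subalg M F)"
    then have A[measurable]: "A \<in> sets F" by (simp add: sets_restr_to_subalg[OF F])
    then have AM: "A \<in> sets M" using F by (rule subalgebra_sets[rotated])
    have "(LINT \<omega>:A|restr_to_subalg M F. real_cond_exp M F (\<lambda>\<omega>. norm (X \<omega>)) \<omega> - norm (Y \<omega>))
      = (LINT \<omega>:A|M. real_cond_exp M F (\<lambda>\<omega>. norm (X \<omega>)) \<omega> - norm (Y \<omega>))"
      unfolding set_lebesgue_integral_def by (intro integral_subalgebra2 F) measurable
    also have "\<dots> = (LINT \<omega>:A|M. norm (X \<omega>)) - (LINT \<omega>:A|M. norm (Y \<omega>))"
      using real_cond_exp_int(1)[OF nX] Yi AM real_cond_exp_intA[OF nX A]
      by (subst set_integral_diff) (auto intro!: integrable_imp_set_integrable)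
    also have "\<dots> \<ge> 0" using has_cond_exp_set_norm_le[OF F Y X A] by simp
    finally show "0 \<le> (LINT \<omega>:A|restr_to_subalg M F. real_cond_exp M F (\<lambda>\<omega>. norm (X \<omega>)) \<omega> - norm (Y \<omega>))" .
  qed
  then have le: "AE \<omega> in M. norm (Y \<omega>) \<le> real_cond_exp M F (\<lambda>\<omega>. norm (X \<omega>)) \<omega>"
    using AE_restr_to_subalg[OF F] by fastforce
  have "AE \<omega> in M. \<bar>real_cond_exp M F (\<lambda>\<omega>. norm (X \<omega>)) \<omega>\<bar> powr q
      \<le> real_cond_exp M F (\<lambda>\<omega>. \<bar>norm (X \<omega>)\<bar> powr q) \<omega>"
    by (rule real_cond_exp_jensens_inequality(2)[where I = UNIV, OF nX])
      (use convex_on_abs_powr[OF q] pX in auto)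
  with le have "AE \<omega> in M. norm (Y \<omega>) powr q \<le> real_cond_exp M F (\<lambda>\<omega>. \<bar>norm (X \<omega>)\<bar> powr q) \<omega>"
  proof eventually_elim
    case (elim \<omega>)
    have "norm (Y \<omega>) powr q \<le> \<bar>real_cond_exp M F (\<lambda>\<omega>. norm (X \<omega>)) \<omega>\<bar> powr q"
      using elim q by (intro powr_mono2) auto
    then show ?case using elim by simp
  qed
  then have "(\<integral>\<^sup>+\<omega>. norm (Y \<omega>) powr q \<partial>M) \<le> (\<integral>\<^sup>+\<omega>. real_cond_exp M F (\<lambda>\<omega>. \<bar>norm (X \<omega>)\<bar> powr q) \<omega> \<partial>M)"
    by (intro nn_integral_mono_AE) (auto simp: ennreal_leI)
  also have "\<dots> = ennreal (LINT \<omega>|M. real_cond_exp M F (\<lambda>\<omega>. \<bar>norm (X \<omega>)\<bar> powr q) \<omega>)"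
    using real_cond_exp_int(1)[OF pX] by (intro nn_integral_eq_integral real_cond_exp_pos) auto
  also have "\<dots> = (\<integral>\<^sup>+\<omega>. \<bar>norm (X \<omega>)\<bar> powr q \<partial>M)"
    using real_cond_exp_int(2)[OF pX] pX by (subst nn_integral_eq_integral) auto
  finally show ?thesis by simp
qed (simp add: not_less top.extremum_unique)

section \<open>Martingale differences and the smoothness inequality\<close>

text \<open>Infinite sequences indexed from \<open>0\<close>, with \<open>d n\<close> adapted to \<open>G (Suc n)\<close>. Requiring the zero function to
be a version of the conditional expectation avoids any reference to a chosen version.\<close>

definition mart_diff_seq ::
  "'a measure \<Rightarrow> (nat \<Rightarrow> 'a measure) \<Rightarrow> (nat \<Rightarrow> 'a \<Rightarrow> 'b::{banach, second_countable_topology}) \<Rightarrow> bool"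
  where "mart_diff_seq M G d \<longleftrightarrow>
    (\<forall>n. subalgebra M (G n)) \<and> (\<forall>n. sets (G n) \<subseteq> sets (G (Suc n))) \<and>
    (\<forall>n. d n \<in> borel_measurable (G (Suc n)) \<and> integrable M (d n) \<and> has_cond_exp M (G n) (d n) (\<lambda>_. 0))"

lemma mart_diff_seqD:
  assumes "mart_diff_seq M G d"
  shows "subalgebra M (G n)" "m \<le> n \<Longrightarrow> sets (G m) \<subseteq> sets (G n)"
    "d n \<in> borel_measurable (G (Suc n))" "integrable M (d n)" "has_cond_exp M (G n) (d n) (\<lambda>_. 0)"
  using assms lift_Suc_mono_le[of "\<lambda>n. sets (G n)" m n] by (auto simp: mart_diff_seq_def)

lemma mart_diff_seq_shift:
  assumes "mart_diff_seq M G d"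
  shows "mart_diff_seq M (\<lambda>n. G (n + m)) (\<lambda>n. d (n + m))"
  using assms by (auto simp: mart_diff_seq_def)

lemma measurable_coarser:
  assumes "subalgebra M F" "subalgebra M G" "sets F \<subseteq> sets G" "f \<in> measurable F N"
  shows "f \<in> measurable G N"
  using assms by (intro measurable_from_subalg[of G F]) (auto simp: subalgebra_def)

lemma mart_diff_seq_sum_measurable:
  assumes "mart_diff_seq M G d" "m \<le> n"
  shows "(\<lambda>\<omega>. \<Sum>i<m. d i \<omega>) \<in> borel_measurable (G n)"
proof (intro borel_measurable_sum)
  fix i assume "i \<in> {..<m}"
  then show "d i \<in> borel_measurable (G n)" using assms
    by (intro measurable_coarser[OF mart_diff_seqD(1,1)[OF assms(1)], of "Suc i" n] mart_diff_seqD(2,3)[OF assms(1)]) auto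
qed

lemma mart_diff_seq_cond_exp_sum:
  assumes md: "mart_diff_seq M G d" "n \<le> N"
  shows "has_cond_exp M (G n) (\<lambda>\<omega>. \<Sum>i<N. d i \<omega>) (\<lambda>\<omega>. \<Sum>i<n. d i \<omega>)"
  using md(2)
proof (induct N rule: dec_induct)
  case base
  then show ?case using md mart_diff_seq_sum_measurable[OF md(1), of n n] mart_diff_seqD(4)[OF md(1)]
    by (intro has_cond_exp_self) auto
next
  case (step N)
  have "has_cond_exp M (G n) (d N) (\<lambda>_. 0)"
    using mart_diff_seqD(5)[OF md(1), of N] mart_diff_seqD(2)[OF md(1), of n N] step(1)
    by (auto simp: has_cond_exp_def)
  from has_cond_exp_add[OF mart_diff_seqD(1)[OF md(1)] step(3) this] mart_diff_seqD(4)[OF md(1)]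
  show ?case by simp
qed

text \<open>Under the joint law of \<open>d 0, d 1, \<dots>\<close> the coordinates are martingale differences. As filtration
one can take the largest possible one: the measurable sets whose preimage lies in \<open>G n\<close>. Then both
adaptedness and the vanishing of conditional expectations are inherited directly.\<close>

lemma (in prob_space) rD_smooth_mart_diff_seq:
  fixes d :: "nat \<Rightarrow> 'a \<Rightarrow> 'b::{banach, second_countable_topology}"
  assumes sm: "rD_smooth TYPE('b) r D" and md: "mart_diff_seq M G d"
  shows "(\<integral>\<^sup>+\<omega>. norm (\<Sum>i<N. d i \<omega>) powr r \<partial>M) \<le> ennreal (D powr r) * (\<Sum>i<N. \<integral>\<^sup>+\<omega>. norm (d i \<omega>) powr r \<partial>M)"
proof -
  note mdD = mart_diff_seqD[OF md]
  have spG: "space (G n) = space M" for n using mdD(1) by (simp add: subalgebra_def)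
  have [measurable]: "d n \<in> borel_measurable M" for n using mdD(4) by auto
  define P where "P = PiM UNIV (\<lambda>_::nat. borel :: 'b measure)"
  have spP: "space P = UNIV" by (simp add: P_def space_PiM)
  \<comment> \<open>The target numbers the differences from \<open>1\<close>, so coordinate \<open>n\<close> carries \<open>d (n - 1)\<close>.\<close>
  define T where "T \<omega> = (\<lambda>i. d (i - 1) \<omega>)" for \<omega>
  have T[measurable]: "T \<in> measurable M P" unfolding T_def P_def
    by (rule measurable_PiM_single') auto
  have proj[measurable]: "(\<lambda>x. x n) \<in> borel_measurable P" for n unfolding P_def by measurable
  define Q where "Q = distr M P T"
  interpret Q: prob_space Q unfolding Q_def by (rule prob_space_distr) measurable
  have setsQ: "sets Q = sets P" "space Q = UNIV" by (simp_all add: Q_def spP)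
  define S where "S n = {A \<in> sets P. T -` A \<inter> space M \<in> sets (G n)}" for n
  have sS: "sigma_algebra UNIV (S n)" for n
    unfolding sigma_algebra_iff2
  proof (intro conjI ballI allI impI)
    fix A assume "A \<in> S n"
    moreover have "T -` (UNIV - A) \<inter> space M = space (G n) - (T -` A \<inter> space M)" by (auto simp: spG)
    ultimately show "UNIV - A \<in> S n" unfolding S_def using spP sets.compl_sets[of A P] by auto
  next
    fix A :: "nat \<Rightarrow> (nat \<Rightarrow> 'b) set" assume A: "range A \<subseteq> S n"
    have "T -` (\<Union>i. A i) \<inter> space M = (\<Union>i. T -` A i \<inter> space M)" by auto
    also have "\<dots> \<in> sets (G n)" using A by (intro sets.countable_UN) (auto simp: S_def)
    finally show "(\<Union>i. A i) \<in> S n" using A unfolding S_def by (auto simp: image_subset_iff)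
  qed (auto simp: S_def)
  define H where "H n = sigma UNIV (S n)" for n
  have H: "sets (H n) = S n" "space (H n) = UNIV" for n
    using sigma_algebra.sets_measure_of_eq[OF sS] by (auto simp: H_def)
  have subH: "subalgebra Q (H n)" for n by (auto simp: subalgebra_def H setsQ S_def)
  have int: "integrable Q (\<lambda>x. x n)" for n
    unfolding Q_def using mdD(4) by (subst integrable_distr_eq) (auto simp: T_def)
  have "martingale_differences Q N (\<lambda>n x. x n)"
    unfolding martingale_differences_def
  proof (intro exI[of _ H] conjI ballI allI impI)
    fix n :: nat
    show "subalgebra Q (H n)" by (rule subH)
    show "sets (H n) \<subseteq> sets (H (Suc n))" using mdD(2)[of n "Suc n"] by (auto simp: H S_def)
    assume n: "n \<in> {1..N}"
    show "integrable Q (\<lambda>x. x n)" by (rule int)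
    show "(\<lambda>x. x n) \<in> borel_measurable (H n)"
    proof (rule measurableI)
      fix B :: "'b set" assume B: "B \<in> sets borel"
      have "(\<lambda>x. x n) -` B \<inter> space P \<in> sets P" using B by measurable
      moreover have "T -` ((\<lambda>x. x n) -` B \<inter> space P) \<inter> space M = d (n - 1) -` B \<inter> space (G n)"
        by (auto simp: T_def spP spG)
      moreover have "d (n - 1) -` B \<inter> space (G n) \<in> sets (G n)"
        using measurable_sets[OF mdD(3) B, of "n - 1"] n by simp
      ultimately show "(\<lambda>x. x n) -` B \<inter> space (H n) \<in> sets (H n)" by (simp add: H S_def spP)
    qed auto
    have "has_cond_exp Q (H (n - 1)) (\<lambda>x. x n) (\<lambda>_. 0)"
      unfolding has_cond_exp_def
    proof (intro conjI ballI)
      fix A assume "A \<in> sets (H (n - 1))"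
      then have A[measurable]: "A \<in> sets P" and A': "T -` A \<inter> space M \<in> sets (G (n - 1))" by (auto simp: H S_def)
      have "(LINT x:A|Q. x n) = (LINT \<omega>|M. indicator A (T \<omega>) *\<^sub>R T \<omega> n)"
        unfolding set_lebesgue_integral_def Q_def by (subst integral_distr) auto
      also have "\<dots> = (LINT \<omega>:T -` A \<inter> space M|M. d (n - 1) \<omega>)"
        unfolding set_lebesgue_integral_def by (intro Bochner_Integration.integral_cong) (auto simp: T_def indicator_def)
      also have "\<dots> = 0" using has_cond_expD(3)[OF mdD(5) A'] by simp
      finally show "(LINT x:A|Q. 0) = (LINT x:A|Q. x n)" by simp
    qed auto
    with Q.has_cond_exp_cond_exp[OF subH int]
    show "AE x in Q. cond_exp Q (H (n - 1)) (\<lambda>x. x n) x = 0"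
      by (rule Q.has_cond_exp_unique[OF subH _ _ int])
  qed
  with sm Q.prob_space_axioms have le: "(\<integral>\<^sup>+ x. ennreal (norm (\<Sum>n=1..N. x n) powr r) \<partial>Q)
        \<le> ennreal (D powr r) * (\<Sum>n=1..N. (\<integral>\<^sup>+ x. ennreal (norm (x n) powr r) \<partial>Q))"
    unfolding rD_smooth_def by blast
  have e1: "(\<integral>\<^sup>+ x. ennreal (norm (x n) powr r) \<partial>Q) = (\<integral>\<^sup>+ \<omega>. ennreal (norm (d (n - 1) \<omega>) powr r) \<partial>M)" for n
    unfolding Q_def by (subst nn_integral_distr) (auto simp: T_def)
  have e2: "(\<integral>\<^sup>+ x. ennreal (norm (\<Sum>n=1..N. x n) powr r) \<partial>Q)
     = (\<integral>\<^sup>+ \<omega>. ennreal (norm (\<Sum>n=1..N. d (n - 1) \<omega>) powr r) \<partial>M)"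
    unfolding Q_def by (subst nn_integral_distr) (auto simp: T_def)
  have re: "(\<Sum>n=1..N. f (n - 1)) = (\<Sum>i<N. f i)" for f :: "nat \<Rightarrow> 'c::comm_monoid_add"
    by (rule sum.reindex_bij_witness[of _ Suc "\<lambda>n. n - 1"]) auto
  show ?thesis using le unfolding e1 e2 re[of "\<lambda>i. d i _"] re[of "\<lambda>i. \<integral>\<^sup>+ \<omega>. ennreal (norm (d i \<omega>) powr r) \<partial>M"] .
qed

text \<open>The single martingale difference \<open>\<plusminus>a\<close> with a fair random sign has constant norm, so
the smoothness inequality for it reads \<open>|a|\<^sup>r \<le> D\<^sup>r |a|\<^sup>r\<close>.\<close>

lemma rD_smooth_constant_ge_1:
  fixes a :: "'b::{banach, second_countable_topology}"
  assumes sm: "rD_smooth TYPE('b) r D" and a: "a \<noteq> 0"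
  shows "1 \<le> D powr r"
proof -
  define M where "M = measure_pmf (bernoulli_pmf (1/2))"
  interpret prob_space M unfolding M_def by (rule measure_pmf.prob_space_axioms)
  define G where "G n = (if n = 0 then sigma UNIV {} else M)" for n :: nat
  define d where "d n b = (if n = 0 then (if b then a else - a) else 0)" for n :: nat and b
  have s0: "sets (G 0) = {{}, UNIV}" by (simp add: G_def sigma_sets_empty_eq)
  have int: "integrable M (d n)" for n unfolding M_def by (rule integrable_measure_pmf_finite) auto
  have "mart_diff_seq M G d" unfolding mart_diff_seq_def
  proof (intro conjI allI)
    fix n
    show "has_cond_exp M (G n) (d n) (\<lambda>_. 0)"
    proof (cases "n = 0")
      case True
      have "integral\<^sup>L M (d 0) = 0" unfolding M_def
        by (subst integral_measure_pmf[of UNIV]) (auto simp: UNIV_bool d_def)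
      then show ?thesis using True s0
        by (auto simp: has_cond_exp_def set_lebesgue_integral_def)
    qed (auto simp: has_cond_exp_def d_def)
    show "subalgebra M (G n)" "sets (G n) \<subseteq> sets (G (Suc n))" 
      by (auto simp: subalgebra_def G_def M_def)
    show "d n \<in> borel_measurable (G (Suc n))" by (simp add: G_def M_def)
  qed (rule int)
  from rD_smooth_mart_diff_seq[OF sm this, of 1]
  have "(\<integral>\<^sup>+b. norm (d 0 b) powr r \<partial>M) \<le> ennreal (D powr r) * (\<integral>\<^sup>+b. norm (d 0 b) powr r \<partial>M)" by simp
  moreover have "(\<integral>\<^sup>+b. norm (d 0 b) powr r \<partial>M) = ennreal (norm a powr r)"
  proof -
    have "norm (d 0 b) = norm a" for b by (simp add: d_def)
    then show ?thesis by (simp add: emeasure_space_1)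
  qed
  ultimately have "norm a powr r * 1 \<le> norm a powr r * D powr r"
    by (simp add: mult.commute flip: ennreal_mult)
  then show ?thesis using a by simp
qed

section \<open>Maximal inequality and convergence\<close>

text \<open>Young's inequality for the product of \<open>x / l\<close> and \<open>1\<close>. It serves as the tangent bound that turns
first moments into \<open>r\<close>-th moments without Hoelder's inequality.\<close>

lemma young_scaled:
  fixes x l r :: real
  assumes r: "1 < r" and l: "0 < l" and x: "0 \<le> x"
  shows "x \<le> l powr (1 - r) / r * x powr r + l * (1 - 1 / r)"
proof -
  have "(x / l) * 1 \<le> (x / l) powr r / r + 1 powr (r / (r - 1)) / (r / (r - 1))"
    using r l x by (intro Youngs_inequality) (auto simp: field_simps)
  then have "l * (x / l) \<le> l * ((x / l) powr r / r + (r - 1) / r)" using l by (intro mult_left_mono) auto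
  moreover have "l * (x / l) = x" "(r - 1) / r = 1 - 1 / r" using l r by (auto simp: field_simps)
  moreover have "(x / l) powr r = l powr - r * x powr r" using l x by (simp add: powr_divide powr_minus divide_simps)
  moreover have "l powr (1 - r) = l * l powr - r" using l by (simp add: powr_diff powr_minus divide_simps)
  ultimately show ?thesis by (simp add: algebra_simps)
qed

text \<open>Split according to the first time \<open>n\<close> at which the partial sum exceeds \<open>l\<close>. On this event, which lies
in \<open>G n\<close>, the conditional expectation of the final sum is the sum at time \<open>n\<close>, so the contraction
property gives \<open>l P(A n) \<le> E(|S N|; A n)\<close>. Young's inequality converts the right-hand side into an
\<open>r\<close>-th moment, at the price of a multiple of \<open>P(A n)\<close> that the left-hand side absorbs.\<close>

lemma (in prob_space) doob_maximal_inequality: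
  fixes d :: "nat \<Rightarrow> 'a \<Rightarrow> 'b::{banach, second_countable_topology}"
  assumes md: "mart_diff_seq M G d" and r: "1 < r" and l: "0 < l"
  shows "emeasure M {\<omega> \<in> space M. \<exists>n\<le>N. l < norm (\<Sum>i<n. d i \<omega>)}
    \<le> ennreal (l powr - r) * (\<integral>\<^sup>+\<omega>. norm (\<Sum>i<N. d i \<omega>) powr r \<partial>M)"
proof (cases "(\<integral>\<^sup>+\<omega>. norm (\<Sum>i<N. d i \<omega>) powr r \<partial>M) < \<infinity>")
  case False
  then show ?thesis using l by (simp add: not_less top.extremum_unique ennreal_mult_top)
next
  case True
  note mdD = mart_diff_seqD[OF md]
  have spG: "space (G n) = space M" for n using mdD(1) by (simp add: subalgebra_def)
  have [measurable]: "d n \<in> borel_measurable M" for n using mdD(4) by auto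
  define S where "S n \<omega> = (\<Sum>i<n. d i \<omega>)" for n \<omega>
  have [measurable]: "S n \<in> borel_measurable M" for n unfolding S_def by measurable
  have Si: "integrable M (S n)" for n unfolding S_def using mdD(4) by auto
  have Sp: "integrable M (\<lambda>\<omega>. norm (S N \<omega>) powr r)" 
    using True by (intro integrableI_bounded) (auto simp: S_def)
  define A where "A n = {\<omega> \<in> space M. l < norm (S n \<omega>) \<and> (\<forall>m<n. norm (S m \<omega>) \<le> l)}" for n
  have AG: "A n \<in> sets (G n)" for n
  proof -
    have S: "(\<lambda>\<omega>. norm (S m \<omega>)) \<in> borel_measurable (G n)" if "m \<le> n" for m
      using mart_diff_seq_sum_measurable[OF md that] unfolding S_def by measurable
    have "A n = {\<omega> \<in> space (G n). l < norm (S n \<omega>)} \<inter> (space (G n) \<inter> (\<Inter>m\<in>{..<n}. {\<omega> \<in> space (G n). norm (S m \<omega>) \<le> l}))"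
      by (auto simp: A_def spG)
    also have "\<dots> \<in> sets (G n)"
    proof (rule sets.Int)
      show "{\<omega> \<in> space (G n). l < norm (S n \<omega>)} \<in> sets (G n)" using S[OF order_refl] by measurable
      have "{\<omega> \<in> space (G n). norm (S m \<omega>) \<le> l} \<in> sets (G n)" if "m < n" for m using S[OF less_imp_le[OF that]] by measurable
      then show "space (G n) \<inter> (\<Inter>m\<in>{..<n}. {\<omega> \<in> space (G n). norm (S m \<omega>) \<le> l}) \<in> sets (G n)"
        by (cases "n = 0") (auto intro!: sets.finite_INT sets.Int)
    qed
    finally show ?thesis .
  qed
  have AM[measurable]: "A n \<in> sets M" for n using AG subalgebra_sets[OF mdD(1)] by blast
  have each: "emeasure M (A n) \<le> (\<integral>\<^sup>+\<omega>. ennreal (l powr - r * norm (S N \<omega>) powr r) * indicator (A n) \<omega> \<partial>M)" if n: "n \<le> N" for n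
  proof -
    have si: "set_integrable M (A n) (\<lambda>\<omega>. norm (S m \<omega>))" "set_integrable M (A n) (\<lambda>_. c)"
      "set_integrable M (A n) (\<lambda>\<omega>. norm (S N \<omega>) powr r)" for m and c :: real
      using Si Sp by (auto intro!: integrable_imp_set_integrable)
    have c: "(LINT \<omega>:A n|M. c) = measure M (A n) * c" for c :: real
      using set_integral_const[of "A n" M c] by auto
    have "measure M (A n) * l = (LINT \<omega>:A n|M. l)" by (simp add: c)
    also have "\<dots> \<le> (LINT \<omega>:A n|M. norm (S n \<omega>))"
      by (rule set_integral_mono) (use si in \<open>auto simp: A_def\<close>)
    also have "\<dots> \<le> (LINT \<omega>:A n|M. norm (S N \<omega>))"
      using has_cond_exp_set_norm_le[OF mdD(1) mart_diff_seq_cond_exp_sum[OF md n] _ AG] Si unfolding S_def by auto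
    also have "\<dots> \<le> (LINT \<omega>:A n|M. l powr (1 - r) / r * norm (S N \<omega>) powr r + l * (1 - 1 / r))"
      using si young_scaled[OF r l] by (intro set_integral_mono set_integral_add) auto
    also have "\<dots> = l powr (1 - r) / r * (LINT \<omega>:A n|M. norm (S N \<omega>) powr r) + measure M (A n) * (l * (1 - 1 / r))"
      using si by (subst set_integral_add) (auto simp: c)
    finally have "measure M (A n) * (l / r) \<le> l powr (1 - r) / r * (LINT \<omega>:A n|M. norm (S N \<omega>) powr r)"
      by (simp add: algebra_simps)
    moreover have "l powr (1 - r) = l * l powr - r" using l by (simp add: powr_diff powr_minus divide_simps)
    ultimately have "measure M (A n) \<le> l powr - r * (LINT \<omega>:A n|M. norm (S N \<omega>) powr r)"
      using l r by (simp add: field_simps)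
    also have "\<dots> = (LINT \<omega>:A n|M. l powr - r * norm (S N \<omega>) powr r)" by simp
    finally have "ennreal (measure M (A n)) \<le> ennreal (LINT \<omega>:A n|M. l powr - r * norm (S N \<omega>) powr r)" by (rule ennreal_leI)
    also have "\<dots> = (\<integral>\<^sup>+\<omega>\<in>A n. (l powr - r * norm (S N \<omega>) powr r) \<partial>M)"
      using Sp by (intro nn_set_integral_eq_set_integral[symmetric]) auto
    finally show ?thesis by (simp add: emeasure_eq_measure)
  qed
  have disj: "disjoint_family_on A {..N}"
    unfolding disjoint_family_on_def
  proof (intro ballI impI)
    fix m n :: nat assume "m \<noteq> n"
    then show "A m \<inter> A n = {}" by (cases "m < n") (auto simp: A_def not_less, (meson linorder_not_less nat_neq_iff)+)
  qed
  have "{\<omega> \<in> space M. \<exists>n\<le>N. l < norm (S n \<omega>)} \<subseteq> (\<Union>n\<le>N. A n)"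
  proof safe
    fix \<omega> n assume w: "\<omega> \<in> space M" "n \<le> N" "l < norm (S n \<omega>)"
    define k where "k = (LEAST n. l < norm (S n \<omega>))"
    have "l < norm (S k \<omega>)" unfolding k_def by (rule LeastI) fact
    moreover have "k \<le> n" unfolding k_def by (rule Least_le) fact
    moreover have "norm (S m \<omega>) \<le> l" if "m < k" for m using not_less_Least that unfolding k_def by (meson not_less)
    ultimately show "\<omega> \<in> (\<Union>n\<le>N. A n)" using w by (auto simp: A_def intro!: bexI[of _ k])
  qed
  then have "emeasure M {\<omega> \<in> space M. \<exists>n\<le>N. l < norm (S n \<omega>)} \<le> emeasure M (\<Union>n\<le>N. A n)"
    by (intro emeasure_mono) auto
  also have "\<dots> = (\<Sum>n\<le>N. emeasure M (A n))" using disj by (intro sum_emeasure[symmetric]) auto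
  also have "\<dots> \<le> (\<Sum>n\<le>N. (\<integral>\<^sup>+\<omega>. ennreal (l powr - r * norm (S N \<omega>) powr r) * indicator (A n) \<omega> \<partial>M))"
    using each by (intro sum_mono) auto
  also have "\<dots> = (\<integral>\<^sup>+\<omega>. (\<Sum>n\<le>N. ennreal (l powr - r * norm (S N \<omega>) powr r) * indicator (A n) \<omega>) \<partial>M)"
    by (rule nn_integral_sum[symmetric]) auto
  also have "\<dots> = (\<integral>\<^sup>+\<omega>. ennreal (l powr - r * norm (S N \<omega>) powr r) * indicator (\<Union>n\<le>N. A n) \<omega> \<partial>M)"
    using disj by (simp add: sum_distrib_left[symmetric] indicator_UN_disjoint)
  also have "\<dots> \<le> (\<integral>\<^sup>+\<omega>. ennreal (l powr - r) * norm (S N \<omega>) powr r \<partial>M)"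
    by (intro nn_integral_mono) (auto simp: indicator_def ennreal_mult)
  also have "\<dots> = ennreal (l powr - r) * (\<integral>\<^sup>+\<omega>. norm (S N \<omega>) powr r \<partial>M)"
    by (rule nn_integral_cmult) auto
  finally show ?thesis by (simp add: S_def)
qed

lemma (in prob_space) mart_diff_seq_maximal:
  fixes d :: "nat \<Rightarrow> 'a \<Rightarrow> 'b::{banach, second_countable_topology}"
  assumes sm: "rD_smooth TYPE('b) r D" and md: "mart_diff_seq M G d" and r: "1 < r" and l: "0 < l"
  shows "emeasure M {\<omega> \<in> space M. \<exists>n. l < norm (\<Sum>i<n. d i \<omega>)}
    \<le> ennreal (l powr - r) * (ennreal (D powr r) * (\<Sum>i. \<integral>\<^sup>+\<omega>. norm (d i \<omega>) powr r \<partial>M))"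
proof -
  have [measurable]: "d n \<in> borel_measurable M" for n using mart_diff_seqD(4)[OF md] by auto
  define E where "E N = {\<omega> \<in> space M. \<exists>n\<le>N. l < norm (\<Sum>i<n. d i \<omega>)}" for N
  have [measurable]: "E N \<in> sets M" for N unfolding E_def by measurable
  have "{\<omega> \<in> space M. \<exists>n. l < norm (\<Sum>i<n. d i \<omega>)} = (\<Union>N. E N)" by (auto simp: E_def)
  also have "emeasure M \<dots> = (SUP N. emeasure M (E N))"
    by (intro SUP_emeasure_incseq[symmetric]) (auto simp: incseq_def E_def dest: order_trans)
  also have "\<dots> \<le> ennreal (l powr - r) * (ennreal (D powr r) * (\<Sum>i. \<integral>\<^sup>+\<omega>. norm (d i \<omega>) powr r \<partial>M))"
  proof (rule SUP_least)
    fix N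
    have "emeasure M (E N) \<le> ennreal (l powr - r) * (\<integral>\<^sup>+\<omega>. norm (\<Sum>i<N. d i \<omega>) powr r \<partial>M)"
      unfolding E_def by (rule doob_maximal_inequality[OF md r l])
    also have "\<dots> \<le> ennreal (l powr - r) * (ennreal (D powr r) * (\<Sum>i. \<integral>\<^sup>+\<omega>. norm (d i \<omega>) powr r \<partial>M))"
      by (intro mult_left_mono order_trans[OF rD_smooth_mart_diff_seq[OF sm md]] sum_le_suminf) auto
    finally show "emeasure M (E N) \<le> \<dots>" .
  qed
  finally show ?thesis .
qed

text \<open>The maximal inequality for the tail after \<open>m\<close> bounds the probability of an oscillation larger than \<open>l\<close>
by a multiple of the tail of a convergent series; hence the partial sums are almost surely Cauchy.\<close>

lemma (in prob_space) mart_diff_seq_convergent: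
  fixes d :: "nat \<Rightarrow> 'a \<Rightarrow> 'b::{banach, second_countable_topology}"
  assumes sm: "rD_smooth TYPE('b) r D" and md: "mart_diff_seq M G d" and r: "1 < r"
    and fin: "(\<Sum>i. \<integral>\<^sup>+\<omega>. norm (d i \<omega>) powr r \<partial>M) < \<infinity>"
  shows "AE \<omega> in M. summable (\<lambda>i. d i \<omega>)"
proof -
  have [measurable]: "d n \<in> borel_measurable M" for n using mart_diff_seqD(4)[OF md] by auto
  define a where "a i = enn2real (\<integral>\<^sup>+\<omega>. norm (d i \<omega>) powr r \<partial>M)" for i
  have an: "(\<integral>\<^sup>+\<omega>. norm (d i \<omega>) powr r \<partial>M) = ennreal (a i)" for i
  proof -
    have "(\<integral>\<^sup>+\<omega>. norm (d i \<omega>) powr r \<partial>M) < \<infinity>"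
      using fin ennreal_suminf_lessD[of "\<lambda>i. \<integral>\<^sup>+\<omega>. norm (d i \<omega>) powr r \<partial>M"] by auto
    then show ?thesis by (simp add: a_def)
  qed
  have a0: "0 \<le> a i" for i by (simp add: a_def)
  have sma: "summable a" using fin unfolding an by (intro summable_suminf_not_top a0) auto
  define E where "E l m = {\<omega> \<in> space M. \<exists>n. l < norm (\<Sum>i<n. d (i + m) \<omega>)}" for l m
  have [measurable]: "E l m \<in> sets M" for l m unfolding E_def by measurable
  have "AE \<omega> in M. \<forall>k. \<exists>m. \<omega> \<notin> E (1 / real (Suc k)) m"
    unfolding AE_all_countable
  proof
    fix k
    define l where "l = 1 / real (Suc k)"
    then have l: "0 < l" by simp
    have lim: "(\<lambda>m. l powr - r * (D powr r * (\<Sum>i. a (i + m)))) \<longlonglongrightarrow> l powr - r * (D powr r * 0)"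
      by (intro tendsto_intros suminf_exist_split2[OF sma])
    have le: "emeasure M (\<Inter>m. E l m) \<le> ennreal (l powr - r * (D powr r * (\<Sum>i. a (i + m))))" for m
    proof -
      have "emeasure M (\<Inter>m. E l m) \<le> emeasure M (E l m)" by (intro emeasure_mono) auto
      also have "\<dots> \<le> ennreal (l powr - r) * (ennreal (D powr r) * (\<Sum>i. ennreal (a (i + m))))"
        unfolding E_def an[symmetric] by (rule mart_diff_seq_maximal[OF sm mart_diff_seq_shift[OF md] r l])
      also have "(\<Sum>i. ennreal (a (i + m))) = ennreal (\<Sum>i. a (i + m))"
        using sma a0 by (intro suminf_ennreal2) (auto simp: summable_iff_shift)
      finally show ?thesis using a0 sma
        by (simp add: ennreal_mult[symmetric] suminf_nonneg summable_iff_shift)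
    qed
    have "emeasure M (\<Inter>m. E l m) \<le> ennreal (l powr - r * (D powr r * 0))"
      using le by (intro LIMSEQ_le_const[OF tendsto_ennrealI[OF lim]]) auto
    then have "(\<Inter>m. E l m) \<in> null_sets M" by (auto simp: null_sets_def)
    then have "AE \<omega> in M. \<omega> \<notin> (\<Inter>m. E l m)" by (rule AE_not_in)
    then show "AE \<omega> in M. \<exists>m. \<omega> \<notin> E (1 / real (Suc k)) m" by (auto simp: l_def)
  qed
  then show ?thesis
  proof (rule AE_mp, intro AE_I2 impI)
    fix \<omega> assume w: "\<omega> \<in> space M" and *: "\<forall>k. \<exists>m. \<omega> \<notin> E (1 / real (Suc k)) m"
    define S where "S n = (\<Sum>i<n. d i \<omega>)" for n
    have sh: "(\<Sum>i<n. d (i + m) \<omega>) = S (n + m) - S m" for n m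
      by (induct n) (auto simp: S_def)
    have "Cauchy S"
    proof (rule CauchyI')
      fix e :: real assume "0 < e"
      then obtain k where k: "1 / real (Suc k) < e / 2" using nat_approx_posE[of "e/2"] by auto
      obtain m where "\<omega> \<notin> E (1 / real (Suc k)) m" using * by blast
      then have m: "norm (S (n + m) - S m) \<le> 1 / real (Suc k)" for n using w by (auto simp: E_def sh not_less)
      show "\<exists>M. \<forall>m\<ge>M. \<forall>n>m. dist (S m) (S n) < e"
      proof (intro exI[of _ m] allI impI)
        fix i j assume ij: "m \<le> i" "i < j"
        have "dist (S i) (S j) \<le> norm (S i - S m) + norm (S j - S m)"
          unfolding dist_norm by (metis dist_norm dist_triangle2)
        also have "\<dots> < e" using m[of "i - m"] m[of "j - m"] ij k by simp
        finally show "dist (S i) (S j) < e" .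
      qed
    qed
    then show "summable (\<lambda>i. d i \<omega>)"
      by (simp add: summable_iff_convergent Cauchy_convergent_iff S_def[abs_def])
  qed
qed

section \<open>Abel summation and power sums\<close>

text \<open>Abel summation: \<open>\<Sum> x\<^sub>i = a\<^sub>n V\<^sub>n - \<Sum> (a\<^bsub>i+1\<^esub> - a\<^sub>i) V\<^sub>i\<close> with \<open>V\<close> the partial sums of \<open>x\<^sub>i / a\<^sub>i\<close>. Because
\<open>a\<close> increases, the total weight is at most \<open>2 a\<^sub>n\<close>.\<close>

lemma norm_sum_le_weighted_partial_sums:
  fixes x :: "nat \<Rightarrow> 'b::real_normed_vector" and a :: "nat \<Rightarrow> real"
  assumes mono: "incseq a" and pos: "\<And>i. 0 < a i"
    and B: "\<And>j. j \<le> Suc n \<Longrightarrow> norm (\<Sum>i<j. x i /\<^sub>R a i) \<le> B"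
  shows "norm (\<Sum>i<Suc n. x i) \<le> 2 * a n * B"
proof -
  define V where "V j = (\<Sum>i<j. x i /\<^sub>R a i)" for j
  have abel: "(\<Sum>i<Suc k. x i) = a k *\<^sub>R V (Suc k) - (\<Sum>i<k. (a (Suc i) - a i) *\<^sub>R V (Suc i))" for k
  proof (induct k)
    case 0
    then show ?case using pos[of 0] by (simp add: V_def)
  next
    case (Suc k)
    have "x (Suc k) = a (Suc k) *\<^sub>R (V (Suc (Suc k)) - V (Suc k))"
      using pos[of "Suc k"] by (simp add: V_def)
    then have "(\<Sum>i<Suc (Suc k). x i) = a k *\<^sub>R V (Suc k) - (\<Sum>i<k. (a (Suc i) - a i) *\<^sub>R V (Suc i))
        + a (Suc k) *\<^sub>R (V (Suc (Suc k)) - V (Suc k))"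
      by (simp only: sum.lessThan_Suc[of _ "Suc k"] Suc)
    then show ?case by (simp add: scaleR_diff_left scaleR_diff_right)
  qed
  have B0: "0 \<le> B" using B[of 0] by simp
  have "norm (\<Sum>i<Suc n. x i) \<le> norm (a n *\<^sub>R V (Suc n)) + norm (\<Sum>i<n. (a (Suc i) - a i) *\<^sub>R V (Suc i))"
    unfolding abel by (rule norm_triangle_ineq4)
  also have "\<dots> \<le> a n * B + (\<Sum>i<n. (a (Suc i) - a i) * B)"
  proof (intro add_mono sum_norm_le)
    show "norm (a n *\<^sub>R V (Suc n)) \<le> a n * B" using B[of "Suc n"] pos[of n] by (simp add: V_def)
    fix i assume "i \<in> {..<n}"
    then show "norm ((a (Suc i) - a i) *\<^sub>R V (Suc i)) \<le> (a (Suc i) - a i) * B"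
      using B[of "Suc i"] incseq_SucD[OF mono, of i] by (simp add: V_def mult_left_mono)
  qed
  also have "\<dots> = a n * B + (a n - a 0) * B"
    by (simp add: sum_distrib_right[symmetric] sum_lessThan_telescope)
  also have "\<dots> \<le> 2 * a n * B" using pos[of 0] B0 by (simp add: algebra_simps)
  finally show ?thesis .
qed

text \<open>The Abel bound applied after an index \<open>m\<close>, where the series oscillates by at most \<open>\<epsilon>/4\<close>; the first
\<open>m\<close> terms are negligible against \<open>a\<^sub>n\<close>.\<close>

lemma kronecker_lemma:
  fixes x :: "nat \<Rightarrow> 'b::real_normed_vector" and a :: "nat \<Rightarrow> real"
  assumes mono: "incseq a" and pos: "\<And>i. 0 < a i" and top: "filterlim a at_top sequentially"
    and sum: "summable (\<lambda>i. x i /\<^sub>R a i)"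
  shows "(\<lambda>n. norm (\<Sum>i<Suc n. x i) / a n) \<longlonglongrightarrow> 0"
proof (rule LIMSEQ_I)
  fix e :: real assume e: "0 < e"
  have "Cauchy (\<lambda>n. \<Sum>i<n. x i /\<^sub>R a i)"
    using sum by (intro convergent_Cauchy) (simp add: summable_iff_convergent)
  then obtain m where m: "\<And>j. j \<ge> m \<Longrightarrow> norm ((\<Sum>i<j. x i /\<^sub>R a i) - (\<Sum>i<m. x i /\<^sub>R a i)) < e / 4"
    using CauchyD[of "\<lambda>n. \<Sum>i<n. x i /\<^sub>R a i" "e/4"] e by fastforce
  have sp: "(\<Sum>i<j + m. f i) = (\<Sum>i<m. f i) + (\<Sum>i<j. f (i + m))" for j and f :: "nat \<Rightarrow> 'b"
    by (induct j) auto
  define S where "S = norm (\<Sum>i<m. x i)"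
  have "filterlim (\<lambda>n. a n * (e / 2)) at_top sequentially"
    using filterlim_tendsto_pos_mult_at_top[OF tendsto_const[of "e/2"] _ top] e by (simp add: mult.commute)
  then have "\<forall>\<^sub>F n in sequentially. S < a n * (e / 2)" by (simp add: filterlim_at_top_dense)
  then obtain N where N: "\<And>n. n \<ge> N \<Longrightarrow> S < a n * (e / 2)" by (auto simp: eventually_sequentially)
  show "\<exists>no. \<forall>n\<ge>no. norm (norm (\<Sum>i<Suc n. x i) / a n - 0) < e"
  proof (intro exI[of _ "max N m"] allI impI)
    fix n assume n: "max N m \<le> n"
    then obtain k where k: "n = k + m" by (metis le_Suc_ex max.bounded_iff add.commute)
    have "norm (\<Sum>i<Suc k. x (i + m)) \<le> 2 * a (k + m) * (e / 4)"
    proof (rule norm_sum_le_weighted_partial_sums[where a = "\<lambda>i. a (i + m)"])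
      show "incseq (\<lambda>i. a (i + m))" using mono by (auto simp: incseq_def)
      fix j
      show "norm (\<Sum>i<j. x (i + m) /\<^sub>R a (i + m)) \<le> e / 4"
        using m[of "j + m"] sp[of "\<lambda>i. x i /\<^sub>R a i" j] by simp
    qed (use pos in auto)
    moreover have "(\<Sum>i<Suc n. x i) = (\<Sum>i<m. x i) + (\<Sum>i<Suc k. x (i + m))"
      using sp[of x "Suc k"] by (simp add: k)
    then have "norm (\<Sum>i<Suc n. x i) \<le> S + norm (\<Sum>i<Suc k. x (i + m))"
      unfolding S_def by (metis norm_triangle_ineq)
    ultimately have "norm (\<Sum>i<Suc n. x i) \<le> S + a n * (e / 2)" unfolding k by argo
    also have "\<dots> < a n * e" using N[of n] n by simp
    finally show "norm (norm (\<Sum>i<Suc n. x i) / a n - 0) < e"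
      using pos[of n] by (simp add: divide_less_eq mult.commute)
  qed
qed

text \<open>Comparison of \<open>\<Sum> n\<^bsup>-\<alpha>\<^esup>\<close> over \<open>1 \<le> n < u\<close> with the integral of \<open>x\<^bsup>-\<alpha>\<^esup>\<close>, where one step is the concavity of
\<open>x \<mapsto> x\<^bsup>1-\<alpha>\<^esup>\<close>. The case \<open>\<alpha> = 0\<close> counts the integers in the range.\<close>

lemma sum_powr_below:
  fixes \<alpha> u :: real
  assumes "0 \<le> \<alpha>" "\<alpha> < 1" "0 \<le> u"
  shows "(\<Sum>i<N. if real i + 1 < u then (real i + 1) powr - \<alpha> else 0) \<le> u powr (1 - \<alpha>) / (1 - \<alpha>)"
proof -
  \<comment> \<open>The minimum makes the bound inductive: it grows exactly as long as terms are added.\<close>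
  have "(\<Sum>i<N. if real i + 1 < u then (real i + 1) powr - \<alpha> else 0) \<le> (min (real N) u) powr (1 - \<alpha>) / (1 - \<alpha>)"
  proof (induct N)
    case 0
    then show ?case using assms by simp
  next
    case (Suc N)
    show ?case
    proof (cases "real N + 1 < u")
      case True
      have "real N powr (1 - \<alpha>) \<le> (real N + 1) powr (1 - \<alpha>) - (1 - \<alpha>) * (real N + 1) powr - \<alpha>"
      proof (cases "N = 0")
        case False
        have "(real N / (real N + 1)) powr (1 - \<alpha>) * 1 powr \<alpha> \<le> (1 - \<alpha>) * (real N / (real N + 1)) + \<alpha> * 1"
          using assms False by (intro Youngs_inequality_0) auto
        then have "(real N / (real N + 1)) powr (1 - \<alpha>) \<le> 1 - (1 - \<alpha>) / (real N + 1)"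
          by (simp add: field_simps)
        then have "(real N + 1) powr (1 - \<alpha>) * (real N / (real N + 1)) powr (1 - \<alpha>)
            \<le> (real N + 1) powr (1 - \<alpha>) * (1 - (1 - \<alpha>) / (real N + 1))" by (intro mult_left_mono) auto
        moreover have "(real N + 1) powr (1 - \<alpha>) * (real N / (real N + 1)) powr (1 - \<alpha>) = real N powr (1 - \<alpha>)"
          by (simp add: powr_divide)
        moreover have "(real N + 1) powr - \<alpha> = (real N + 1) powr (1 - \<alpha>) / (real N + 1)"
          using powr_diff[of "real N + 1" "1 - \<alpha>" 1] by simp
        ultimately show ?thesis by (simp add: algebra_simps)
      qed (use assms in simp)
      then have "(real N powr (1 - \<alpha>) + (1 - \<alpha>) * (real N + 1) powr - \<alpha>) / (1 - \<alpha>) \<le> (real N + 1) powr (1 - \<alpha>) / (1 - \<alpha>)"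
        using assms by (intro divide_right_mono) auto
      then have "real N powr (1 - \<alpha>) / (1 - \<alpha>) + (real N + 1) powr - \<alpha> \<le> (real N + 1) powr (1 - \<alpha>) / (1 - \<alpha>)"
        using assms by (simp add: add_divide_distrib)
      then show ?thesis using Suc True by (simp add: add.commute)
    next
      case False
      have "min (real N) u powr (1 - \<alpha>) / (1 - \<alpha>) \<le> min (real (Suc N)) u powr (1 - \<alpha>) / (1 - \<alpha>)"
        using assms by (intro divide_right_mono powr_mono2) auto
      then show ?thesis using Suc False by simp
    qed
  qed
  also have "\<dots> \<le> u powr (1 - \<alpha>) / (1 - \<alpha>)"
    using assms by (intro divide_right_mono powr_mono2) auto
  finally show ?thesis .
qed

text \<open>Comparison of \<open>\<Sum> n\<^bsup>-s\<^esup>\<close> over \<open>n \<ge> u\<close> with the integral of \<open>x\<^bsup>-s\<^esup>\<close>. The first term may exceed its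
share of the integral, which accounts for the factor \<open>s/(s-1)\<close> instead of \<open>1/(s-1)\<close>.\<close>

lemma sum_powr_above:
  fixes s u :: real
  assumes s: "1 < s" and u: "0 < u"
  shows "(\<Sum>i<N. if u \<le> real i + 1 then (real i + 1) powr - s else 0) \<le> s / (s - 1) * u powr (1 - s)"
proof -
  \<comment> \<open>The subtracted term is the integral over the part not yet summed; the claim needs it to be inductive.\<close>
  have "(\<Sum>i<N. if u \<le> real i + 1 then (real i + 1) powr - s else 0)
    \<le> s / (s - 1) * u powr (1 - s) - (if u \<le> real N then real N powr (1 - s) / (s - 1) else 0)"
  proof (induct N)
    case 0
    then show ?case using s u by simp
  next
    case (Suc N)
    consider "u \<le> real N" | "real N < u" "u \<le> real N + 1" | "real N + 1 < u" by linarith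
    then show ?case
    proof cases
      case 1
      then have N: "0 < real N" using u by simp
      define y where "y = 1 / (real N + 1)"
      have y: "0 < y" "y < 1" using N by (auto simp: y_def)
      have "1 + (s - 1) * y \<le> exp ((s - 1) * y)" by (rule exp_ge_add_one_self)
      also have "(s - 1) * y \<le> (1 - s) * ln (1 - y)"
        using mult_left_mono_neg[OF ln_le_minus_one[of "1 - y"], of "1 - s"] y s by (simp add: algebra_simps)
      finally have "1 + (s - 1) * y \<le> (1 - y) powr (1 - s)" using y by (simp add: powr_def)
      moreover have "1 - y = real N / (real N + 1)" by (simp add: y_def field_simps)
      ultimately have "(real N + 1) powr (1 - s) * (1 + (s - 1) * y) \<le> (real N + 1) powr (1 - s) * (real N / (real N + 1)) powr (1 - s)"
        by (intro mult_left_mono) auto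
      moreover have "(real N + 1) powr (1 - s) * (real N / (real N + 1)) powr (1 - s) = real N powr (1 - s)"
        by (simp add: powr_divide)
      moreover have "(real N + 1) powr (1 - s) * y = (real N + 1) powr - s"
        using powr_diff[of "real N + 1" "1 - s" 1] by (simp add: y_def)
      ultimately have "(real N + 1) powr (1 - s) + (s - 1) * (real N + 1) powr - s \<le> real N powr (1 - s)"
        by (simp add: algebra_simps)
      then have "(s - 1) * (real N + 1) powr - s / (s - 1) \<le> (real N powr (1 - s) - (real N + 1) powr (1 - s)) / (s - 1)"
        using s by (intro divide_right_mono) auto
      then have "(real N + 1) powr - s \<le> real N powr (1 - s) / (s - 1) - (real N + 1) powr (1 - s) / (s - 1)"
        using s by (simp add: diff_divide_distrib)
      then show ?thesis using Suc 1 by (simp add: add.commute)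
    next
      case 2
      have "(real N + 1) powr - s \<le> (real N + 1) powr (1 - s)" by (rule powr_mono) auto
      moreover have "s / (s - 1) * (real N + 1) powr (1 - s) \<le> s / (s - 1) * u powr (1 - s)"
        using 2 u s by (intro mult_left_mono powr_mono2') auto
      moreover have "s / (s - 1) = 1 + 1 / (s - 1)" using s by (simp add: field_simps)
      moreover have "(\<Sum>i<N. if u \<le> real i + 1 then (real i + 1) powr - s else 0) = 0"
        using 2 by (intro sum.neutral) auto
      ultimately show ?thesis using 2 by (simp add: algebra_simps)
    next
      case 3
      then show ?thesis using Suc by simp
    qed
  qed
  also have "\<dots> \<le> s / (s - 1) * u powr (1 - s)" using s by simp
  finally show ?thesis .
qed

lemma less_root_iff:
  fixes x t p :: real
  assumes "0 < p" "0 < t" "0 \<le> x" "0 \<le> n"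
  shows "t * n powr (1 / p) < x \<longleftrightarrow> n < (x / t) powr p"
proof -
  have "t * n powr (1 / p) < x \<longleftrightarrow> n powr (1 / p) < x / t" using assms by (simp add: field_simps)
  also have "\<dots> \<longleftrightarrow> (n powr (1 / p)) powr p < (x / t) powr p"
    using assms powr_less_mono2[of p "n powr (1 / p)" "x / t"] powr_less_cancel2[of p "n powr (1 / p)" "x / t"]
    by (cases "n = 0 \<or> x = 0") auto
  also have "(n powr (1 / p)) powr p = n" using assms by (simp add: powr_powr)
  finally show ?thesis .
qed

text \<open>Since \<open>t a\<^sub>i < x\<close> means \<open>i + 1 < (x/t)\<^sup>p\<close>, the three sums are of the two kinds above, with exponents
\<open>0\<close>, \<open>1/p < 1\<close> and \<open>r/p > 1\<close>. All three bounds are multiples of \<open>(x/t)\<^sup>p\<close>, so integrating them over the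
law of \<open>|d|\<close> produces one and the same moment.\<close>

lemma truncation_sums:
  fixes x t p r :: real
  assumes p: "1 < p" "p < r" and t: "0 < t" and x: "0 \<le> x"
  defines "a \<equiv> (\<lambda>i::nat. (real i + 1) powr (1 / p))"
  shows "(\<Sum>i<N. if t * a i < x then 1 else 0) \<le> (x / t) powr p"
    and "(\<Sum>i<N. if t * a i < x then x / a i else 0) \<le> p / (p - 1) * t * (x / t) powr p"
    and "(\<Sum>i<N. if t * a i < x then 0 else (x / a i) powr r) \<le> r / (r - p) * t powr r * (x / t) powr p"
proof -
  define u where "u = (x / t) powr p"
  have iff: "t * a i < x \<longleftrightarrow> real i + 1 < u" for i
    unfolding a_def u_def using p t x by (intro less_root_iff) auto
  have d1: "x / a i = x * (real i + 1) powr - (1 / p)" for i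
    unfolding a_def by (simp add: powr_minus divide_inverse)
  have d2: "(x / a i) powr r = x powr r * (real i + 1) powr - (r / p)" for i
    unfolding d1 using x p by (simp add: powr_mult powr_powr)
  have u0: "0 \<le> u" by (simp add: u_def)
  show "(\<Sum>i<N. if t * a i < x then 1 else 0) \<le> (x / t) powr p"
    using sum_powr_below[of 0 u N] u0 by (simp add: iff u_def cong: if_cong)
  have "(\<Sum>i<N. if t * a i < x then x / a i else 0) = x * (\<Sum>i<N. if real i + 1 < u then (real i + 1) powr - (1 / p) else 0)"
    unfolding sum_distrib_left by (intro sum.cong) (auto simp: iff d1)
  also have "\<dots> \<le> x * (u powr (1 - 1 / p) / (1 - 1 / p))"
    using x p u0 by (intro mult_left_mono sum_powr_below) auto
  also have "1 - 1 / p = (p - 1) / p" using p by (simp add: field_simps)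
  also have "x * (u powr ((p - 1) / p) / ((p - 1) / p)) = p / (p - 1) * (x * u powr ((p - 1) / p))"
    using p by (simp add: field_simps)
  also have "x * u powr ((p - 1) / p) = t * u"
  proof (cases "x = 0")
    case False
    then have "u powr ((p - 1) / p) = (x / t) powr (p - 1)" using p x t by (simp add: u_def powr_powr)
    moreover have "u = (x / t) powr (p - 1) * (x / t)" using p x t False powr_add[of "x / t" "p - 1" 1] by (simp add: u_def)
    ultimately show ?thesis using t by simp
  qed (simp add: u_def)
  finally show "(\<Sum>i<N. if t * a i < x then x / a i else 0) \<le> p / (p - 1) * t * (x / t) powr p" by (simp add: u_def mult.assoc)
  show "(\<Sum>i<N. if t * a i < x then 0 else (x / a i) powr r) \<le> r / (r - p) * t powr r * (x / t) powr p"
  proof (cases "x = 0")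
    case False
    then have x: "0 < x" using x by simp
    then have u: "0 < u" using t by (simp add: u_def)
    have "(\<Sum>i<N. if t * a i < x then 0 else (x / a i) powr r)
        = x powr r * (\<Sum>i<N. if u \<le> real i + 1 then (real i + 1) powr - (r / p) else 0)"
      unfolding sum_distrib_left by (intro sum.cong) (auto simp: iff d2)
    also have "\<dots> \<le> x powr r * (r / p / (r / p - 1) * u powr (1 - r / p))"
      using x p u by (intro mult_left_mono sum_powr_above) auto
    also have "r / p / (r / p - 1) = r / (r - p)" using p by (simp add: field_simps)
    also have "u powr (1 - r / p) = u * (x / t) powr (- r)"
    proof -
      have "p * - (r / p) = - r" using p by simp
      then have "u powr - (r / p) = (x / t) powr - r" by (simp add: u_def powr_powr)
      then show ?thesis using u powr_add[of u 1 "- (r / p)"] by simp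
    qed
    also have "x powr r * (r / (r - p) * (u * (x / t) powr - r)) = r / (r - p) * t powr r * u"
    proof -
      have "x powr r * (x / t) powr - r = t powr r" using x t by (simp add: powr_divide powr_minus field_simps)
      then have "r / (r - p) * u * (x powr r * (x / t) powr - r) = r / (r - p) * u * t powr r" by simp
      then show ?thesis by (simp only: mult_ac)
    qed
    finally show ?thesis by (simp add: u_def)
  qed (use t p in \<open>auto intro!: sum_nonpos\<close>)
qed

section \<open>Truncation of identically distributed martingale differences\<close>

lemma ennreal_suminf_le_of_partial_sums:
  fixes f :: "nat \<Rightarrow> real"
  assumes "\<And>i. 0 \<le> f i" "\<And>N. (\<Sum>i<N. f i) \<le> c"
  shows "(\<Sum>i. ennreal (f i)) \<le> ennreal c"
proof (rule suminf_le_const)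
  fix N
  show "(\<Sum>i<N. ennreal (f i)) \<le> ennreal c"
    using assms by (simp add: sum_ennreal ennreal_leI)
qed auto

text \<open>Here \<open>b\<close> is the part of \<open>Y\<^sub>i\<close> above the level \<open>t a\<^sub>i\<close>, \<open>e\<close> its conditional expectation given the past, and
\<open>z\<close> the remaining part made into martingale differences by adding \<open>e\<close>, all divided by \<open>a\<^sub>i\<close>. As the
conditional expectation of \<open>Y\<^sub>i\<close> vanishes, \<open>-e\<close> is also the conditional expectation of the part
below the level; so Jensen's inequality bounds \<open>e\<close> in \<open>L\<^sup>1\<close> by the large part and in \<open>L\<^sup>r\<close> by the small part.
Only the law of the norms enters the resulting sums, hence the form of the second hypothesis.\<close>

lemma (in prob_space) truncation_decomposition:
  fixes Y :: "nat \<Rightarrow> 'a \<Rightarrow> 'b::{banach, second_countable_topology}"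
  assumes md: "mart_diff_seq M G Y"
    and id: "\<And>i. distr M borel (\<lambda>\<omega>. norm (Y i \<omega>)) = distr M borel (\<lambda>\<omega>. norm (Y 0 \<omega>))"
    and p: "1 < p" "p < r" "r \<le> 2" and t: "0 < t"
  defines "a \<equiv> (\<lambda>i::nat. (real i + 1) powr (1 / p))"
    and "U \<equiv> \<integral>\<^sup>+\<omega>. (norm (Y 0 \<omega>) / t) powr p \<partial>M"
  obtains z e b where
    "\<And>i \<omega>. Y i \<omega> /\<^sub>R a i = z i \<omega> - e i \<omega> + b i \<omega>"
    "mart_diff_seq M G z" "\<And>i. e i \<in> borel_measurable M" "\<And>i. b i \<in> borel_measurable M"
    "(\<Sum>i. \<integral>\<^sup>+\<omega>. norm (z i \<omega>) powr r \<partial>M) \<le> ennreal (4 * r / (r - p) * t powr r) * U"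
    "(\<Sum>i. \<integral>\<^sup>+\<omega>. norm (e i \<omega>) \<partial>M) \<le> ennreal (p / (p - 1) * t) * U"
    "(\<Sum>i. emeasure M {\<omega> \<in> space M. b i \<omega> \<noteq> 0}) \<le> U"
proof -
  note mdD = mart_diff_seqD[OF md]
  have Ym[measurable]: "Y n \<in> borel_measurable M" for n using mdD(4) by auto
  have a: "0 < a i" for i by (simp add: a_def)
  have transfer: "(\<integral>\<^sup>+\<omega>. f (norm (Y i \<omega>)) \<partial>M) = (\<integral>\<^sup>+\<omega>. f (norm (Y 0 \<omega>)) \<partial>M)"
    if [measurable]: "f \<in> borel_measurable borel" for f i
  proof -
    have "(\<integral>\<^sup>+\<omega>. f (norm (Y i \<omega>)) \<partial>M) = (\<integral>\<^sup>+x. f x \<partial>distr M borel (\<lambda>\<omega>. norm (Y i \<omega>)))"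
      by (subst nn_integral_distr) auto
    also have "\<dots> = (\<integral>\<^sup>+x. f x \<partial>distr M borel (\<lambda>\<omega>. norm (Y 0 \<omega>)))" by (rule arg_cong[OF id])
    also have "\<dots> = (\<integral>\<^sup>+\<omega>. f (norm (Y 0 \<omega>)) \<partial>M)" by (subst nn_integral_distr) auto
    finally show ?thesis .
  qed
  \<comment> \<open>All three estimates are instances: a pointwise bound of a sum, integrated over the common law.\<close>
  have transfer_sum: "(\<Sum>i. \<integral>\<^sup>+\<omega>. f i (norm (Y i \<omega>)) \<partial>M) \<le> ennreal c * U"
    if m[measurable]: "\<And>i. f i \<in> borel_measurable borel" and c: "0 \<le> c" and nn: "\<And>i x. 0 \<le> f i x"
      and le: "\<And>x N. 0 \<le> x \<Longrightarrow> (\<Sum>i<N. f i x) \<le> c * (x / t) powr p" for f :: "nat \<Rightarrow> real \<Rightarrow> real" and c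
  proof -
    have "(\<integral>\<^sup>+\<omega>. f i (norm (Y i \<omega>)) \<partial>M) = (\<integral>\<^sup>+\<omega>. f i (norm (Y 0 \<omega>)) \<partial>M)" for i
      by (rule transfer[of "\<lambda>x. ennreal (f i x)"]) measurable
    then have "(\<Sum>i. \<integral>\<^sup>+\<omega>. f i (norm (Y i \<omega>)) \<partial>M) = (\<Sum>i. \<integral>\<^sup>+\<omega>. f i (norm (Y 0 \<omega>)) \<partial>M)"
      by presburger
    also have "\<dots> = (\<integral>\<^sup>+\<omega>. (\<Sum>i. ennreal (f i (norm (Y 0 \<omega>)))) \<partial>M)"
      by (rule nn_integral_suminf[symmetric]) auto
    also have "\<dots> \<le> (\<integral>\<^sup>+\<omega>. ennreal (c * (norm (Y 0 \<omega>) / t) powr p) \<partial>M)"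
      using nn le by (intro nn_integral_mono ennreal_suminf_le_of_partial_sums) auto
    also have "\<dots> = ennreal c * U" unfolding U_def
      using c by (simp add: ennreal_mult nn_integral_cmult)
    finally show ?thesis .
  qed
  have aeq: "a i = (real i + 1) powr (1 / p)" for i by (simp add: a_def)
  note sums = truncation_sums[OF p(1,2) t, folded aeq]
  define big where "big i \<omega> = (if t * a i < norm (Y i \<omega>) then Y i \<omega> else 0)" for i \<omega>
  have big[measurable]: "big i \<in> borel_measurable M" for i unfolding big_def by measurable
  have bigi: "integrable M (big i)" for i
    by (rule Bochner_Integration.integrable_bound[OF mdD(4)[of i]]) (auto simp: big_def)
  define small where "small i \<omega> = Y i \<omega> - big i \<omega>" for i \<omega>
  have small_eq: "small i \<omega> = (if t * a i < norm (Y i \<omega>) then 0 else Y i \<omega>)" for i \<omega>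
    by (simp add: small_def big_def)
  have smalli: "integrable M (small i)" for i unfolding small_def using mdD(4) bigi by auto
  have small_meas: "small i \<in> borel_measurable (G (Suc i))" for i
  proof -
    note mdD(3)[of i, measurable]
    show ?thesis unfolding small_eq[abs_def] by measurable
  qed
  define ce where "ce i = cond_exp M (G i) (big i)" for i
  have ce: "has_cond_exp M (G i) (big i) (ce i)" for i
    unfolding ce_def by (rule has_cond_exp_cond_exp[OF mdD(1) bigi])
  have cem: "ce i \<in> borel_measurable (G i)" and cei[measurable]: "integrable M (ce i)" for i
    using has_cond_expD[OF ce] by auto
  have ce_small: "has_cond_exp M (G i) (small i) (\<lambda>\<omega>. 0 - ce i \<omega>)" for i
    unfolding small_def by (rule has_cond_exp_diff[OF mdD(1) mdD(5) ce mdD(4) bigi])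
  define z where "z i \<omega> = (1 / a i) *\<^sub>R (small i \<omega> + ce i \<omega>)" for i \<omega>
  define e where "e i \<omega> = ce i \<omega> /\<^sub>R a i" for i \<omega>
  define b where "b i \<omega> = big i \<omega> /\<^sub>R a i" for i \<omega>
  show thesis
  proof (rule that)
    show "Y i \<omega> /\<^sub>R a i = z i \<omega> - e i \<omega> + b i \<omega>" for i \<omega>
      by (simp add: z_def e_def b_def small_def algebra_simps divide_inverse)
    show "e i \<in> borel_measurable M" "b i \<in> borel_measurable M" for i
      unfolding e_def b_def by measurable
    show "mart_diff_seq M G z"
      unfolding mart_diff_seq_def
    proof (intro conjI allI)
      fix n
      show "subalgebra M (G n)" "sets (G n) \<subseteq> sets (G (Suc n))" using mdD(1) mdD(2)[of n "Suc n"] by auto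
      have [measurable]: "ce n \<in> borel_measurable (G (Suc n))"
        using mdD(2)[of n "Suc n"] by (intro measurable_coarser[OF mdD(1,1) _ cem]) auto
      note small_meas[of n, measurable]
      show "z n \<in> borel_measurable (G (Suc n))" unfolding z_def by measurable
      show "integrable M (z n)" unfolding z_def using smalli cei by auto
      have "has_cond_exp M (G n) (\<lambda>\<omega>. small n \<omega> + ce n \<omega>) (\<lambda>\<omega>. (0 - ce n \<omega>) + ce n \<omega>)"
        by (intro has_cond_exp_add mdD(1) ce_small has_cond_exp_self cem cei smalli)
      from has_cond_exp_scaleR[OF this, of "1 / a n"]
      show "has_cond_exp M (G n) (z n) (\<lambda>_. 0)" unfolding z_def by simp
    qed
    show "(\<Sum>i. emeasure M {\<omega> \<in> space M. b i \<omega> \<noteq> 0}) \<le> U"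
    proof -
      have "emeasure M {\<omega> \<in> space M. b i \<omega> \<noteq> 0}
          \<le> (\<integral>\<^sup>+\<omega>. (if t * a i < norm (Y i \<omega>) then 1 else 0) \<partial>M)" for i
      proof -
        have "emeasure M {\<omega> \<in> space M. b i \<omega> \<noteq> 0} = (\<integral>\<^sup>+\<omega>. indicator {\<omega> \<in> space M. b i \<omega> \<noteq> 0} \<omega> \<partial>M)"
          unfolding b_def by (subst nn_integral_indicator) auto
        also have "\<dots> \<le> (\<integral>\<^sup>+\<omega>. (if t * a i < norm (Y i \<omega>) then 1 else 0) \<partial>M)"
          by (intro nn_integral_mono) (auto simp: indicator_def b_def big_def)
        finally show ?thesis .
      qed
      then have "(\<Sum>i. emeasure M {\<omega> \<in> space M. b i \<omega> \<noteq> 0})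
          \<le> (\<Sum>i. \<integral>\<^sup>+\<omega>. ennreal (if t * a i < norm (Y i \<omega>) then 1 else 0) \<partial>M)"
        by (intro suminf_le) (auto simp: if_distrib[of ennreal] cong: if_cong)
      also have "\<dots> \<le> ennreal 1 * U"
        by (rule transfer_sum[of "\<lambda>i x. if t * a i < x then 1 else 0"]) (use sums(1) in auto)
      finally show ?thesis by simp
    qed
    show "(\<Sum>i. \<integral>\<^sup>+\<omega>. norm (e i \<omega>) \<partial>M) \<le> ennreal (p / (p - 1) * t) * U"
    proof -
      have "(\<integral>\<^sup>+\<omega>. norm (e i \<omega>) \<partial>M) \<le> (\<integral>\<^sup>+\<omega>. (if t * a i < norm (Y i \<omega>) then norm (Y i \<omega>) / a i else 0) \<partial>M)" for i
      proof -
        have "has_cond_exp M (G i) (\<lambda>\<omega>. big i \<omega> /\<^sub>R a i) (e i)"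
          unfolding e_def by (rule has_cond_exp_scaleR[OF ce])
        from has_cond_exp_powr_le[OF mdD(1) this, of 1] bigi
        have "(\<integral>\<^sup>+\<omega>. norm (e i \<omega>) \<partial>M) \<le> (\<integral>\<^sup>+\<omega>. norm (big i \<omega> /\<^sub>R a i) \<partial>M)" by simp
        also have "\<dots> = (\<integral>\<^sup>+\<omega>. (if t * a i < norm (Y i \<omega>) then norm (Y i \<omega>) / a i else 0) \<partial>M)"
          using a[of i] by (intro nn_integral_cong) (auto simp: big_def divide_inverse)
        finally show ?thesis .
      qed
      then have "(\<Sum>i. \<integral>\<^sup>+\<omega>. norm (e i \<omega>) \<partial>M)
        \<le> (\<Sum>i. \<integral>\<^sup>+\<omega>. ennreal (if t * a i < norm (Y i \<omega>) then norm (Y i \<omega>) / a i else 0) \<partial>M)"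
        by (intro suminf_le) auto
      also have "\<dots> \<le> ennreal (p / (p - 1) * t) * U"
      proof -
        \<comment> \<open>The absolute value makes the nonnegativity of the integrand evident.\<close>
        have "(\<Sum>i. \<integral>\<^sup>+\<omega>. ennreal ((\<lambda>i x. if t * a i < x then \<bar>x\<bar> / a i else 0) i (norm (Y i \<omega>))) \<partial>M) \<le> ennreal (p / (p - 1) * t) * U"
        proof (rule transfer_sum)
          fix x :: real and N assume "0 \<le> x"
          with sums(2)[of x N] show "(\<Sum>i<N. if t * a i < x then \<bar>x\<bar> / a i else 0) \<le> p / (p - 1) * t * (x / t) powr p" by simp
        qed (use p t a in \<open>auto intro!: divide_nonneg_pos\<close>)
        then show ?thesis by (simp cong: if_cong)
      qed
      finally show ?thesis .
    qed
    show "(\<Sum>i. \<integral>\<^sup>+\<omega>. norm (z i \<omega>) powr r \<partial>M) \<le> ennreal (4 * r / (r - p) * t powr r) * U"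
    proof -
      \<comment> \<open>The factor is \<open>2\<^sup>r \<le> 4\<close>: convexity gives \<open>2\<^bsup>r-1\<^esup>\<close> for each of two terms with equal bounds.\<close>
      have "(\<integral>\<^sup>+\<omega>. norm (z i \<omega>) powr r \<partial>M) \<le> (\<integral>\<^sup>+\<omega>. 4 * (if t * a i < norm (Y i \<omega>) then 0 else (norm (Y i \<omega>) / a i) powr r) \<partial>M)" for i
      proof -
        define s where "s \<omega> = small i \<omega> /\<^sub>R a i" for \<omega>
        have [measurable]: "s \<in> borel_measurable M" unfolding s_def small_def by measurable
        have [measurable]: "e i \<in> borel_measurable M" unfolding e_def by measurable
        have pt: "norm (z i \<omega>) powr r \<le> 2 * norm (s \<omega>) powr r + 2 * norm (e i \<omega>) powr r" for \<omega>
        proof -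
          have "norm (z i \<omega>) = norm (s \<omega> + e i \<omega>)" by (simp add: z_def s_def e_def divide_inverse scaleR_add_right)
          also have "\<dots> \<le> 2 * \<bar>(1 - 1/2) * norm (s \<omega>) + 1/2 * norm (e i \<omega>)\<bar>"
            using norm_triangle_ineq[of "s \<omega>" "e i \<omega>"] by simp
          finally have "norm (z i \<omega>) powr r \<le> (2 * \<bar>(1 - 1/2) * norm (s \<omega>) + 1/2 * norm (e i \<omega>)\<bar>) powr r"
            using p by (intro powr_mono2) auto
          also have "\<dots> = 2 powr r * \<bar>(1 - 1/2) * norm (s \<omega>) + 1/2 * norm (e i \<omega>)\<bar> powr r"
            by (rule powr_mult)
          also have "\<dots> \<le> 2 powr r * ((1 - 1/2) * \<bar>norm (s \<omega>)\<bar> powr r + 1/2 * \<bar>norm (e i \<omega>)\<bar> powr r)"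
            using convex_onD[OF convex_on_abs_powr[of r], of "1/2" "norm (s \<omega>)" "norm (e i \<omega>)"] p
            by (intro mult_left_mono) auto
          also have "\<dots> \<le> 2 powr 2 * ((1 - 1/2) * \<bar>norm (s \<omega>)\<bar> powr r + 1/2 * \<bar>norm (e i \<omega>)\<bar> powr r)"
            using p by (intro mult_right_mono powr_mono) auto
          finally show ?thesis by simp
        qed
        have "has_cond_exp M (G i) s (\<lambda>\<omega>. (0 - ce i \<omega>) /\<^sub>R a i)"
          unfolding s_def by (rule has_cond_exp_scaleR[OF ce_small])
        moreover have "integrable M s" unfolding s_def using smalli by simp
        ultimately have "(\<integral>\<^sup>+\<omega>. norm ((0 - ce i \<omega>) /\<^sub>R a i) powr r \<partial>M) \<le> (\<integral>\<^sup>+\<omega>. norm (s \<omega>) powr r \<partial>M)"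
          using p by (intro has_cond_exp_powr_le[OF mdD(1)]) auto
        then have es: "(\<integral>\<^sup>+\<omega>. norm (e i \<omega>) powr r \<partial>M) \<le> (\<integral>\<^sup>+\<omega>. norm (s \<omega>) powr r \<partial>M)"
          by (simp add: e_def s_def)
        have "(\<integral>\<^sup>+\<omega>. norm (z i \<omega>) powr r \<partial>M) \<le> (\<integral>\<^sup>+\<omega>. 2 * ennreal (norm (s \<omega>) powr r) + 2 * ennreal (norm (e i \<omega>) powr r) \<partial>M)"
          using pt by (intro nn_integral_mono) (auto simp flip: ennreal_numeral ennreal_mult ennreal_plus simp: ennreal_leI)
        also have "\<dots> = 2 * (\<integral>\<^sup>+\<omega>. norm (s \<omega>) powr r \<partial>M) + 2 * (\<integral>\<^sup>+\<omega>. norm (e i \<omega>) powr r \<partial>M)"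
          by (subst nn_integral_add) (auto simp: nn_integral_cmult)
        also have "\<dots> \<le> 2 * (\<integral>\<^sup>+\<omega>. norm (s \<omega>) powr r \<partial>M) + 2 * (\<integral>\<^sup>+\<omega>. norm (s \<omega>) powr r \<partial>M)"
          by (intro add_left_mono mult_left_mono es) auto
        also have "\<dots> = 4 * (\<integral>\<^sup>+\<omega>. norm (s \<omega>) powr r \<partial>M)"
          by (simp add: distrib_right[symmetric])
        also have "\<dots> = (\<integral>\<^sup>+\<omega>. 4 * ennreal (norm (s \<omega>) powr r) \<partial>M)"
          by (rule nn_integral_cmult[symmetric]) auto
        also have "\<dots> = (\<integral>\<^sup>+\<omega>. 4 * (if t * a i < norm (Y i \<omega>) then 0 else (norm (Y i \<omega>) / a i) powr r) \<partial>M)"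
          using a[of i] p by (intro nn_integral_cong)
             (auto simp: s_def small_eq divide_inverse mult.commute ennreal_mult)
        finally show ?thesis .
      qed
      then have "(\<Sum>i. \<integral>\<^sup>+\<omega>. norm (z i \<omega>) powr r \<partial>M)
        \<le> (\<Sum>i. \<integral>\<^sup>+\<omega>. ennreal ((\<lambda>i x. 4 * (if t * a i < x then 0 else (x / a i) powr r)) i (norm (Y i \<omega>))) \<partial>M)"
        by (intro suminf_le) auto
      also have "\<dots> \<le> ennreal (4 * r / (r - p) * t powr r) * U"
      proof (rule transfer_sum)
        fix x :: real and N assume "0 \<le> x"
        with sums(3)[of x N] show "(\<Sum>i<N. 4 * (if t * a i < x then 0 else (x / a i) powr r)) \<le> 4 * r / (r - p) * t powr r * (x / t) powr p"
          by (simp add: sum_distrib_left[symmetric])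
      qed (use p in auto)
      finally show ?thesis .
    qed
  qed
qed

text \<open>If no \<open>Y\<^sub>i\<close> exceeds its level, the compensators sum to less than \<open>t\<close> and the martingale of the small parts
stays below \<open>t\<close>, then the weighted sums stay below \<open>2t\<close>. The three exceptional events are estimated by the union bound,
Markov's inequality and the maximal inequality.\<close>

lemma (in prob_space) weighted_sums_weak_type:
  fixes Y :: "nat \<Rightarrow> 'a \<Rightarrow> 'b::{banach, second_countable_topology}"
  assumes sm: "rD_smooth TYPE('b) r D" and md: "mart_diff_seq M G Y"
    and id: "\<And>i. distr M borel (\<lambda>\<omega>. norm (Y i \<omega>)) = distr M borel (\<lambda>\<omega>. norm (Y 0 \<omega>))"
    and p: "1 < p" "p < r" "r \<le> 2" and t: "0 < t"
  shows "emeasure M {\<omega> \<in> space M. \<exists>n. 2 * t < norm (\<Sum>i<n. Y i \<omega> /\<^sub>R (real i + 1) powr (1 / p))}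
    \<le> ennreal (1 + p / (p - 1) + 4 * r / (r - p) * D powr r) * (\<integral>\<^sup>+\<omega>. (norm (Y 0 \<omega>) / t) powr p \<partial>M)"
proof -
  define U where "U = (\<integral>\<^sup>+\<omega>. (norm (Y 0 \<omega>) / t) powr p \<partial>M)"
  obtain z e b where dec: "\<And>i \<omega>. Y i \<omega> /\<^sub>R (real i + 1) powr (1 / p) = z i \<omega> - e i \<omega> + b i \<omega>"
    and z: "mart_diff_seq M G z" and m[measurable]: "\<And>i. e i \<in> borel_measurable M" "\<And>i. b i \<in> borel_measurable M"
    and zb: "(\<Sum>i. \<integral>\<^sup>+\<omega>. norm (z i \<omega>) powr r \<partial>M) \<le> ennreal (4 * r / (r - p) * t powr r) * U"
    and eb: "(\<Sum>i. \<integral>\<^sup>+\<omega>. norm (e i \<omega>) \<partial>M) \<le> ennreal (p / (p - 1) * t) * U"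
    and bb: "(\<Sum>i. emeasure M {\<omega> \<in> space M. b i \<omega> \<noteq> 0}) \<le> U"
    by (rule truncation_decomposition[OF md id p t, folded U_def]) (rule that)
  have [measurable]: "z n \<in> borel_measurable M" for n using mart_diff_seqD(4)[OF z] by auto
  define EZ where "EZ = {\<omega> \<in> space M. \<exists>n. t < norm (\<Sum>i<n. z i \<omega>)}"
  define EE where "EE = {\<omega> \<in> space M. ennreal t \<le> (\<Sum>i. ennreal (norm (e i \<omega>)))}"
  define EB where "EB = (\<Union>i. {\<omega> \<in> space M. b i \<omega> \<noteq> 0})"
  have [measurable]: "EZ \<in> sets M" "EE \<in> sets M" "EB \<in> sets M" unfolding EZ_def EE_def EB_def by measurable
  have PZ: "emeasure M EZ \<le> ennreal (4 * r / (r - p) * D powr r) * U"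
  proof -
    have "emeasure M EZ \<le> ennreal (t powr - r) * (ennreal (D powr r) * (\<Sum>i. \<integral>\<^sup>+\<omega>. norm (z i \<omega>) powr r \<partial>M))"
      unfolding EZ_def by (rule mart_diff_seq_maximal[OF sm z _ t]) (use p in auto)
    also have "\<dots> \<le> ennreal (t powr - r) * (ennreal (D powr r) * (ennreal (4 * r / (r - p) * t powr r) * U))"
      by (intro mult_left_mono zb) auto
    also have "\<dots> = ennreal (t powr - r * (D powr r * (4 * r / (r - p) * t powr r))) * U"
    proof -
      define K where "K = 4 * r / (r - p) * t powr r"
      have "0 \<le> K" using p by (simp add: K_def)
      then show ?thesis unfolding K_def[symmetric] by (simp add: ennreal_mult mult.assoc)
    qed
    also have "t powr - r * (D powr r * (4 * r / (r - p) * t powr r)) = 4 * r / (r - p) * D powr r"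
      using t by (simp add: powr_minus)
    finally show ?thesis .
  qed
  have PE: "emeasure M EE \<le> ennreal (p / (p - 1)) * U"
  proof -
    have "ennreal t * emeasure M EE = (\<integral>\<^sup>+\<omega>. ennreal t * indicator EE \<omega> \<partial>M)"
      by (simp add: nn_integral_cmult_indicator)
    also have "\<dots> \<le> (\<integral>\<^sup>+\<omega>. (\<Sum>i. ennreal (norm (e i \<omega>))) \<partial>M)"
      by (intro nn_integral_mono) (auto simp: indicator_def EE_def)
    finally have "ennreal (1 / t) * (ennreal t * emeasure M EE) \<le> ennreal (1 / t) * (\<integral>\<^sup>+\<omega>. (\<Sum>i. ennreal (norm (e i \<omega>))) \<partial>M)"
      by (intro mult_left_mono) auto
    moreover have "ennreal (1 / t) * (ennreal t * emeasure M EE) = emeasure M EE"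
      using t by (simp add: mult.assoc[symmetric] ennreal_mult[symmetric])
    ultimately have "emeasure M EE \<le> ennreal (1 / t) * (\<integral>\<^sup>+\<omega>. (\<Sum>i. ennreal (norm (e i \<omega>))) \<partial>M)" by simp
    also have "(\<integral>\<^sup>+\<omega>. (\<Sum>i. ennreal (norm (e i \<omega>))) \<partial>M) = (\<Sum>i. \<integral>\<^sup>+\<omega>. norm (e i \<omega>) \<partial>M)"
      by (rule nn_integral_suminf) auto
    also have "ennreal (1 / t) * \<dots> \<le> ennreal (1 / t) * (ennreal (p / (p - 1) * t) * U)"
      by (intro mult_left_mono eb) auto
    also have "\<dots> = ennreal (p / (p - 1)) * U"
      using p t by (simp add: mult.assoc[symmetric] ennreal_mult[symmetric])
    finally show ?thesis .
  qed
  have PB: "emeasure M EB \<le> U"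
    unfolding EB_def by (rule order_trans[OF emeasure_subadditive_countably bb]) auto
  have "{\<omega> \<in> space M. \<exists>n. 2 * t < norm (\<Sum>i<n. Y i \<omega> /\<^sub>R (real i + 1) powr (1 / p))} \<subseteq> EZ \<union> EE \<union> EB"
  proof (rule subsetI, rule ccontr)
    fix \<omega> assume w: "\<omega> \<in> {\<omega> \<in> space M. \<exists>n. 2 * t < norm (\<Sum>i<n. Y i \<omega> /\<^sub>R (real i + 1) powr (1 / p))}"
      and n: "\<omega> \<notin> EZ \<union> EE \<union> EB"
    then obtain n where n2: "2 * t < norm (\<Sum>i<n. Y i \<omega> /\<^sub>R (real i + 1) powr (1 / p))" by auto
    have b0: "b i \<omega> = 0" for i using w n by (auto simp: EB_def)
    have "(\<Sum>i<n. ennreal (norm (e i \<omega>))) \<le> (\<Sum>i. ennreal (norm (e i \<omega>)))" by (rule sum_le_suminf) auto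
    also have "\<dots> < ennreal t" using w n by (auto simp: EE_def not_le)
    finally have e: "(\<Sum>i<n. norm (e i \<omega>)) < t" by (simp add: ennreal_less_iff sum_nonneg)
    have "norm (\<Sum>i<n. Y i \<omega> /\<^sub>R (real i + 1) powr (1 / p)) = norm ((\<Sum>i<n. z i \<omega>) - (\<Sum>i<n. e i \<omega>))"
      unfolding dec by (simp add: b0 sum_subtractf)
    also have "\<dots> \<le> norm (\<Sum>i<n. z i \<omega>) + (\<Sum>i<n. norm (e i \<omega>))"
      by (rule order_trans[OF norm_triangle_ineq4]) (intro add_left_mono norm_sum)
    also have "norm (\<Sum>i<n. z i \<omega>) \<le> t" using w n by (auto simp: EZ_def not_less)
    finally show False using e n2 by simp
  qed
  then have "emeasure M {\<omega> \<in> space M. \<exists>n. 2 * t < norm (\<Sum>i<n. Y i \<omega> /\<^sub>R (real i + 1) powr (1 / p))}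
     \<le> emeasure M (EZ \<union> EE \<union> EB)" by (intro emeasure_mono) auto
  also have "\<dots> \<le> emeasure M (EZ \<union> EE) + emeasure M EB" by (intro emeasure_subadditive) auto
  also have "emeasure M (EZ \<union> EE) \<le> emeasure M EZ + emeasure M EE" by (intro emeasure_subadditive) auto
  also have "emeasure M EZ + emeasure M EE + emeasure M EB
      \<le> ennreal (4 * r / (r - p) * D powr r) * U + ennreal (p / (p - 1)) * U + ennreal 1 * U"
    using PZ PE PB by (intro add_mono) auto
  also have "\<dots> = ennreal (1 + p / (p - 1) + 4 * r / (r - p) * D powr r) * U"
  proof -
    have nn: "0 \<le> 4 * r / (r - p) * D powr r" "0 \<le> p / (p - 1)" using p by auto
    have "ennreal (4 * r / (r - p) * D powr r) * U + ennreal (p / (p - 1)) * U + ennreal 1 * U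
      = ennreal (4 * r / (r - p) * D powr r + p / (p - 1) + 1) * U"
      using nn by (simp only: ennreal_plus add_nonneg_nonneg zero_le_one distrib_right)
    also have "4 * r / (r - p) * D powr r + p / (p - 1) + 1 = 1 + p / (p - 1) + 4 * r / (r - p) * D powr r" by simp
    finally show ?thesis .
  qed
  finally show ?thesis by (simp add: U_def add_right_mono)
qed

text \<open>Each of the three parts of the truncation at level \<open>a\<^sub>i\<close> is summable almost surely: the small parts by martingale
convergence, the compensators because they are summable in \<open>L\<^sup>1\<close>, the large parts by Borel--Cantelli.\<close>

lemma (in prob_space) weighted_sums_summable:
  fixes Y :: "nat \<Rightarrow> 'a \<Rightarrow> 'b::{banach, second_countable_topology}"
  assumes sm: "rD_smooth TYPE('b) r D" and md: "mart_diff_seq M G Y"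
    and id: "\<And>i. distr M borel (\<lambda>\<omega>. norm (Y i \<omega>)) = distr M borel (\<lambda>\<omega>. norm (Y 0 \<omega>))"
    and p: "1 < p" "p < r" "r \<le> 2" and fin: "(\<integral>\<^sup>+\<omega>. norm (Y 0 \<omega>) powr p \<partial>M) < \<infinity>"
  shows "AE \<omega> in M. summable (\<lambda>i. Y i \<omega> /\<^sub>R (real i + 1) powr (1 / p))"
proof -
  define U where "U = (\<integral>\<^sup>+\<omega>. (norm (Y 0 \<omega>) / 1) powr p \<partial>M)"
  have U: "U < \<infinity>" using fin by (simp add: U_def)
  obtain z e b where dec: "\<And>i \<omega>. Y i \<omega> /\<^sub>R (real i + 1) powr (1 / p) = z i \<omega> - e i \<omega> + b i \<omega>"
    and z: "mart_diff_seq M G z" and m[measurable]: "\<And>i. e i \<in> borel_measurable M" "\<And>i. b i \<in> borel_measurable M"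
    and zb: "(\<Sum>i. \<integral>\<^sup>+\<omega>. norm (z i \<omega>) powr r \<partial>M) \<le> ennreal (4 * r / (r - p) * 1 powr r) * U"
    and eb: "(\<Sum>i. \<integral>\<^sup>+\<omega>. norm (e i \<omega>) \<partial>M) \<le> ennreal (p / (p - 1) * 1) * U"
    and bb: "(\<Sum>i. emeasure M {\<omega> \<in> space M. b i \<omega> \<noteq> 0}) \<le> U"
    by (rule truncation_decomposition[OF md id p zero_less_one, folded U_def]) (rule that)
  have f: "ennreal c * U < \<infinity>" for c using U by (simp add: ennreal_mult_less_top)
  have "AE \<omega> in M. summable (\<lambda>i. z i \<omega>)"
    by (rule mart_diff_seq_convergent[OF sm z]) (use p order_le_less_trans[OF zb f] in auto)
  moreover have "AE \<omega> in M. summable (\<lambda>i. e i \<omega>)"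
  proof -
    have "(\<integral>\<^sup>+\<omega>. (\<Sum>i. ennreal (norm (e i \<omega>))) \<partial>M) < \<infinity>"
      using order_le_less_trans[OF eb f] by (subst nn_integral_suminf) auto
    then have "AE \<omega> in M. (\<Sum>i. ennreal (norm (e i \<omega>))) \<noteq> \<infinity>"
      by (intro nn_integral_PInf_AE) auto
    then show ?thesis
    proof eventually_elim
      case (elim \<omega>)
      then have "summable (\<lambda>i. norm (e i \<omega>))" by (intro summable_suminf_not_top) auto
      then show ?case by (rule summable_norm_cancel)
    qed
  qed
  moreover have "AE \<omega> in M. summable (\<lambda>i. b i \<omega>)"
  proof -
    have "AE \<omega> in M. \<forall>\<^sub>F n in sequentially. \<omega> \<in> space M - {\<omega> \<in> space M. b n \<omega> \<noteq> 0}"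
    proof (rule borel_cantelli_AE1)
      have "(\<Sum>i. ennreal (measure M {\<omega> \<in> space M. b i \<omega> \<noteq> 0})) \<noteq> \<infinity>"
        using order_le_less_trans[OF bb U] by (simp add: emeasure_eq_measure)
      then show "summable (\<lambda>n. measure M {\<omega> \<in> space M. b n \<omega> \<noteq> 0})"
        by (intro summable_suminf_not_top) auto
    qed (auto simp: emeasure_eq_measure)
    then show ?thesis
    proof eventually_elim
      case (elim \<omega>)
      then obtain N where "\<And>n. n \<ge> N \<Longrightarrow> b n \<omega> = 0" by (auto simp: eventually_sequentially)
      then show ?case by (intro summable_finite[of "{..<N}"]) auto
    qed
  qed
  ultimately show ?thesis
  proof eventually_elim
    case (elim \<omega>)
    then show ?case unfolding dec by (intro summable_add summable_diff)
  qed
qed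

section \<open>Strong and weak Lebesgue norms\<close>

lemma ennreal_le_suminf:
  fixes f :: "nat \<Rightarrow> ennreal"
  shows "f j \<le> suminf f"
  using sum_le_suminf[of f "{j}"] by simp

lemma (in prob_space) nn_integral_norm_le_Lp_norm:
  fixes Z :: "'a \<Rightarrow> 'b::{banach, second_countable_topology}"
  assumes p: "1 < p" and Z[measurable]: "Z \<in> borel_measurable M"
  shows "(\<integral>\<^sup>+\<omega>. norm (Z \<omega>) \<partial>M) \<le> Lp_norm p M Z"
proof (cases "(\<integral>\<^sup>+\<omega>. norm (Z \<omega>) powr p \<partial>M) = \<infinity>")
  case True
  then show ?thesis by (simp add: Lp_norm_def)
next
  case False
  define i where "i = enn2real (\<integral>\<^sup>+\<omega>. norm (Z \<omega>) powr p \<partial>M)"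
  have i: "(\<integral>\<^sup>+\<omega>. norm (Z \<omega>) powr p \<partial>M) = ennreal i" "0 \<le> i"
    using False by (auto simp: i_def less_top)
  have L: "Lp_norm p M Z = ennreal (i powr (1 / p))" using False by (simp add: Lp_norm_def i_def)
  show ?thesis
  proof (cases "i = 0")
    case True
    then have "AE \<omega> in M. ennreal (norm (Z \<omega>) powr p) = 0"
      using i(1) by (intro iffD1[OF nn_integral_0_iff_AE]) auto
    then have "AE \<omega> in M. ennreal (norm (Z \<omega>)) = 0" by eventually_elim (auto simp: ennreal_eq_0_iff)
    then have "(\<integral>\<^sup>+\<omega>. norm (Z \<omega>) \<partial>M) = 0" by (subst nn_integral_0_iff_AE) auto
    then show ?thesis by simp
  next
    case False
    define c where "c = i powr (1 / p)"
    have c: "0 < c" "c powr p = i" using False i p by (auto simp: c_def powr_powr)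
    have "(\<integral>\<^sup>+\<omega>. norm (Z \<omega>) \<partial>M) \<le> (\<integral>\<^sup>+\<omega>. ennreal (c powr (1 - p) / p) * ennreal (norm (Z \<omega>) powr p) + ennreal (c * (1 - 1 / p)) \<partial>M)"
      using young_scaled[OF p c(1)] p c
      by (intro nn_integral_mono) (auto simp flip: ennreal_mult ennreal_plus intro!: ennreal_leI)
    also have "\<dots> = ennreal (c powr (1 - p) / p) * ennreal i + ennreal (c * (1 - 1 / p))"
      by (subst nn_integral_add) (auto simp: nn_integral_cmult i emeasure_space_1)
    also have "\<dots> = ennreal (c powr (1 - p) / p * i + c * (1 - 1 / p))"
      using p c i by (simp flip: ennreal_mult ennreal_plus)
    also have "c powr (1 - p) / p * i + c * (1 - 1 / p) = c"
    proof -
      have "c powr (1 - p) * i = c" using powr_add[of c "1 - p" p] c by simp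
      then have "c powr (1 - p) / p * i = c / p" by simp
      then show ?thesis by (simp only: right_diff_distrib) simp
    qed
    finally show ?thesis by (simp add: L c_def)
  qed
qed

lemma (in prob_space) prob_le_weak_Lp_norm:
  assumes w: "weak_Lp_norm p M f \<le> ennreal N" and N: "0 \<le> N" and p: "1 < p" and t: "0 < t"
  shows "prob {\<omega> \<in> space M. ennreal t < f \<omega>} \<le> (N / t) powr p"
proof -
  define P where "P = prob {\<omega> \<in> space M. ennreal t < f \<omega>}"
  have "ennreal (t * P powr (1 / p)) \<le> weak_Lp_norm p M f"
    unfolding weak_Lp_norm_def P_def using t by (intro SUP_upper2[of t]) auto
  then have "t * P powr (1 / p) \<le> N" using w N by (metis ennreal_le_iff order_trans)
  then have "P powr (1 / p) \<le> N / t" using t by (simp add: field_simps)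
  then have "(P powr (1 / p)) powr p \<le> (N / t) powr p" using p by (intro powr_mono2) auto
  then show ?thesis using p by (simp add: powr_powr P_def)
qed

text \<open>The weak \<open>L\<^sup>p\<close> norm is not subadditive; but for \<open>p > 1\<close> it is equivalent to the norm
\<open>sup\<^sub>A P(A)\<^bsup>1/p-1\<^esup> E(f; A)\<close>, which is. This lemma is the nontrivial half of the equivalence: \<open>f\<close> is bounded by
\<open>s\<close> plus the dyadic sum \<open>\<Sum>\<^sub>j 2\<^bsup>j+1\<^esup> s 1(f > 2\<^sup>j s)\<close>, whose integral is a geometric series with ratio \<open>2\<^bsup>1-p\<^esup>\<close>.\<close>

lemma (in prob_space) set_nn_integral_le_weak_Lp:
  fixes f :: "'a \<Rightarrow> ennreal"
  assumes f[measurable]: "f \<in> borel_measurable M" and A[measurable]: "A \<in> events"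
    and p: "1 < p" "p \<le> 2" and N: "0 \<le> N" and w: "weak_Lp_norm p M f \<le> ennreal N"
  shows "(\<integral>\<^sup>+\<omega>\<in>A. f \<omega> \<partial>M) \<le> ennreal (5 / (p - 1) * N * prob A powr (1 - 1 / p))"
proof (cases "prob A = 0")
  case True
  then have "AE \<omega> in M. \<omega> \<notin> A" by (simp add: prob_eq_0)
  then have "AE \<omega> in M. f \<omega> * indicator A \<omega> = 0" by eventually_elim auto
  then have "(\<integral>\<^sup>+\<omega>\<in>A. f \<omega> \<partial>M) = 0" by (subst nn_integral_0_iff_AE) auto
  then show ?thesis by simp
next
  case False
  then have P: "0 < prob A" by (simp add: zero_less_measure_iff)
  define q where "q = 2 powr (1 - p)"
  have q: "0 < q" "2 * q \<le> 3 - p"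
  proof -
    have "(1/2) powr (p - 1) * 1 powr (2 - p) \<le> (p - 1) * (1/2) + (2 - p) * (1::real)"
      using p by (intro Youngs_inequality_0) auto
    moreover have "(1/2) powr (p - 1) = q" unfolding q_def using powr_minus_divide[of 2 "p - 1"] by (simp add: powr_divide)
    ultimately show "2 * q \<le> 3 - p" by (simp add: field_simps)
  qed (simp add: q_def)
  have q1: "q < 1" using q p by linarith
  \<comment> \<open>A strictly larger \<open>N'\<close> covers the case \<open>N = 0\<close>, in which no positive level could be chosen.\<close>
  have pos: "(\<integral>\<^sup>+\<omega>\<in>A. f \<omega> \<partial>M) \<le> ennreal (5 / (p - 1) * N' * prob A powr (1 - 1 / p))" if N': "0 < N'" "N \<le> N'" for N'
  proof -
    \<comment> \<open>The level at which the bound \<open>s P(A)\<close> for the low part and the tail bound \<open>s (N'/s)\<^sup>p\<close> balance.\<close>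
    define s where "s = N' * prob A powr - (1 / p)"
    have s: "0 < s" using N' P by (simp add: s_def)
    have Ns: "(N' / s) powr p = prob A"
      using N' P p by (simp add: s_def powr_minus powr_mult powr_powr divide_simps)
    have pt: "f \<omega> \<le> ennreal s + (\<Sum>j. ennreal (2 ^ Suc j * s) * indicator {\<omega>\<in>space M. ennreal (2 ^ j * s) < f \<omega>} \<omega>)"
      (is "_ \<le> _ + suminf ?g") if w: "\<omega> \<in> space M" for \<omega>
    proof (cases "f \<omega>")
      case (real x)
      show ?thesis
      proof (cases "x \<le> s")
        case True
        then show ?thesis using real by (intro order_trans[OF _ add_increasing2[OF zero_le order_refl]]) (simp add: ennreal_leI)
      next
        case False
        have ex: "\<exists>j. x \<le> 2 ^ j * s"
        proof -
          obtain j where "x / s < 2 ^ j" using real_arch_pow[of 2 "x / s"] by auto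
          then show ?thesis using s by (intro exI[of _ j]) (simp add: field_simps)
        qed
        define k where "k = (LEAST j. x \<le> 2 ^ j * s)"
        have k: "x \<le> 2 ^ k * s" unfolding k_def by (rule LeastI_ex[OF ex])
        then have "k \<noteq> 0" using False by (intro notI) simp
        then obtain j where j: "k = Suc j" by (cases k) auto
        have "\<not> x \<le> 2 ^ j * s" using not_less_Least[of j "\<lambda>j. x \<le> 2 ^ j * s"] by (simp add: k_def[symmetric] j)
        then have "f \<omega> \<le> ?g j" using real k w s by (auto simp: j indicator_def ennreal_less_iff intro!: ennreal_leI)
        also have "\<dots> \<le> suminf ?g" by (rule ennreal_le_suminf)
        finally show ?thesis by (rule order_trans) simp
      qed
    next
      case top
      have "ennreal s \<le> ?g j" for j
      proof -
        have "s \<le> 2 ^ Suc j * s" using mult_right_mono[OF one_le_power[of 2 "Suc j"], of s] s by simp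
        then show ?thesis using top w by (auto simp: indicator_def intro!: ennreal_leI)
      qed
      then have "(\<Sum>j::nat. ennreal s) \<le> suminf ?g" by (intro suminf_le) auto
      moreover have "(\<Sum>j::nat. ennreal s) = top" using s
        by (subst nn_integral_count_space_nat[symmetric]) (simp add: ennreal_mult_top)
      ultimately show ?thesis by (simp add: top.extremum_unique)
    qed
    have "(\<integral>\<^sup>+\<omega>\<in>A. f \<omega> \<partial>M) \<le> (\<integral>\<^sup>+\<omega>. ennreal s * indicator A \<omega> + (\<Sum>j. ennreal (2 ^ Suc j * s) * indicator {\<omega>\<in>space M. ennreal (2 ^ j * s) < f \<omega>} \<omega>) \<partial>M)"
      using pt by (intro nn_integral_mono) (auto simp: indicator_def)
    also have "\<dots> = ennreal s * emeasure M A + (\<Sum>j. \<integral>\<^sup>+\<omega>. ennreal (2 ^ Suc j * s) * indicator {\<omega>\<in>space M. ennreal (2 ^ j * s) < f \<omega>} \<omega> \<partial>M)"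
      by (subst nn_integral_add) (auto simp: nn_integral_suminf nn_integral_cmult_indicator)
    also have "\<dots> \<le> ennreal s * emeasure M A + (\<Sum>j. ennreal (2 * s * prob A * q ^ j))"
    proof (intro add_left_mono suminf_le)
      fix j
      define t where "t = 2 ^ j * s"
      have t: "0 < t" using s by (simp add: t_def)
      have "(\<integral>\<^sup>+\<omega>. ennreal (2 ^ Suc j * s) * indicator {\<omega>\<in>space M. ennreal (2 ^ j * s) < f \<omega>} \<omega> \<partial>M)
         = ennreal (2 * t * prob {\<omega>\<in>space M. ennreal t < f \<omega>})"
      proof -
        have "2 ^ Suc j * s = 2 * t" by (simp add: t_def)
        then have "(\<integral>\<^sup>+\<omega>. ennreal (2 ^ Suc j * s) * indicator {\<omega>\<in>space M. ennreal (2 ^ j * s) < f \<omega>} \<omega> \<partial>M)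
          = (\<integral>\<^sup>+\<omega>. ennreal (2 * t) * indicator {\<omega>\<in>space M. ennreal t < f \<omega>} \<omega> \<partial>M)" by (simp only: t_def)
        also have "\<dots> = ennreal (2 * t) * emeasure M {\<omega>\<in>space M. ennreal t < f \<omega>}"
          by (rule nn_integral_cmult_indicator) measurable
        finally show ?thesis using t by (simp only: emeasure_eq_measure ennreal_mult'' measure_nonneg)
      qed
      also have "prob {\<omega>\<in>space M. ennreal t < f \<omega>} \<le> (N / t) powr p"
        by (rule prob_le_weak_Lp_norm[OF w N p(1) t])
      also have "(N / t) powr p \<le> (N' / t) powr p" using N N' t p by (intro powr_mono2 divide_right_mono) auto
      also have "(N' / t) powr p = prob A * (2 ^ j) powr - p"
        unfolding Ns[symmetric] t_def using N' s by (simp add: powr_divide powr_mult powr_minus divide_simps)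
      also have "2 * t * (prob A * (2 ^ j) powr - p) = 2 * s * prob A * q ^ j"
      proof -
        have "2 ^ j * (2 ^ j) powr - p = q ^ j"
          unfolding q_def by (simp add: powr_powr powr_realpow[symmetric] powr_add[symmetric] algebra_simps)
        then show ?thesis unfolding t_def by (metis (no_types, opaque_lifting) mult.assoc mult.commute)
      qed
      finally show "(\<integral>\<^sup>+\<omega>. ennreal (2 ^ Suc j * s) * indicator {\<omega>\<in>space M. ennreal (2 ^ j * s) < f \<omega>} \<omega> \<partial>M)
        \<le> ennreal (2 * s * prob A * q ^ j)" using t by (simp add: ennreal_leI mult_left_mono)
    qed auto
    also have "(\<Sum>j. ennreal (2 * s * prob A * q ^ j)) = ennreal (\<Sum>j. 2 * s * prob A * q ^ j)"
      using s q q1 by (intro suminf_ennreal2) (auto intro!: summable_mult summable_geometric)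
    also have "(\<Sum>j. 2 * s * prob A * q ^ j) = 2 * s * prob A * (1 / (1 - q))"
      using q q1 by (subst suminf_mult) (auto intro!: summable_geometric simp: suminf_geometric)
    also have "ennreal s * emeasure M A + ennreal (2 * s * prob A * (1 / (1 - q))) = ennreal (s * prob A * (1 + 2 / (1 - q)))"
      using s q1 by (simp add: emeasure_eq_measure algebra_simps flip: ennreal_mult ennreal_plus)
    also have "\<dots> \<le> ennreal (s * prob A * (5 / (p - 1)))"
    proof (intro ennreal_leI mult_left_mono)
      have h: "(p - 1) / 2 \<le> 1 - q" using q(2) by (simp add: field_simps)
      have h0: "0 < (p - 1) / 2" using p by simp
      have "2 / (1 - q) \<le> 2 / ((p - 1) / 2)"
        using h h0 q1 by (intro divide_left_mono mult_pos_pos) (simp_all only: diff_gt_0_iff_gt zero_le_numeral)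
      moreover have "1 \<le> 1 / (p - 1)" using p by simp
      moreover have "2 / ((p - 1) / 2) = 4 / (p - 1)" by simp
      ultimately show "1 + 2 / (1 - q) \<le> 5 / (p - 1)" by (simp add: add_divide_distrib[symmetric] flip: add_divide_distrib)
    qed (use s in auto)
    also have "s * prob A = N' * prob A powr (1 - 1 / p)"
      using P powr_add[of "prob A" "- (1 / p)" 1] by (simp add: s_def)
    finally show ?thesis by (simp add: mult_ac)
  qed
  show ?thesis
  proof (rule ennreal_le_epsilon)
    fix e :: real assume e: "0 < e"
    define d where "d = 5 / (p - 1) * prob A powr (1 - 1 / p)"
    have d: "0 < d" using p P by (simp add: d_def)
    have "(\<integral>\<^sup>+\<omega>\<in>A. f \<omega> \<partial>M) \<le> ennreal (5 / (p - 1) * (N + e / d) * prob A powr (1 - 1 / p))"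
      using e d N by (intro pos) (auto simp: add_nonneg_pos)
    also have "5 / (p - 1) * (N + e / d) * prob A powr (1 - 1 / p) = d * (N + e / d)" by (simp add: d_def)
    also have "\<dots> = d * N + e" using d by (simp add: distrib_left)
    also have "d * N = 5 / (p - 1) * N * prob A powr (1 - 1 / p)" by (simp add: d_def)
    finally show "(\<integral>\<^sup>+\<omega>\<in>A. f \<omega> \<partial>M) \<le> ennreal (5 / (p - 1) * N * prob A powr (1 - 1 / p)) + ennreal e"
      using e N p by simp
  qed
qed

text \<open>Integrate \<open>\<Sum>\<^sub>k f k\<close> over the event \<open>A = {g > t}\<close>: the left-hand side is at least \<open>t P(A)\<close>, and each \<open>f k\<close> contributes
a multiple of \<open>N k P(A)\<^bsup>1-1/p\<^esup>\<close>. Dividing by the power of \<open>P(A)\<close> leaves the weak norm of \<open>g\<close>.\<close>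

lemma (in prob_space) weak_Lp_norm_le_suminf:
  fixes f :: "nat \<Rightarrow> 'a \<Rightarrow> ennreal" and g :: "'a \<Rightarrow> ennreal"
  assumes f[measurable]: "\<And>k. f k \<in> borel_measurable M" and g[measurable]: "g \<in> borel_measurable M"
    and p: "1 < p" "p \<le> 2" and N: "\<And>k. 0 \<le> N k" "summable N"
    and w: "\<And>k. weak_Lp_norm p M (f k) \<le> ennreal (N k)"
    and le: "AE \<omega> in M. g \<omega> \<le> (\<Sum>k. f k \<omega>)"
  shows "weak_Lp_norm p M g \<le> ennreal (5 / (p - 1) * (\<Sum>k. N k))"
  unfolding weak_Lp_norm_def
proof (intro SUP_least ennreal_leI)
  fix t :: real assume "t \<in> {0<..}"
  then have t: "0 < t" by simp
  define A where "A = {\<omega>\<in>space M. ennreal t < g \<omega>}"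
  have A[measurable]: "A \<in> events" unfolding A_def by measurable
  have SN: "0 \<le> (\<Sum>k. N k)" using N by (intro suminf_nonneg) auto
  have "ennreal (t * prob A) = (\<integral>\<^sup>+\<omega>. ennreal t * indicator A \<omega> \<partial>M)"
    using t by (simp add: nn_integral_cmult_indicator emeasure_eq_measure ennreal_mult)
  also have "\<dots> \<le> (\<integral>\<^sup>+\<omega>. (\<Sum>k. f k \<omega> * indicator A \<omega>) \<partial>M)"
    using le by (intro nn_integral_mono_AE) (auto simp: indicator_def A_def elim!: eventually_mono)
  also have "\<dots> = (\<Sum>k. \<integral>\<^sup>+\<omega>\<in>A. f k \<omega> \<partial>M)" by (rule nn_integral_suminf) auto
  also have "\<dots> \<le> (\<Sum>k. ennreal (5 / (p - 1) * N k * prob A powr (1 - 1 / p)))"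
    by (intro suminf_le set_nn_integral_le_weak_Lp f A p N w) auto
  also have "\<dots> = ennreal (\<Sum>k. 5 / (p - 1) * N k * prob A powr (1 - 1 / p))"
    using N p by (intro suminf_ennreal2 summable_mult2 summable_mult) auto
  also have "(\<Sum>k. 5 / (p - 1) * N k * prob A powr (1 - 1 / p)) = 5 / (p - 1) * (\<Sum>k. N k) * prob A powr (1 - 1 / p)"
    by (simp only: suminf_mult2[OF summable_mult[OF N(2)], symmetric] suminf_mult[OF N(2)])
  finally have le: "t * prob A \<le> 5 / (p - 1) * (\<Sum>k. N k) * prob A powr (1 - 1 / p)"
    using p SN by (subst (asm) ennreal_le_iff) auto
  show "t * prob {\<omega>\<in>space M. ennreal t < g \<omega>} powr (1 / p) \<le> 5 / (p - 1) * (\<Sum>k. N k)"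
    unfolding A_def[symmetric]
  proof (cases "prob A = 0")
    case False
    then have P: "0 < prob A" by (simp add: zero_less_measure_iff)
    have "prob A = prob A powr (1 / p) * prob A powr (1 - 1 / p)" using P by (simp add: powr_add[symmetric])
    with le have "(t * prob A powr (1 / p)) * prob A powr (1 - 1 / p) \<le> 5 / (p - 1) * (\<Sum>k. N k) * prob A powr (1 - 1 / p)"
      by (simp add: mult.assoc)
    then show "t * prob A powr (1 / p) \<le> 5 / (p - 1) * (\<Sum>k. N k)"
      using P by (simp only: mult_le_cancel_right) auto
  qed (use p SN in auto)
qed

section \<open>Averages of identically distributed martingale differences\<close>

text \<open>By Abel summation an average above \<open>t\<close> forces a weighted partial sum above \<open>t/2\<close>; truncating at level
\<open>t/4\<close> therefore gives the bound \<open>4\<^sup>p (1 + p/(p-1) + 4r/(r-p) D\<^sup>r) E|Y\<^sub>0|\<^sup>p\<close> for \<open>t\<^sup>p P(\<dots> > t)\<close>, and taking \<open>p\<close>-th roots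
turns \<open>D\<^sup>r\<close> into \<open>D\<^bsup>r/p\<^esup>\<close>. On the zero space, where \<open>D\<close> may be small, both sides vanish.\<close>

lemma (in prob_space) maximal_average_weak_type:
  fixes Y :: "nat \<Rightarrow> 'a \<Rightarrow> 'b::{banach, second_countable_topology}"
  assumes sm: "rD_smooth TYPE('b) r D" and D: "0 < D" and md: "mart_diff_seq M G Y"
    and id: "\<And>i. distr M borel (\<lambda>\<omega>. norm (Y i \<omega>)) = distr M borel (\<lambda>\<omega>. norm (Y 0 \<omega>))"
    and p: "1 < p" "p < r" "r \<le> 2" and fin: "Lp_norm p M (Y 0) < \<infinity>"
  shows "weak_Lp_norm p M (\<lambda>\<omega>. SUP n\<in>{1..}. ennreal (norm (\<Sum>i<n. Y i \<omega>) / real n powr (1 / p)))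
    \<le> ennreal (44 / ((p - 1) * (r - p)) * D powr (r / p)) * Lp_norm p M (Y 0)"
proof (cases "\<forall>x::'b. x = 0")
  case True
  then have z: "norm x = 0" for x :: 'b using norm_zero by metis
  show ?thesis unfolding z by (simp add: weak_Lp_norm_def)
next
  case False
  then have D1: "1 \<le> D powr r" using rD_smooth_constant_ge_1[OF sm] by auto
  have [measurable]: "Y n \<in> borel_measurable M" for n using mart_diff_seqD(4)[OF md] by auto
  define i where "i = enn2real (\<integral>\<^sup>+\<omega>. norm (Y 0 \<omega>) powr p \<partial>M)"
  have i: "(\<integral>\<^sup>+\<omega>. norm (Y 0 \<omega>) powr p \<partial>M) = ennreal i" "0 \<le> i" "Lp_norm p M (Y 0) = ennreal (i powr (1 / p))"
    using fin by (auto simp: i_def Lp_norm_def Let_def less_top split: if_splits)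
  \<comment> \<open>With \<open>u = 1/(p-1)\<close> and \<open>v = 1/(r-p)\<close>, both at least \<open>1\<close>: \<open>2 + u + 8 v \<le> 11 u v\<close>.\<close>
  define K where "K = 11 / ((p - 1) * (r - p))"
  have K: "1 \<le> K" "1 + p / (p - 1) + 4 * r / (r - p) * D powr r \<le> K * D powr r"
  proof -
    define u v where "u = 1 / (p - 1)" and "v = 1 / (r - p)"
    have uv: "1 \<le> u" "1 \<le> v" using p by (auto simp: u_def v_def)
    have uv1: "u \<le> u * v" "v \<le> u * v"
      using mult_left_mono[OF uv(2), of u] mult_right_mono[OF uv(1), of v] uv by auto
    have Kuv: "K = 11 * (u * v)" by (simp add: K_def u_def v_def)
    show "1 \<le> K" using uv uv1 unfolding Kuv by linarith
    have "1 + p / (p - 1) \<le> (1 + p / (p - 1)) * D powr r"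
      using mult_left_mono[OF D1, of "1 + p / (p - 1)"] p by simp
    moreover have "p / (p - 1) = 1 + u" using p by (simp add: u_def field_simps)
    moreover have "4 * r / (r - p) \<le> 8 * v" using p by (simp add: v_def divide_right_mono)
    then have "4 * r / (r - p) * D powr r \<le> 8 * v * D powr r" by (intro mult_right_mono) auto
    moreover have "2 + u + 8 * v \<le> 11 * (u * v)" using uv uv1 by linarith
    then have "(2 + u + 8 * v) * D powr r \<le> 11 * (u * v) * D powr r" by (intro mult_right_mono) auto
    ultimately show "1 + p / (p - 1) + 4 * r / (r - p) * D powr r \<le> K * D powr r"
      unfolding Kuv by (simp add: algebra_simps)
  qed
  show ?thesis
    unfolding weak_Lp_norm_def
  proof (intro SUP_least)
    fix t :: real assume "t \<in> {0<..}"
    then have t: "0 < t" by simp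
    define A where "A = {\<omega> \<in> space M. \<exists>n. 2 * (t / 4) < norm (\<Sum>i<n. Y i \<omega> /\<^sub>R (real i + 1) powr (1 / p))}"
    have [measurable]: "A \<in> events" unfolding A_def by measurable
    have "{\<omega> \<in> space M. ennreal t < (SUP n\<in>{1..}. ennreal (norm (\<Sum>i<n. Y i \<omega>) / real n powr (1 / p)))} \<subseteq> A"
    proof safe
      fix \<omega> assume w: "\<omega> \<in> space M" and "ennreal t < (SUP n\<in>{1..}. ennreal (norm (\<Sum>i<n. Y i \<omega>) / real n powr (1 / p)))"
      then obtain n where n: "1 \<le> n" "ennreal t < ennreal (norm (\<Sum>i<n. Y i \<omega>) / real n powr (1 / p))"
        by (auto simp: less_SUP_iff)
      then obtain m where m: "n = Suc m" by (cases n) auto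
      from n have tn: "t * (real m + 1) powr (1 / p) < norm (\<Sum>i<Suc m. Y i \<omega>)"
        using t by (simp add: m ennreal_less_iff less_divide_eq add.commute)
      show "\<omega> \<in> A"
      proof (rule ccontr)
        assume "\<omega> \<notin> A"
        then have "norm (\<Sum>i<j. Y i \<omega> /\<^sub>R (real i + 1) powr (1 / p)) \<le> t / 2" for j
          using w by (auto simp: A_def not_less)
        then have "norm (\<Sum>i<Suc m. Y i \<omega>) \<le> 2 * (real m + 1) powr (1 / p) * (t / 2)"
          using p by (intro norm_sum_le_weighted_partial_sums[where a = "\<lambda>i. (real i + 1) powr (1 / p)"])
            (auto simp: incseq_def intro!: powr_mono2)
        with tn show False by (simp add: mult.commute)
      qed
    qed
    then have "prob {\<omega> \<in> space M. ennreal t < (SUP n\<in>{1..}. ennreal (norm (\<Sum>i<n. Y i \<omega>) / real n powr (1 / p)))} \<le> prob A"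
      by (intro finite_measure_mono) auto
    moreover have "prob A \<le> K * D powr r * ((4 / t) powr p * i)"
    proof -
      have "emeasure M A \<le> ennreal (1 + p / (p - 1) + 4 * r / (r - p) * D powr r) * (\<integral>\<^sup>+\<omega>. (norm (Y 0 \<omega>) / (t / 4)) powr p \<partial>M)"
        unfolding A_def using t by (intro weighted_sums_weak_type[OF sm md id p]) auto
      also have "(\<integral>\<^sup>+\<omega>. (norm (Y 0 \<omega>) / (t / 4)) powr p \<partial>M) = (\<integral>\<^sup>+\<omega>. ennreal ((4 / t) powr p) * ennreal (norm (Y 0 \<omega>) powr p) \<partial>M)"
        by (intro nn_integral_cong) (simp add: ennreal_mult[symmetric] powr_mult[symmetric] mult.commute)
      also have "\<dots> = ennreal ((4 / t) powr p * i)"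
        by (simp add: nn_integral_cmult i ennreal_mult)
      also have "ennreal (1 + p / (p - 1) + 4 * r / (r - p) * D powr r) * \<dots> \<le> ennreal (K * D powr r) * ennreal ((4 / t) powr p * i)"
        by (intro mult_right_mono ennreal_leI K) auto
      also have "\<dots> = ennreal (K * D powr r * ((4 / t) powr p * i))"
        using K i by (intro ennreal_mult[symmetric]) auto
      finally show ?thesis using K i by (simp add: emeasure_eq_measure)
    qed
    ultimately have "t * prob {\<omega> \<in> space M. ennreal t < (SUP n\<in>{1..}. ennreal (norm (\<Sum>i<n. Y i \<omega>) / real n powr (1 / p)))} powr (1 / p)
        \<le> t * (K * D powr r * ((4 / t) powr p * i)) powr (1 / p)"
      using t p by (intro mult_left_mono powr_mono2) auto
    also have "(K * D powr r * ((4 / t) powr p * i)) powr (1 / p) = K powr (1 / p) * D powr (r / p) * (4 / t * i powr (1 / p))"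
      using p t by (simp add: powr_mult powr_powr)
    also have "t * \<dots> = 4 * K powr (1 / p) * D powr (r / p) * i powr (1 / p)" using t by simp
    also have "\<dots> \<le> 4 * K * D powr (r / p) * i powr (1 / p)"
      using powr_mono[of "1 / p" 1 K] K p by (intro mult_right_mono mult_left_mono) auto
    finally have "ennreal (t * prob {\<omega> \<in> space M. ennreal t < (SUP n\<in>{1..}. ennreal (norm (\<Sum>i<n. Y i \<omega>) / real n powr (1 / p)))} powr (1 / p))
      \<le> ennreal (4 * K * D powr (r / p) * i powr (1 / p))" by (rule ennreal_leI)
    also have "\<dots> = ennreal (44 / ((p - 1) * (r - p)) * D powr (r / p)) * Lp_norm p M (Y 0)"
      using p by (simp add: i K_def ennreal_mult[symmetric])
    finally show "ennreal (t * prob {\<omega> \<in> space M. ennreal t < (SUP n\<in>{1..}. ennreal (norm (\<Sum>i<n. Y i \<omega>) / real n powr (1 / p)))} powr (1 / p))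
      \<le> ennreal (44 / ((p - 1) * (r - p)) * D powr (r / p)) * Lp_norm p M (Y 0)" .
  qed
qed

lemma (in prob_space) average_tendsto_0:
  fixes Y :: "nat \<Rightarrow> 'a \<Rightarrow> 'b::{banach, second_countable_topology}"
  assumes sm: "rD_smooth TYPE('b) r D" and md: "mart_diff_seq M G Y"
    and id: "\<And>i. distr M borel (\<lambda>\<omega>. norm (Y i \<omega>)) = distr M borel (\<lambda>\<omega>. norm (Y 0 \<omega>))"
    and p: "1 < p" "p < r" "r \<le> 2" and fin: "Lp_norm p M (Y 0) < \<infinity>"
  shows "AE \<omega> in M. (\<lambda>n. norm (\<Sum>i<n. Y i \<omega>) / real n powr (1 / p)) \<longlonglongrightarrow> 0"
proof -
  have "(\<integral>\<^sup>+\<omega>. norm (Y 0 \<omega>) powr p \<partial>M) < \<infinity>"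
    using fin by (auto simp: Lp_norm_def Let_def less_top split: if_splits)
  from weighted_sums_summable[OF sm md id p this] show ?thesis
  proof eventually_elim
    case (elim \<omega>)
    have "(\<lambda>n. norm (\<Sum>i<Suc n. Y i \<omega>) / (real n + 1) powr (1 / p)) \<longlonglongrightarrow> 0"
    proof (rule kronecker_lemma[OF _ _ _ elim])
      show "incseq (\<lambda>n. (real n + 1) powr (1 / p))" using p by (auto simp: incseq_def intro!: powr_mono2)
      show "filterlim (\<lambda>n. (real n + 1) powr (1 / p)) at_top sequentially"
        using p by real_asymp
    qed auto
    then have "(\<lambda>n. norm (\<Sum>i<Suc n. Y i \<omega>) / real (Suc n) powr (1 / p)) \<longlonglongrightarrow> 0"
      by (simp add: add.commute)
    then show ?case by (rule LIMSEQ_imp_Suc)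
  qed
qed

section \<open>The filtration of a measure-preserving map\<close>

locale mpt_filtration = prob_space M for M :: "'a measure" +
  fixes \<theta> :: "'a \<Rightarrow> 'a" and F0 :: "'a measure"
  assumes mpt: "invertible_mpt M \<theta>" and subF0: "subalgebra M F0"
    and F0_le: "sets F0 \<subseteq> sets (filt M \<theta> F0 1)"
begin

abbreviation Fn :: "int \<Rightarrow> 'a measure" where "Fn \<equiv> filt M \<theta> F0"

lemma theta_measurable[measurable]: "\<theta> \<in> measurable M M"
  and distr_theta: "distr M M \<theta> = M"
  using mpt by (auto simp: invertible_mpt_def)

lemma theta_space: "x \<in> space M \<Longrightarrow> \<theta> x \<in> space M"
  by (rule measurable_space[OF theta_measurable])

lemma int_iter_measurable[measurable]: "int_iter M \<theta> n \<in> measurable M M"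
proof -
  have "f ^^ k \<in> measurable M M" if "f \<in> measurable M M" for f :: "'a \<Rightarrow> 'a" and k
    using that by (induct k) auto
  then show ?thesis using mpt by (auto simp: int_iter_def invertible_mpt_def)
qed

lemma int_iter_space: "x \<in> space M \<Longrightarrow> int_iter M \<theta> n x \<in> space M"
  by (rule measurable_space[OF int_iter_measurable])

text \<open>The group law for iterates, with one further step taken either first or last.\<close>

lemma int_iter_Suc:
  assumes x: "x \<in> space M"
  shows "int_iter M \<theta> (n + 1) x = int_iter M \<theta> n (\<theta> x)" and "int_iter M \<theta> (n + 1) x = \<theta> (int_iter M \<theta> n x)"
proof -
  define j where "j = inv_into (space M) \<theta>"
  have bij: "bij_betw \<theta> (space M) (space M)" using mpt by (simp add: invertible_mpt_def)
  have j1: "j (\<theta> y) = y" if "y \<in> space M" for y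
    unfolding j_def using bij_betw_inv_into_left[OF bij that] .
  have j2: "\<theta> (j y) = y" if "y \<in> space M" for y
    unfolding j_def using bij_betw_inv_into_right[OF bij that] .
  have "int_iter M \<theta> (n + 1) x = int_iter M \<theta> n (\<theta> x) \<and> int_iter M \<theta> (n + 1) x = \<theta> (int_iter M \<theta> n x)"
  proof (cases "0 \<le> n")
    case True
    then have "nat (n + 1) = Suc (nat n)" by simp
    then show ?thesis using True by (simp add: int_iter_def funpow_swap1)
  next
    case False
    define k where "k = nat (- n - 1)"
    have n: "n + 1 = - int k" and a: "nat (- n) = Suc k" using False by (auto simp: k_def)
    have "int_iter M \<theta> (n + 1) y = (j ^^ k) y" for y
      unfolding n by (cases "k = 0") (simp_all add: int_iter_def j_def)
    moreover have "int_iter M \<theta> n y = (j ^^ Suc k) y" for y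
      using False a by (simp add: int_iter_def j_def del: funpow.simps)
    ultimately have i: "int_iter M \<theta> (n + 1) y = (j ^^ k) y" "int_iter M \<theta> n y = j ((j ^^ k) y)"
      "int_iter M \<theta> n y = (j ^^ k) (j y)" for y by (auto simp: funpow_swap1)
    have "(j ^^ k) x \<in> space M" using int_iter_space[OF x, of "n + 1"] i by simp
    then show ?thesis using i(1)[of x] i(2)[of x] i(3)[of "\<theta> x"] by (simp add: j1 j2 x)
  qed
  then show "int_iter M \<theta> (n + 1) x = int_iter M \<theta> n (\<theta> x)" "int_iter M \<theta> (n + 1) x = \<theta> (int_iter M \<theta> n x)" by auto
qed

lemma space_filt[simp]: "space (Fn n) = space M"
  by (simp add: filt_def)

lemma sets_filt: "sets (Fn n) = {int_iter M \<theta> n -` A \<inter> space M | A. A \<in> sets F0}"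
  unfolding filt_def using subF0 int_iter_space by (intro sets_vimage_algebra2) (auto simp: subalgebra_def)

lemma subalgebra_filt: "subalgebra M (Fn n)"
  using subalgebra_sets[OF subF0] measurable_sets[OF int_iter_measurable]
  by (auto simp: subalgebra_def sets_filt)

lemma sets_filt_Suc: "sets (Fn (n + 1)) = {\<theta> -` B \<inter> space M | B. B \<in> sets (Fn n)}"
proof -
  have "int_iter M \<theta> (n + 1) -` A \<inter> space M = \<theta> -` (int_iter M \<theta> n -` A \<inter> space M) \<inter> space M" for A
    by (auto simp: int_iter_Suc(1) theta_space)
  then show ?thesis unfolding sets_filt by (auto simp del: vimage_Int)
qed

lemma filt_mono_Suc: "sets (Fn n) \<subseteq> sets (Fn (n + 1))"
proof
  fix A' assume "A' \<in> sets (Fn n)"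
  then obtain A where A: "A \<in> sets F0" "A' = int_iter M \<theta> n -` A \<inter> space M" by (auto simp: sets_filt)
  with F0_le obtain B where B: "B \<in> sets F0" "A = int_iter M \<theta> 1 -` B \<inter> space M" by (auto simp: sets_filt)
  have "int_iter M \<theta> 1 = \<theta>" by (simp add: int_iter_def)
  then have "A' = int_iter M \<theta> (n + 1) -` B \<inter> space M"
    unfolding A(2) B(2) by (auto simp: int_iter_Suc(2) int_iter_space)
  with B(1) show "A' \<in> sets (Fn (n + 1))" by (auto simp: sets_filt)
qed

lemma filt_mono: "m \<le> n \<Longrightarrow> sets (Fn m) \<subseteq> sets (Fn n)"
proof (induct n rule: int_ge_induct)
  case (step i)
  then show ?case using filt_mono_Suc[of i] by blast
qed auto

lemma measurable_shift:
  assumes "f \<in> measurable (Fn n) N"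
  shows "(\<lambda>\<omega>. f (\<theta> \<omega>)) \<in> measurable (Fn (n + 1)) N"
proof (rule measurable_compose[OF _ assms], rule measurableI)
  fix A assume "A \<in> sets (Fn n)"
  then show "\<theta> -` A \<inter> space (Fn (n + 1)) \<in> sets (Fn (n + 1))" by (auto simp: sets_filt_Suc)
qed (auto simp: theta_space)

lemma integrable_shift:
  fixes f :: "'a \<Rightarrow> 'b::{banach, second_countable_topology}"
  assumes "integrable M f"
  shows "integrable M (\<lambda>\<omega>. f (\<theta> \<omega>))"
  using integrable_distr[OF theta_measurable, of f] assms by (simp add: distr_theta)

lemma integral_shift:
  fixes f :: "'a \<Rightarrow> 'b::{banach, second_countable_topology}"
  assumes "f \<in> borel_measurable M"
  shows "(LINT \<omega>|M. f (\<theta> \<omega>)) = (LINT \<omega>|M. f \<omega>)"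
  using integral_distr[OF theta_measurable assms] by (simp add: distr_theta)

lemma has_cond_exp_zero_shift:
  fixes f :: "'a \<Rightarrow> 'b::{banach, second_countable_topology}"
  assumes f: "integrable M f" "has_cond_exp M (Fn n) f (\<lambda>_. 0)"
  shows "has_cond_exp M (Fn (n + 1)) (\<lambda>\<omega>. f (\<theta> \<omega>)) (\<lambda>_. 0)"
  unfolding has_cond_exp_def
proof (intro conjI ballI)
  fix A assume "A \<in> sets (Fn (n + 1))"
  then obtain B where B: "B \<in> sets (Fn n)" "A = \<theta> -` B \<inter> space M" by (auto simp: sets_filt_Suc)
  have BM[measurable]: "B \<in> sets M" using B(1) subalgebra_sets[OF subalgebra_filt] by blast
  note f(1)[measurable]
  have "(LINT \<omega>:A|M. f (\<theta> \<omega>)) = (LINT \<omega>|M. indicator B (\<theta> \<omega>) *\<^sub>R f (\<theta> \<omega>))"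
    unfolding set_lebesgue_integral_def by (intro Bochner_Integration.integral_cong) (auto simp: B indicator_def)
  also have "\<dots> = (LINT \<omega>:B|M. f \<omega>)"
    unfolding set_lebesgue_integral_def by (rule integral_shift) measurable
  also have "\<dots> = 0" using has_cond_expD(3)[OF f(2) B(1)] by simp
  finally show "(LINT \<omega>:A|M. 0) = (LINT \<omega>:A|M. f (\<theta> \<omega>))" by simp
qed auto

lemma funpow_theta_measurable[measurable]: "\<theta> ^^ i \<in> measurable M M"
  by (induct i) auto

lemma distr_funpow_theta: "distr M M (\<theta> ^^ i) = M"
proof (induct i)
  case 0
  have "distr M M (\<lambda>x. x) = M" by (rule distr_id)
  then show ?case by (simp add: id_def)
next
  case (Suc i)
  have "distr M M (\<theta> ^^ Suc i) = distr (distr M M (\<theta> ^^ i)) M \<theta>"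
    by (subst distr_distr) (auto simp: comp_def)
  then show ?case by (simp only: Suc distr_theta)
qed

lemma AE_funpow_theta:
  assumes "AE \<omega> in M. P \<omega>"
  shows "AE \<omega> in M. P ((\<theta> ^^ i) \<omega>)"
  by (rule AE_distrD[OF funpow_theta_measurable]) (simp only: distr_funpow_theta assms)

text \<open>Composition with \<open>\<theta>\<close> moves measurability from \<open>F\<^sub>n\<close> to \<open>F\<^bsub>n+1\<^esub>\<close> and, by invariance of the measure, also
the vanishing of integrals over the sets of \<open>F\<^sub>n\<close>.\<close>

lemma mart_diff_seq_orbit:
  fixes f :: "'a \<Rightarrow> 'b::{banach, second_countable_topology}"
  assumes f: "f \<in> borel_measurable (Fn (k + 1))" "integrable M f" "has_cond_exp M (Fn k) f (\<lambda>_. 0)"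
  shows "mart_diff_seq M (\<lambda>i. Fn (k + int i)) (\<lambda>i \<omega>. f ((\<theta> ^^ i) \<omega>))"
proof -
  have "(\<lambda>\<omega>. f ((\<theta> ^^ i) \<omega>)) \<in> borel_measurable (Fn (k + int (Suc i))) \<and> integrable M (\<lambda>\<omega>. f ((\<theta> ^^ i) \<omega>))
    \<and> has_cond_exp M (Fn (k + int i)) (\<lambda>\<omega>. f ((\<theta> ^^ i) \<omega>)) (\<lambda>_. 0)" for i
  proof (induct i)
    case 0
    then show ?case using f by simp
  next
    case (Suc i)
    have e: "k + int (Suc i) = k + int i + 1" "k + int (Suc (Suc i)) = k + int (Suc i) + 1" by auto
    have s: "(\<theta> ^^ Suc i) \<omega> = (\<theta> ^^ i) (\<theta> \<omega>)" for \<omega> by (simp add: funpow_swap1)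
    from Suc have "(\<lambda>\<omega>. f ((\<theta> ^^ i) (\<theta> \<omega>))) \<in> borel_measurable (Fn (k + int (Suc i) + 1))"
      by (intro measurable_shift[of "\<lambda>\<omega>. f ((\<theta> ^^ i) \<omega>)"]) blast
    moreover from Suc have "integrable M (\<lambda>\<omega>. f ((\<theta> ^^ i) (\<theta> \<omega>)))"
      by (intro integrable_shift[of "\<lambda>\<omega>. f ((\<theta> ^^ i) \<omega>)"]) blast
    moreover from Suc have "has_cond_exp M (Fn (k + int i + 1)) (\<lambda>\<omega>. f ((\<theta> ^^ i) (\<theta> \<omega>))) (\<lambda>_. 0)"
      by (intro has_cond_exp_zero_shift[of "\<lambda>\<omega>. f ((\<theta> ^^ i) \<omega>)"]) blast+
    ultimately show ?case unfolding s e(2) unfolding e(1) by blast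
  qed
  moreover have "sets (Fn (k + int n)) \<subseteq> sets (Fn (k + int (Suc n)))" for n
    by (rule filt_mono) simp
  ultimately show ?thesis unfolding mart_diff_seq_def by (intro conjI allI subalgebra_filt) blast+
qed

lemma distr_norm_orbit:
  fixes f :: "'a \<Rightarrow> 'b::{banach, second_countable_topology}"
  assumes [measurable]: "f \<in> borel_measurable M"
  shows "distr M borel (\<lambda>\<omega>. norm (f ((\<theta> ^^ i) \<omega>))) = distr M borel (\<lambda>\<omega>. norm (f \<omega>))"
proof -
  have "distr M borel (\<lambda>\<omega>. norm (f ((\<theta> ^^ i) \<omega>))) = distr (distr M M (\<theta> ^^ i)) borel (\<lambda>\<omega>. norm (f \<omega>))"
    by (subst distr_distr) (auto simp: comp_def)
  then show ?thesis by (simp add: distr_funpow_theta)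
qed

lemma proj_P_props:
  fixes X :: "'a \<Rightarrow> 'b::{banach, second_countable_topology}"
  assumes X: "integrable M X"
  shows "proj_P M \<theta> F0 k X \<in> borel_measurable (Fn k)" "integrable M (proj_P M \<theta> F0 k X)"
    "has_cond_exp M (Fn (k - 1)) (proj_P M \<theta> F0 k X) (\<lambda>_. 0)"
proof -
  define E where "E n = cond_exp M (Fn n) X" for n
  have E: "has_cond_exp M (Fn n) X (E n)" for n
    unfolding E_def by (rule has_cond_exp_cond_exp[OF subalgebra_filt X])
  have P: "proj_P M \<theta> F0 k X = (\<lambda>\<omega>. E k \<omega> - E (k - 1) \<omega>)" by (auto simp: proj_P_def E_def)
  have sub: "sets (Fn (k - 1)) \<subseteq> sets (Fn k)" by (rule filt_mono) simp
  have Em: "E k \<in> borel_measurable (Fn k)" "E (k - 1) \<in> borel_measurable (Fn (k - 1))"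
    and Ei: "integrable M (E n)" for n using has_cond_expD(1,2)[OF E] by auto
  have "E (k - 1) \<in> borel_measurable (Fn k)"
    by (rule measurable_coarser[OF subalgebra_filt subalgebra_filt sub Em(2)])
  then show "proj_P M \<theta> F0 k X \<in> borel_measurable (Fn k)" unfolding P using Em by auto
  show "integrable M (proj_P M \<theta> F0 k X)" unfolding P using Ei by auto
  have "has_cond_exp M (Fn (k - 1)) (E k) (E (k - 1))"
    unfolding has_cond_exp_def using Em(2) Ei sub has_cond_expD(3)[OF E] by (auto simp: subset_iff)
  from has_cond_exp_diff[OF subalgebra_filt this has_cond_exp_self[OF Em(2) Ei] Ei Ei]
  show "has_cond_exp M (Fn (k - 1)) (proj_P M \<theta> F0 k X) (\<lambda>_. 0)" unfolding P by simp
qed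

end

section \<open>The martingale decomposition of a regular variable\<close>

text \<open>An enumeration of the integers in the order \<open>0, 1, -1, 2, -2, \<dots>\<close>, for which the first \<open>2n\<close> terms of
\<open>\<Sum>\<^sub>k P\<^sub>k X\<close> telescope to \<open>E\<^sub>n X - E\<^bsub>-n\<^esub> X\<close>.\<close>

definition zigzag :: "nat \<Rightarrow> int" where
  "zigzag j = (if even j then - int (j div 2) else int (j div 2) + 1)"

lemma inj_zigzag: "inj zigzag"
proof (rule injI)
  fix i j assume "zigzag i = zigzag j"
  then have "even i = even j \<and> i div 2 = j div 2" by (auto simp: zigzag_def split: if_splits)
  then show "i = j" by (metis div_mult_mod_eq odd_iff_mod_2_eq_one even_iff_mod_2_eq_zero)
qed

context mpt_filtration begin

lemma suminf_Lp_norm_proj_le: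
  assumes g: "inj (g :: nat \<Rightarrow> int)"
  shows "(\<Sum>i. Lp_norm p M (proj_P M \<theta> F0 (g i) X)) \<le> Hp_norm p M \<theta> F0 X"
proof (rule suminf_le_const)
  fix N
  have "(\<Sum>i<N. Lp_norm p M (proj_P M \<theta> F0 (g i) X)) = (\<Sum>k\<in>g ` {..<N}. Lp_norm p M (proj_P M \<theta> F0 k X))"
    using g by (subst sum.reindex) (auto intro: inj_on_subset)
  also have "\<dots> \<le> (SUP B\<in>{B. finite B \<and> B \<subseteq> UNIV}. \<Sum>k\<in>B. Lp_norm p M (proj_P M \<theta> F0 k X))"
    by (rule SUP_upper) simp
  also have "\<dots> = Hp_norm p M \<theta> F0 X"
    unfolding Hp_norm_def by (rule nonneg_infsum_complete[symmetric]) simp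
  finally show "(\<Sum>i<N. Lp_norm p M (proj_P M \<theta> F0 (g i) X)) \<le> Hp_norm p M \<theta> F0 X" .
qed auto

lemma suminf_L1_norm_proj_finite:
  fixes X :: "'a \<Rightarrow> 'b::{banach, second_countable_topology}"
  assumes p: "1 < p" and X: "integrable M X" and H: "Hp_norm p M \<theta> F0 X < \<infinity>" and g: "inj g"
  shows "(\<Sum>i::nat. \<integral>\<^sup>+\<omega>. norm (proj_P M \<theta> F0 (g i) X \<omega>) \<partial>M) < \<infinity>"
proof -
  have "proj_P M \<theta> F0 k X \<in> borel_measurable M" for k using proj_P_props(2)[OF X] by auto
  then have "(\<Sum>i::nat. \<integral>\<^sup>+\<omega>. norm (proj_P M \<theta> F0 (g i) X \<omega>) \<partial>M) \<le> (\<Sum>i. Lp_norm p M (proj_P M \<theta> F0 (g i) X))"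
    by (intro suminf_le nn_integral_norm_le_Lp_norm p) auto
  also have "\<dots> \<le> Hp_norm p M \<theta> F0 X" by (rule suminf_Lp_norm_proj_le[OF g])
  finally show ?thesis using H by (rule le_less_trans)
qed

text \<open>An intersection of \<open>\<sigma>\<close>-algebras is a \<open>\<sigma>\<close>-algebra, so nothing has to be generated for \<open>F\<^bsub>-\<infinity>\<^esub>\<close>.\<close>

lemma sets_filt_inf: "sets (filt_inf M \<theta> F0) = sigma_sets (space M) (\<Union>n. sets (Fn n))"
  and space_filt_inf: "space (filt_inf M \<theta> F0) = space M"
  and sets_filt_minf: "sets (filt_minf M \<theta> F0) = (\<Inter>n. sets (Fn n))"
  and space_filt_minf: "space (filt_minf M \<theta> F0) = space M"
proof -
  have Pow: "sets (Fn n) \<subseteq> Pow (space M)" for n using sets.space_closed[of "Fn n"] by simp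
  then have U: "(\<Union>n. sets (Fn n)) \<subseteq> Pow (space M)" and I: "(\<Inter>n. sets (Fn n)) \<subseteq> Pow (space M)" by blast+
  show "sets (filt_inf M \<theta> F0) = sigma_sets (space M) (\<Union>n. sets (Fn n))" "space (filt_inf M \<theta> F0) = space M"
    unfolding filt_inf_def using U by (simp_all add: sets_measure_of space_measure_of)
  show "space (filt_minf M \<theta> F0) = space M"
    unfolding filt_minf_def using I by (simp add: space_measure_of)
  have "sigma_sets (space M) (\<Inter>n. sets (Fn n)) \<subseteq> sets (Fn m)" for m
    using sets.sigma_sets_subset[of "\<Inter>n. sets (Fn n)" "Fn m"] by auto
  then show "sets (filt_minf M \<theta> F0) = (\<Inter>n. sets (Fn n))"
    unfolding filt_minf_def using I by (simp add: sets_measure_of) (blast intro: sigma_sets.Basic)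
qed

lemma subalgebra_filt_inf: "subalgebra M (filt_inf M \<theta> F0)"
proof -
  have "(\<Union>n. sets (Fn n)) \<subseteq> sets M" using subalgebra_sets[OF subalgebra_filt] by blast
  then show ?thesis unfolding subalgebra_def space_filt_inf sets_filt_inf
    using sets.sigma_sets_subset by blast
qed

lemma subalgebra_filt_minf: "subalgebra M (filt_minf M \<theta> F0)"
  unfolding subalgebra_def space_filt_minf sets_filt_minf
  using subalgebra_sets[OF subalgebra_filt] by blast

text \<open>Summability of \<open>\<parallel>P\<^sub>k X\<parallel>\<^sub>1\<close> makes the sequence \<open>E\<^sub>n X\<close> converge without any martingale convergence theorem.
The limit is measurable with respect to \<open>F\<^sub>\<infinity>\<close> and has the same integrals as \<open>X\<close> over the sets of every
\<open>F\<^sub>n\<close>; these form a generator of \<open>F\<^sub>\<infinity>\<close> stable under intersections.\<close>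

lemma cond_exp_tendsto_at_top:
  fixes X :: "'a \<Rightarrow> 'b::{banach, second_countable_topology}"
  assumes p: "1 < p" and X: "integrable M X" and H: "Hp_norm p M \<theta> F0 X < \<infinity>"
  shows "AE \<omega> in M. (\<lambda>i. cond_exp M (Fn (int i)) X \<omega>) \<longlonglongrightarrow> cond_exp M (filt_inf M \<theta> F0) X \<omega>"
proof -
  define E where "E i = cond_exp M (Fn (int i)) X" for i
  have E: "has_cond_exp M (Fn (int i)) X (E i)" for i
    unfolding E_def by (rule has_cond_exp_cond_exp[OF subalgebra_filt X])
  have Ei: "integrable M (E i)" for i using has_cond_expD(2)[OF E] .
  have inc: "E (Suc i) \<omega> - E i \<omega> = proj_P M \<theta> F0 (int i + 1) X \<omega>" for i \<omega>
    by (simp add: E_def proj_P_def add.commute)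
  have sum: "(\<Sum>i. \<integral>\<^sup>+x. norm (E (Suc i) x - E i x) \<partial>M) < \<infinity>"
    unfolding inc by (rule suminf_L1_norm_proj_finite[OF p X H]) (auto simp: inj_def)
  define V where "V = (\<lambda>x. lim (\<lambda>i. E i x))"
  note V = L1_limit_of_summable_increments[OF Ei sum, folded V_def]
  have lim: "AE \<omega> in M. (\<lambda>i. E i \<omega>) \<longlonglongrightarrow> V \<omega>"
    unfolding V_def by (rule L1_limit_of_summable_increments(1)[OF Ei sum])
  have fin: "\<And>n. sets (Fn n) \<subseteq> sets (filt_inf M \<theta> F0)" unfolding sets_filt_inf by (auto intro: sigma_sets.Basic)
  have [measurable]: "E i \<in> borel_measurable (filt_inf M \<theta> F0)" for i
    by (rule measurable_coarser[OF subalgebra_filt subalgebra_filt_inf fin has_cond_expD(1)[OF E]])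
  have si: "set_integrable M A X" "set_integrable M A V" if "A \<in> sets M" for A
    using that X V(2) by (auto intro!: integrable_imp_set_integrable)
  have FM: "A \<in> sets (Fn n) \<Longrightarrow> A \<in> sets M" for A n using subalgebra_sets[OF subalgebra_filt] .
  have base: "(LINT x:A|M. V x) = (LINT x:A|M. X x)" if A: "A \<in> sets (Fn n)" for A n
  proof -
    have "\<forall>\<^sub>F i in sequentially. (LINT x:A|M. E i x) = (LINT x:A|M. X x)"
      using eventually_ge_at_top[of "nat n"]
    proof eventually_elim
      case (elim i)
      then have "n \<le> int i" by linarith
      from filt_mono[OF this] A have "A \<in> sets (Fn (int i))" by (rule subsetD)
      then show ?case by (rule has_cond_expD(3)[OF E])
    qed
    then have "(\<lambda>i. LINT x:A|M. E i x) \<longlonglongrightarrow> (LINT x:A|M. X x)" by (rule tendsto_eventually)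
    with V(3)[OF FM[OF A]] show ?thesis by (rule LIMSEQ_unique)
  qed
  have "has_cond_exp M (filt_inf M \<theta> F0) X V"
    unfolding has_cond_exp_def
  proof (intro conjI ballI)
    show "V \<in> borel_measurable (filt_inf M \<theta> F0)" unfolding V_def by measurable
    show "integrable M V" by (rule V(2))
    fix A assume "A \<in> sets (filt_inf M \<theta> F0)"
    then have A: "A \<in> sigma_sets (space M) (\<Union>n. sets (Fn n))" by (simp add: sets_filt_inf)
    have stable: "Int_stable (\<Union>n. sets (Fn n))"
    proof (rule Int_stableI)
      fix A B assume "A \<in> (\<Union>n. sets (Fn n))" "B \<in> (\<Union>n. sets (Fn n))"
      then obtain m n where "A \<in> sets (Fn m)" "B \<in> sets (Fn n)" by auto
      then have "A \<in> sets (Fn (max m n))" "B \<in> sets (Fn (max m n))"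
        using filt_mono[of m "max m n"] filt_mono[of n "max m n"] by auto
      then show "A \<inter> B \<in> (\<Union>n. sets (Fn n))" by blast
    qed
    have closed: "(\<Union>n. sets (Fn n)) \<subseteq> Pow (space M)"
      using sets.sets_into_space[OF FM] by blast
    from stable closed A show "(LINT x:A|M. V x) = (LINT x:A|M. X x)"
    proof (induct rule: sigma_sets_induct_disjoint)
      case (basic A)
      then show ?case using base by blast
    next
      case empty
      then show ?case by (simp add: set_lebesgue_integral_def)
    next
      case (compl A)
      then have A: "A \<in> sets M" using subalgebra_sets[OF subalgebra_filt_inf] by (simp add: sets_filt_inf)
      have c: "(LINT x:space M - A|M. f x) = (LINT x:space M|M. f x) - (LINT x:A|M. f x)" if "integrable M f" for f :: "'a \<Rightarrow> 'b"
      proof -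
        have "(LINT x:(space M - A) \<union> A|M. f x) = (LINT x:space M - A|M. f x) + (LINT x:A|M. f x)"
          using A that by (intro set_integral_Un) (auto intro!: integrable_imp_set_integrable)
        moreover have "(space M - A) \<union> A = space M" using sets.sets_into_space[OF A] by blast
        ultimately show ?thesis by simp
      qed
      have "space M \<in> sets (Fn 0)" using sets.top[of "Fn 0"] by simp
      from base[OF this] compl show ?case by (simp add: c X V(2))
    next
      case (union A)
      then have A: "A i \<in> sets M" for i using subalgebra_sets[OF subalgebra_filt_inf] by (auto simp: sets_filt_inf)
      have "(LINT x:(\<Union>i. A i)|M. f x) = (\<Sum>i. LINT x:A i|M. f x)" if "integrable M f" for f :: "'a \<Rightarrow> 'b"
        using A union(1) that by (intro lebesgue_integral_countable_add)
          (auto intro!: integrable_imp_set_integrable simp: disjoint_family_on_def)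
      then show ?case using union X V(2) by simp
    qed
  qed
  from has_cond_exp_unique[OF subalgebra_filt_inf this has_cond_exp_cond_exp[OF subalgebra_filt_inf X] X] lim
  show ?thesis by eventually_elim (simp add: E_def)
qed

text \<open>A limit does not depend on finitely many terms, so the limit of \<open>E\<^bsub>-n\<^esub> X\<close> is measurable with respect to every
\<open>F\<^sub>m\<close>, hence with respect to \<open>F\<^bsub>-\<infinity>\<^esub>\<close>.\<close>

lemma cond_exp_tendsto_at_bot:
  fixes X :: "'a \<Rightarrow> 'b::{banach, second_countable_topology}"
  assumes p: "1 < p" and X: "integrable M X" and H: "Hp_norm p M \<theta> F0 X < \<infinity>"
  shows "AE \<omega> in M. (\<lambda>i. cond_exp M (Fn (- int i)) X \<omega>) \<longlonglongrightarrow> cond_exp M (filt_minf M \<theta> F0) X \<omega>"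
proof -
  define E where "E i = cond_exp M (Fn (- int i)) X" for i
  have E: "has_cond_exp M (Fn (- int i)) X (E i)" for i
    unfolding E_def by (rule has_cond_exp_cond_exp[OF subalgebra_filt X])
  have Ei: "integrable M (E i)" for i using has_cond_expD(2)[OF E] .
  have inc: "norm (E (Suc i) \<omega> - E i \<omega>) = norm (proj_P M \<theta> F0 (- int i) X \<omega>)" for i \<omega>
  proof -
    have e: "- int (Suc i) = - int i - 1" by simp
    show ?thesis unfolding E_def proj_P_def e by (rule norm_minus_commute)
  qed
  have sum: "(\<Sum>i. \<integral>\<^sup>+x. norm (E (Suc i) x - E i x) \<partial>M) < \<infinity>"
    unfolding inc by (rule suminf_L1_norm_proj_finite[OF p X H]) (auto simp: inj_def)
  define W where "W = (\<lambda>x. lim (\<lambda>i. E i x))"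
  note W = L1_limit_of_summable_increments[OF Ei sum, folded W_def]
  have lim: "AE \<omega> in M. (\<lambda>i. E i \<omega>) \<longlonglongrightarrow> W \<omega>"
    unfolding W_def by (rule L1_limit_of_summable_increments(1)[OF Ei sum])
  have FM: "A \<in> sets (Fn n) \<Longrightarrow> A \<in> sets M" for A n using subalgebra_sets[OF subalgebra_filt] .
  have Wm: "W \<in> borel_measurable (Fn n)" for n
  proof -
    define m where "m = nat (- n)"
    have "(\<lambda>x. lim (\<lambda>i. E (i + m) x)) \<in> borel_measurable (Fn n)"
    proof (rule borel_measurable_lim_metric)
      fix i
      show "E (i + m) \<in> borel_measurable (Fn n)"
        by (rule measurable_coarser[OF subalgebra_filt subalgebra_filt filt_mono has_cond_expD(1)[OF E]])
          (simp add: m_def)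
    qed
    also have "(\<lambda>x. lim (\<lambda>i. E (i + m) x)) = W"
    proof -
      have "((\<lambda>i. E (i + m) x) \<longlonglongrightarrow> l) = ((\<lambda>i. E i x) \<longlonglongrightarrow> l)" for x l
        using LIMSEQ_offset[of "\<lambda>i. E i x" m l] LIMSEQ_ignore_initial_segment[of "\<lambda>i. E i x" l m] by blast
      then show ?thesis unfolding W_def lim_def by simp
    qed
    finally show ?thesis .
  qed
  have "has_cond_exp M (filt_minf M \<theta> F0) X W"
    unfolding has_cond_exp_def
  proof (intro conjI ballI)
    show "W \<in> borel_measurable (filt_minf M \<theta> F0)"
      using measurable_sets[OF Wm] by (intro measurableI) (auto simp: sets_filt_minf space_filt_minf)
    show "integrable M W" by (rule W(2))
    fix A assume "A \<in> sets (filt_minf M \<theta> F0)"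
    then have A: "A \<in> sets (Fn n)" for n by (simp add: sets_filt_minf)
    have "(\<lambda>i. LINT x:A|M. E i x) \<longlonglongrightarrow> (LINT x:A|M. X x)"
      using has_cond_expD(3)[OF E A] by simp
    with W(3)[OF FM[OF A]] show "(LINT x:A|M. W x) = (LINT x:A|M. X x)" by (rule LIMSEQ_unique)
  qed
  from has_cond_exp_unique[OF subalgebra_filt_minf this has_cond_exp_cond_exp[OF subalgebra_filt_minf X] X] lim
  show ?thesis by eventually_elim (simp add: E_def)
qed

lemma regular_sums_proj:
  fixes X :: "'a \<Rightarrow> 'b::{banach, second_countable_topology}"
  assumes p: "1 < p" and reg: "regular M \<theta> F0 X" and H: "Hp_norm p M \<theta> F0 X < \<infinity>"
  shows "AE \<omega> in M. summable (\<lambda>j. norm (proj_P M \<theta> F0 (zigzag j) X \<omega>)) \<and>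
    (\<lambda>j. proj_P M \<theta> F0 (zigzag j) X \<omega>) sums X \<omega>"
proof -
  have X: "integrable M X" using reg by (simp add: regular_def)
  have [measurable]: "proj_P M \<theta> F0 k X \<in> borel_measurable M" for k using proj_P_props(2)[OF X] by auto
  have "(\<integral>\<^sup>+\<omega>. (\<Sum>j. ennreal (norm (proj_P M \<theta> F0 (zigzag j) X \<omega>))) \<partial>M) < \<infinity>"
    using suminf_L1_norm_proj_finite[OF p X H inj_zigzag] by (subst nn_integral_suminf) auto
  then have "AE \<omega> in M. (\<Sum>j. ennreal (norm (proj_P M \<theta> F0 (zigzag j) X \<omega>))) \<noteq> \<infinity>"
    by (intro nn_integral_PInf_AE) auto
  moreover have "AE \<omega> in M. cond_exp M (filt_minf M \<theta> F0) X \<omega> = 0" "AE \<omega> in M. X \<omega> - cond_exp M (filt_inf M \<theta> F0) X \<omega> = 0"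
    using reg by (auto simp: regular_def)
  ultimately show ?thesis
    using cond_exp_tendsto_at_top[OF p X H] cond_exp_tendsto_at_bot[OF p X H]
  proof eventually_elim
    case (elim \<omega>)
    define P where "P j = proj_P M \<theta> F0 (zigzag j) X \<omega>" for j
    have sm: "summable (\<lambda>j. norm (P j))" using elim(1) unfolding P_def by (intro summable_suminf_not_top) auto
    have "(\<lambda>n. \<Sum>j<2 * n. P j) \<longlonglongrightarrow> (\<Sum>j. P j)"
      using LIMSEQ_subseq_LIMSEQ[OF summable_LIMSEQ[OF summable_norm_cancel[OF sm]], of "\<lambda>n. 2 * n"]
      by (simp add: strict_mono_def comp_def)
    moreover have "(\<Sum>j<2 * n. P j) = cond_exp M (Fn (int n)) X \<omega> - cond_exp M (Fn (- int n)) X \<omega>" for n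
    proof (induct n)
      case (Suc n)
      have "(\<Sum>j<2 * Suc n. P j) = (\<Sum>j<2 * n. P j) + P (2 * n) + P (Suc (2 * n))" by simp
      also have "P (2 * n) = cond_exp M (Fn (- int n)) X \<omega> - cond_exp M (Fn (- int (Suc n))) X \<omega>"
      proof -
        have e: "- int (Suc n) = - int n - 1" by simp
        show ?thesis unfolding e by (simp add: P_def zigzag_def proj_P_def)
      qed
      also have "P (Suc (2 * n)) = cond_exp M (Fn (int (Suc n))) X \<omega> - cond_exp M (Fn (int n)) X \<omega>"
        by (simp add: P_def zigzag_def proj_P_def algebra_simps)
      finally show ?case using Suc by simp
    qed simp
    moreover have "(\<lambda>n. cond_exp M (Fn (int n)) X \<omega> - cond_exp M (Fn (- int n)) X \<omega>) \<longlonglongrightarrow> X \<omega> - 0"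
      using tendsto_diff[OF elim(4,5)] elim(2,3) by simp
    ultimately have "(\<Sum>j. P j) = X \<omega>" using LIMSEQ_unique by fastforce
    then have "P sums X \<omega>" using summable_norm_cancel[OF sm] by (simp add: sums_iff)
    with sm show ?case by (simp add: P_def[abs_def])
  qed
qed

end

section \<open>Summation over the decomposition\<close>

lemma (in mpt_filtration) measurable_S_sum_max_op:
  fixes f :: "'a \<Rightarrow> 'b::{banach, second_countable_topology}"
  assumes [measurable]: "f \<in> borel_measurable M"
  shows "S_sum \<theta> n f \<in> borel_measurable M" "max_op p \<theta> f \<in> borel_measurable M"
proof -
  have S[measurable]: "S_sum \<theta> n f \<in> borel_measurable M" for n
    unfolding S_sum_def[abs_def] by measurable
  then show "S_sum \<theta> n f \<in> borel_measurable M" .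
  show "max_op p \<theta> f \<in> borel_measurable M" unfolding max_op_def[abs_def] by measurable
qed

lemma (in prob_space) weak_Lp_norm_finite_imp_AE_finite:
  assumes [measurable]: "f \<in> borel_measurable M" and w: "weak_Lp_norm p M f \<le> ennreal N" and N: "0 \<le> N" and p: "1 < p"
  shows "AE \<omega> in M. f \<omega> < \<infinity>"
proof -
  define A where "A = {\<omega> \<in> space M. f \<omega> = \<infinity>}"
  have [measurable]: "A \<in> events" unfolding A_def by measurable
  have le: "prob A \<le> (N / real (Suc n)) powr p" for n
  proof -
    have "prob A \<le> prob {\<omega> \<in> space M. ennreal (real (Suc n)) < f \<omega>}"
      by (intro finite_measure_mono) (auto simp: A_def)
    also have "\<dots> \<le> (N / real (Suc n)) powr p" by (rule prob_le_weak_Lp_norm[OF w N p]) simp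
    finally show ?thesis .
  qed
  have "(\<lambda>n. (N / real (Suc n)) powr p) \<longlonglongrightarrow> 0 powr p"
    using p by (intro tendsto_powr2 lim_const_over_n[THEN LIMSEQ_Suc]) (auto simp: N)
  then have "prob A \<le> 0 powr p" using le by (intro LIMSEQ_le_const) auto
  then have "prob A = 0" by (simp add: measure_le_0_iff)
  then have "AE \<omega> in M. \<omega> \<notin> A" by (simp add: prob_eq_0)
  then show ?thesis using AE_space by eventually_elim (auto simp: A_def less_top)
qed

text \<open>The factor \<open>5/(p-1)\<close> comes from countable subadditivity of the weak norm, the other one from a
single orbit.\<close>

lemma C_univ_ge:
  assumes p: "1 < p" "p < r" "r \<le> 2"
  shows "5 / (p - 1) * (44 / ((p - 1) * (r - p))) \<le> C_univ p r" "0 < C_univ p r"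
proof -
  have "5 / (p - 1) * (44 / ((p - 1) * (r - p))) = 220 / ((p - 1)\<^sup>2 * (r - p))"
    by (simp add: power2_eq_square mult.assoc)
  also have "\<dots> \<le> 10000 / ((p - 1)\<^sup>2 * (r - p))" using p by (intro divide_right_mono) auto
  finally show "5 / (p - 1) * (44 / ((p - 1) * (r - p))) \<le> C_univ p r" by (simp add: C_univ_def)
  show "0 < C_univ p r" using p by (simp add: C_univ_def)
qed

theorem theorem2p8:
  fixes M F0 :: "'a measure"
    and \<theta> :: "'a \<Rightarrow> 'a"
    and X :: "'a \<Rightarrow> 'b::{banach, second_countable_topology}"
    and p r D :: real
  assumes "1 < p" and "p < r" and "r \<le> 2" and "0 < D"
    and "rD_smooth TYPE('b) r D"
    and "prob_space M"
    and "invertible_mpt M \<theta>"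
    and "subalgebra M F0"
    and "sets F0 \<subseteq> sets (filt M \<theta> F0 1)"
    and "in_Lp p M X"
    and "regular M \<theta> F0 X"
    and "Hp_norm p M \<theta> F0 X < \<infinity>"
  shows "0 < C_univ p r \<and>
    weak_Lp_norm p M (max_op p \<theta> X)
      \<le> ennreal (C_univ p r * D powr (r / p)) * Hp_norm p M \<theta> F0 X \<and>
    (AE \<omega> in M. (\<lambda>n. norm (S_sum \<theta> n X \<omega>) / real n powr (1 / p)) \<longlonglongrightarrow> 0)"
proof -
  note p = assms(1-3) and D = assms(4) and sm = assms(5) and reg = assms(11) and H = assms(12)
  interpret prob_space M by fact
  interpret mpt_filtration M \<theta> F0 by unfold_locales fact+
  have X: "integrable M X" using reg by (simp add: regular_def)
  define f where "f j = proj_P M \<theta> F0 (zigzag j) X" for j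
  have fi: "integrable M (f j)" for j unfolding f_def by (rule proj_P_props(2)[OF X])
  have fm[measurable]: "f j \<in> borel_measurable M" for j using fi by auto
  have Xm[measurable]: "X \<in> borel_measurable M" using X by auto
  note [measurable] = measurable_S_sum_max_op
  define L where "L j = enn2real (Lp_norm p M (f j))" for j
  have Lle: "(\<Sum>j. Lp_norm p M (f j)) \<le> Hp_norm p M \<theta> F0 X"
    unfolding f_def by (rule suminf_Lp_norm_proj_le[OF inj_zigzag])
  have Lfin: "Lp_norm p M (f j) < \<infinity>" for j
    by (rule le_less_trans[OF ennreal_le_suminf le_less_trans[OF Lle H]])
  then have L: "Lp_norm p M (f j) = ennreal (L j)" "0 \<le> L j" for j by (simp_all add: L_def)
  have Lsum: "summable L"
    using le_less_trans[OF Lle H] unfolding L(1) by (intro summable_suminf_not_top L(2)) auto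
  have SL: "(\<Sum>j. Lp_norm p M (f j)) = ennreal (suminf L)"
    unfolding L(1) by (intro suminf_ennreal2 L(2) Lsum)
  define K where "K = 44 / ((p - 1) * (r - p)) * D powr (r / p)"
  have K0: "0 \<le> K" using p by (simp add: K_def)
  have md: "mart_diff_seq M (\<lambda>i. filt M \<theta> F0 (zigzag j - 1 + int i)) (\<lambda>i \<omega>. f j ((\<theta> ^^ i) \<omega>))" for j
    using proj_P_props[OF X, of "zigzag j"] unfolding f_def by (intro mart_diff_seq_orbit) auto
  have id: "distr M borel (\<lambda>\<omega>. norm (f j ((\<theta> ^^ i) \<omega>))) = distr M borel (\<lambda>\<omega>. norm (f j ((\<theta> ^^ 0) \<omega>)))" for i j
    using distr_norm_orbit[OF fm, of j i] by simp
  have Lfin0: "Lp_norm p M (\<lambda>\<omega>. f j ((\<theta> ^^ 0) \<omega>)) < \<infinity>" for j using Lfin by simp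
  have w: "weak_Lp_norm p M (max_op p \<theta> (f j)) \<le> ennreal (K * L j)" for j
  proof -
    have "weak_Lp_norm p M (max_op p \<theta> (f j)) \<le> ennreal K * Lp_norm p M (f j)"
      using maximal_average_weak_type[OF sm D md id p Lfin0, of j]
      unfolding K_def max_op_def[abs_def] S_sum_def funpow_0 .
    also have "\<dots> = ennreal (K * L j)" using K0 by (simp add: L ennreal_mult)
    finally show ?thesis .
  qed
  have KL: "0 \<le> K * L j" "summable (\<lambda>j. K * L j)" for j
    using K0 L(2) Lsum by (auto intro: summable_mult)
  have p2: "p \<le> 2" using p by simp
  have dec: "AE \<omega> in M. \<forall>i. summable (\<lambda>j. norm (f j ((\<theta> ^^ i) \<omega>))) \<and> (\<lambda>j. f j ((\<theta> ^^ i) \<omega>)) sums X ((\<theta> ^^ i) \<omega>)"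
    unfolding AE_all_countable using AE_funpow_theta[OF regular_sums_proj[OF p(1) reg H]] by (simp add: f_def)
  have Ssums: "summable (\<lambda>j. norm (S_sum \<theta> n (f j) \<omega>)) \<and> norm (S_sum \<theta> n X \<omega>) \<le> (\<Sum>j. norm (S_sum \<theta> n (f j) \<omega>))"
    if *: "\<forall>i. summable (\<lambda>j. norm (f j ((\<theta> ^^ i) \<omega>))) \<and> (\<lambda>j. f j ((\<theta> ^^ i) \<omega>)) sums X ((\<theta> ^^ i) \<omega>)" for n \<omega>
  proof -
    have "summable (\<lambda>j. \<Sum>i<n. norm (f j ((\<theta> ^^ i) \<omega>)))" using * by (intro summable_sum) auto
    then have s: "summable (\<lambda>j. norm (S_sum \<theta> n (f j) \<omega>))"
      by (rule summable_comparison_test'[where N = 0]) (auto simp: S_sum_def intro: norm_sum)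
    have "(\<lambda>j. S_sum \<theta> n (f j) \<omega>) sums S_sum \<theta> n X \<omega>"
      unfolding S_sum_def using * by (intro sums_sum) auto
    then have "S_sum \<theta> n X \<omega> = (\<Sum>j. S_sum \<theta> n (f j) \<omega>)" by (simp add: sums_iff)
    with s summable_norm[OF s] show ?thesis by simp
  qed
  \<comment> \<open>The maximal function ranges over \<open>n \<ge> 1\<close>; for \<open>n = 0\<close> the quotient is \<open>0 / 0 = 0\<close>.\<close>
  have norm_le_max_op: "ennreal (norm (S_sum \<theta> n g \<omega>) / real n powr (1 / p)) \<le> max_op p \<theta> g \<omega>" for g :: "'a \<Rightarrow> 'b" and n \<omega>
  proof (cases "n = 0")
    case False
    then show ?thesis unfolding max_op_def by (intro SUP_upper) auto
  qed simp
  have max_le: "AE \<omega> in M. max_op p \<theta> X \<omega> \<le> (\<Sum>j. max_op p \<theta> (f j) \<omega>)"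
    using dec
  proof eventually_elim
    case (elim \<omega>)
    show ?case unfolding max_op_def[of p \<theta> X]
    proof (rule SUP_least)
      fix n :: nat
      define c where "c = real n powr (1 / p)"
      have c: "0 \<le> c" by (simp add: c_def)
      have s: "summable (\<lambda>j. norm (S_sum \<theta> n (f j) \<omega>) / c)" using Ssums[OF elim, of n] by (auto intro: summable_divide)
      have "norm (S_sum \<theta> n X \<omega>) / c \<le> (\<Sum>j. norm (S_sum \<theta> n (f j) \<omega>)) / c"
        using Ssums[OF elim, of n] c by (intro divide_right_mono) auto
      also have "\<dots> = (\<Sum>j. norm (S_sum \<theta> n (f j) \<omega>) / c)" using Ssums[OF elim, of n] by (simp add: suminf_divide)
      finally have "ennreal (norm (S_sum \<theta> n X \<omega>) / c) \<le> ennreal (\<Sum>j. norm (S_sum \<theta> n (f j) \<omega>) / c)" by (rule ennreal_leI)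
      also have "\<dots> = (\<Sum>j. ennreal (norm (S_sum \<theta> n (f j) \<omega>) / c))"
        using s c by (intro suminf_ennreal2[symmetric]) auto
      also have "\<dots> \<le> (\<Sum>j. max_op p \<theta> (f j) \<omega>)"
        unfolding c_def by (intro suminf_le norm_le_max_op) auto
      finally show "ennreal (norm (S_sum \<theta> n X \<omega>) / real n powr (1 / p)) \<le> (\<Sum>j. max_op p \<theta> (f j) \<omega>)" by (simp add: c_def)
    qed
  qed
  have "weak_Lp_norm p M (max_op p \<theta> X) \<le> ennreal (5 / (p - 1) * (\<Sum>j. K * L j))"
    by (rule weak_Lp_norm_le_suminf[where f = "\<lambda>j. max_op p \<theta> (f j)"]) (use p p2 KL w max_le in auto)
  also have "(\<Sum>j. K * L j) = K * suminf L" by (rule suminf_mult[OF Lsum])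
  also have "5 / (p - 1) * (K * suminf L) = (5 / (p - 1) * (44 / ((p - 1) * (r - p)))) * D powr (r / p) * suminf L"
    by (simp add: K_def)
  also have "ennreal \<dots> \<le> ennreal (C_univ p r * D powr (r / p) * suminf L)"
    using C_univ_ge(1)[OF p] suminf_nonneg[OF Lsum L(2)] by (intro ennreal_leI mult_right_mono) auto
  also have "\<dots> = ennreal (C_univ p r * D powr (r / p)) * (\<Sum>j. Lp_norm p M (f j))"
    unfolding SL using C_univ_ge(2)[OF p] suminf_nonneg[OF Lsum L(2)] by (intro ennreal_mult) auto
  also have "\<dots> \<le> ennreal (C_univ p r * D powr (r / p)) * Hp_norm p M \<theta> F0 X"
    by (intro mult_left_mono Lle) auto
  finally have weak: "weak_Lp_norm p M (max_op p \<theta> X) \<le> ennreal (C_univ p r * D powr (r / p)) * Hp_norm p M \<theta> F0 X" .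

  have "weak_Lp_norm p M (\<lambda>\<omega>. \<Sum>j. max_op p \<theta> (f j) \<omega>) \<le> ennreal (5 / (p - 1) * (\<Sum>j. K * L j))"
    by (rule weak_Lp_norm_le_suminf[where f = "\<lambda>j. max_op p \<theta> (f j)"]) (use p p2 KL w in auto)
  then have fin: "AE \<omega> in M. (\<Sum>j. max_op p \<theta> (f j) \<omega>) < \<infinity>"
  proof (rule weak_Lp_norm_finite_imp_AE_finite[rotated])
    show "0 \<le> 5 / (p - 1) * (\<Sum>j. K * L j)" using p suminf_nonneg[OF KL(2,1)] by (intro mult_nonneg_nonneg) auto
  qed (use p in auto)
  have single: "AE \<omega> in M. \<forall>j. (\<lambda>n. norm (S_sum \<theta> n (f j) \<omega>) / real n powr (1 / p)) \<longlonglongrightarrow> 0"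
    unfolding AE_all_countable S_sum_def by (intro allI average_tendsto_0[OF sm md id p Lfin0])
  \<comment> \<open>Each term tends to \<open>0\<close> and is dominated by its maximal function; as the maximal functions
    have a finite sum almost surely, limit and sum may be exchanged.\<close>
  have "AE \<omega> in M. (\<lambda>n. norm (S_sum \<theta> n X \<omega>) / real n powr (1 / p)) \<longlonglongrightarrow> 0"
    using dec fin single
  proof eventually_elim
    case (elim \<omega>)
    define a where "a j n = norm (S_sum \<theta> n (f j) \<omega>) / real n powr (1 / p)" for j n
    define B where "B j = enn2real (max_op p \<theta> (f j) \<omega>)" for j
    have mB: "max_op p \<theta> (f j) \<omega> = ennreal (B j)" for j
      using le_less_trans[OF ennreal_le_suminf elim(2)] by (simp add: B_def)
    have B0: "0 \<le> B j" for j by (simp add: B_def)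
    have Bs: "summable B" using elim(2) unfolding mB by (intro summable_suminf_not_top B0) auto
    have ab: "norm (a j n) \<le> B j" for j n
      using norm_le_max_op[of n "f j" \<omega>] B0[of j] unfolding mB by (simp add: a_def)
    have ev: "\<forall>\<^sub>F (k, n) in sequentially \<times>\<^sub>F sequentially. norm (a k n) \<le> B k"
      using ab by (intro always_eventually) auto
    have a0: "(\<lambda>n. a k n) \<longlonglongrightarrow> 0" for k using elim(3) by (simp add: a_def)
    have "((\<lambda>n. \<Sum>j. a j n) \<longlongrightarrow> (\<Sum>j. 0)) sequentially"
      using tannerys_theorem[OF a0 ev Bs sequentially_bot] by blast
    then have lim: "(\<lambda>n. \<Sum>j. a j n) \<longlonglongrightarrow> 0" by simp
    show ?case
    proof (rule tendsto_sandwich[OF _ _ tendsto_const lim])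
      show "\<forall>\<^sub>F n in sequentially. norm (S_sum \<theta> n X \<omega>) / real n powr (1 / p) \<le> (\<Sum>j. a j n)"
      proof (rule always_eventually, rule allI)
        fix n
        have "norm (S_sum \<theta> n X \<omega>) / real n powr (1 / p) \<le> (\<Sum>j. norm (S_sum \<theta> n (f j) \<omega>)) / real n powr (1 / p)"
          using Ssums[OF elim(1), of n] by (intro divide_right_mono) auto
        also have "\<dots> = (\<Sum>j. a j n)" unfolding a_def using Ssums[OF elim(1), of n] by (simp add: suminf_divide)
        finally show "norm (S_sum \<theta> n X \<omega>) / real n powr (1 / p) \<le> (\<Sum>j. a j n)" .
      qed
    qed auto
  qed
  with weak C_univ_ge(2)[OF p] show ?thesis by blast
qed

end
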